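(* Let $d,m\ge1$ be integers, let $H=\sum_{|\alpha|\le m}c_\alpha D^\alpha$ ($c_\alpha\in\mathbb{C}$) be an elliptic constant-coefficient differential operator of order $m$ on $\mathbb{R}^d$ with symbol $P(\xi)=\sum_{|\alpha|\le m}c_\alpha\xi^\alpha$, let $\delta>0$, $r>0$, let $\gamma\in\mathbb{N}^d$ be a multi-index, and let $(M_\beta)_{\beta\in\mathbb{N}^d}$ be a family of nonnegative real numbers. Then there is a constant $C$, depending only on $H,d,r,\delta,\gamma$ and $(M_\beta)$, such that for every open set $\Omega\subset\mathbb{R}^d$, every $V\in C^\infty(\Omega,\mathbb{C})$ with $\sup_\Omega|D^\beta V|\le M_\beta$ for all $\beta\in\mathbb{N}^d$, every $\lambda\in\mathbb{C}$ with $|\lambda|\ge1$, and every $\psi_\lambda\in C^\infty(\Omega,\mathbb{C})$ satisfying $(H+V)\psi_\lambda=\lambda\psi_\lambda$ on $\Omega$, $$\|D^\gamma\psi_\lambda\|_{L^\infty(\Omega_{-r})}\le C\,|\lambda|^{|\gamma|/m}\left(1+\mathcal{N}_\lambda^{1/2}\right)\|\psi_\lambda\|_{L^2(\Omega)},$$ where $\Omega_{-r}=\{x\in\Omega: B(x,r)\subset\Omega\}$ and $\mathcal{N}_\lambda=\#\{\xi\in\mathbb{Z}^d:\ |P(\xi)-\lambda|\le|\xi|^{m-1+\delta}\}$.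
   Context: Notation: $\mathbb{N}=\{0,1,2,\dots\}$; for a multi-index $\alpha\in\mathbb{N}^d$, $|\alpha|=\alpha_1+\dots+\alpha_d$, $D^\alpha=(-i\partial_{x_1})^{\alpha_1}\cdots(-i\partial_{x_d})^{\alpha_d}$ and $\xi^\alpha=\xi_1^{\alpha_1}\cdots\xi_d^{\alpha_d}$. $H$ is elliptic if $\sum_{|\alpha|=m}c_\alpha\xi^\alpha\ne0$ for all $\xi\in\mathbb{R}^d\setminus\{0\}$. $B(x,r)$ is the closed Euclidean ball of center $x$ and radius $r$. If $\mathcal{N}_\lambda=\infty$ or $\|\psi_\lambda\|_{L^2(\Omega)}=\infty$, the inequality is regarded as trivially true; the supremum over an empty set is $0$. *)

theory Defs
  imports "HOL-Probability.Essential_Supremum"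
begin

(* Multi-indices are functions 'n => nat on the index type of real^'n. The linear order on 'n
   plays the role of the numbering 1,...,d of the coordinates. *)

type_synonym 'n multi_index = "'n \<Rightarrow> nat"

definition mi_abs :: "'n::finite multi_index \<Rightarrow> nat" where
  "mi_abs \<alpha> = (\<Sum>i\<in>UNIV. \<alpha> i)"

definition mi_power :: "real^'n \<Rightarrow> 'n::finite multi_index \<Rightarrow> real" where
  "mi_power \<xi> \<alpha> = (\<Prod>i\<in>UNIV. (\<xi> $ i) ^ \<alpha> i)"

(* The sums over multi-indices below are genuine, as their index sets are finite. *)

lemma finite_mi_abs_le: "finite {\<alpha> :: 'n::finite multi_index. mi_abs \<alpha> \<le> m}"
proof (rule finite_subset)
  have "\<alpha> i \<le> mi_abs \<alpha>" for \<alpha> :: "'n multi_index" and i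
    unfolding mi_abs_def by (rule member_le_sum) simp_all
  then show "{\<alpha> :: 'n multi_index. mi_abs \<alpha> \<le> m} \<subseteq> (\<Pi>\<^sub>E i\<in>UNIV. {..m})"
    by (fastforce simp: PiE_UNIV_domain intro: le_trans)
qed (simp add: finite_PiE)

lemma finite_mi_abs_eq: "finite {\<alpha> :: 'n::finite multi_index. mi_abs \<alpha> = m}"
  by (rule finite_subset[OF _ finite_mi_abs_le[of m]]) auto

fun k_smooth_on :: "nat \<Rightarrow> 'a::real_normed_vector set \<Rightarrow> ('a \<Rightarrow> 'b::real_normed_vector) \<Rightarrow> bool" where
  "k_smooth_on 0 \<Omega> f \<longleftrightarrow> continuous_on \<Omega> f"
| "k_smooth_on (Suc k) \<Omega> f \<longleftrightarrow>
     (\<forall>x\<in>\<Omega>. f differentiable (at x)) \<and>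
     (\<forall>v. k_smooth_on k \<Omega> (\<lambda>x. frechet_derivative f (at x) v))"

(* Only meant for open sets: derivatives are taken in the full neighbourhood filter. *)

definition smooth_on :: "'a::real_normed_vector set \<Rightarrow> ('a \<Rightarrow> 'b::real_normed_vector) \<Rightarrow> bool" where
  "smooth_on \<Omega> f \<longleftrightarrow> (\<forall>k. k_smooth_on k \<Omega> f)"

definition partial_derivative ::
    "'n::finite \<Rightarrow> (real^'n \<Rightarrow> complex) \<Rightarrow> real^'n \<Rightarrow> complex" where
  "partial_derivative i f x = vector_derivative (\<lambda>t. f (x + t *\<^sub>R axis i 1)) (at 0)"

definition D_coord :: "'n::finite \<Rightarrow> (real^'n \<Rightarrow> complex) \<Rightarrow> real^'n \<Rightarrow> complex" where
  "D_coord i f = (\<lambda>x. - \<i> * partial_derivative i f x)"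

definition D_multi ::
    "'n::{finite,linorder} multi_index \<Rightarrow> (real^'n::{finite,linorder} \<Rightarrow> complex) \<Rightarrow> real^'n::{finite,linorder} \<Rightarrow> complex" where
  "D_multi \<alpha> f = foldr (\<lambda>i. D_coord i ^^ \<alpha> i) (sorted_list_of_set UNIV) f"

(* A differential operator of order at most m is given by its coefficient family c;
   coefficients of multi-indices longer than m are ignored. *)

definition diff_op ::
    "nat \<Rightarrow> ('n::{finite,linorder} multi_index \<Rightarrow> complex) \<Rightarrow>
     (real^'n::{finite,linorder} \<Rightarrow> complex) \<Rightarrow> real^'n::{finite,linorder} \<Rightarrow> complex" where
  "diff_op m c f x = (\<Sum>\<alpha> | mi_abs \<alpha> \<le> m. c \<alpha> * D_multi \<alpha> f x)"

definition symbol ::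
    "nat \<Rightarrow> ('n::finite multi_index \<Rightarrow> complex) \<Rightarrow> real^'n \<Rightarrow> complex" where
  "symbol m c \<xi> = (\<Sum>\<alpha> | mi_abs \<alpha> \<le> m. c \<alpha> * of_real (mi_power \<xi> \<alpha>))"

definition elliptic :: "nat \<Rightarrow> ('n::finite multi_index \<Rightarrow> complex) \<Rightarrow> bool" where
  "elliptic m c \<longleftrightarrow>
     (\<forall>\<xi> :: real^'n. \<xi> \<noteq> 0 \<longrightarrow> (\<Sum>\<alpha> | mi_abs \<alpha> = m. c \<alpha> * of_real (mi_power \<xi> \<alpha>)) \<noteq> 0)"

definition inner_region :: "'a::metric_space set \<Rightarrow> real \<Rightarrow> 'a set" where
  "inner_region \<Omega> r = {x \<in> \<Omega>. cball x r \<subseteq> \<Omega>}"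

(* Taking values in ennreal, the norm over the empty set (the bottom element) is 0. *)

definition Linf_norm :: "'a::euclidean_space set \<Rightarrow> ('a \<Rightarrow> complex) \<Rightarrow> ennreal" where
  "Linf_norm S f = esssup (lebesgue_on S) (\<lambda>x. ennreal (norm (f x)))"

(* L2_norm is meaningful under square_integrable_on, i.e. when the norm is finite. *)

definition square_integrable_on :: "('a::euclidean_space \<Rightarrow> complex) \<Rightarrow> 'a set \<Rightarrow> bool" where
  "square_integrable_on f S \<longleftrightarrow> set_integrable lebesgue S (\<lambda>x. (norm (f x))\<^sup>2)"

definition L2_norm :: "'a::euclidean_space set \<Rightarrow> ('a \<Rightarrow> complex) \<Rightarrow> real" where
  "L2_norm S f = sqrt (LINT x:S|lebesgue. (norm (f x))\<^sup>2)"

(* The exponent m - 1 + delta is positive for m >= 1 and delta > 0, so the convention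
   0 powr a = 0 gives the intended value at \<xi> = 0. *)

definition near_lattice_points ::
    "nat \<Rightarrow> ('n::finite multi_index \<Rightarrow> complex) \<Rightarrow> real \<Rightarrow> complex \<Rightarrow> (real^'n) set" where
  "near_lattice_points m c \<delta> z =
     {\<xi>. (\<forall>i. \<xi> $ i \<in> \<int>) \<and> norm (symbol m c \<xi> - z) \<le> norm \<xi> powr (real m - 1 + \<delta>)}"

end

theory Submission
  imports Defs
begin

text \<open>
Only a small ball around each point matters: after shrinking \<open>r\<close> to at most 1, a ball of radius \<open>r\<close> fits into
a period cube of side \<open>2 \<pi>\<close>, and the Fourier coefficients over that cube of a function supported in the
ball are indexed by the integer lattice. Multiply \<open>\<psi>\<close> by a cutoff \<open>\<phi>\<close> and write \<open>a\<^sub>\<phi>(\<xi>)\<close> for the coefficient of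
\<open>\<phi> \<psi>\<close>. Testing the equation \<open>(H + V) \<psi> = z \<psi>\<close> against \<open>\<phi>\<close> times the plane wave of frequency \<open>\<xi>\<close> and moving all
derivatives off \<open>\<psi>\<close> gives

  \<open>(P(\<xi>) - z) a\<^sub>\<phi>(\<xi>) = - (terms of degree at most m - 1 in \<xi>, with cutoffs \<phi>' obtained from \<phi> and V)\<close>.

If \<open>\<xi>\<close> is not one of the near lattice points, dividing by \<open>|P(\<xi>) - z| > |\<xi>|\<^sup>m\<^sup>-\<^sup>1\<^sup>+\<^sup>\<delta>\<close> gains a factor \<open>|\<xi>|\<close> to the
power \<open>- \<delta>\<close>, at the price of other cutoffs, whose derivatives are still controlled. Iterating, \<open>a\<^sub>\<phi>(\<xi>)\<close> decays like any
prescribed negative power of \<open>|\<xi>|\<close>, uniformly in \<open>V\<close>, \<open>z\<close>, \<open>\<psi>\<close> and the centre (lemma \<open>pairing_decay\<close>). On the finitely many near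
points there is no decay, but by ellipticity they satisfy \<open>|\<xi>| \<le> C |z|\<^sup>1\<^sup>/\<^sup>m\<close> (\<open>near_lattice_points_norm_le\<close>), so
Bessel's inequality and Cauchy-Schwarz bound their total contribution to the derivative \<open>D\<^sup>\<gamma>\<close> by
\<open>|z|\<close> to the power \<open>|\<gamma>| / m\<close>, times the square root of their number, times the local \<open>L\<^sup>2\<close> norm of \<open>\<psi>\<close>
(\<open>pairing_L2\<close>). Summing both contributions bounds \<open>D\<^sup>\<gamma> \<psi>\<close> at the centre, because the value there of a
continuous function supported in the cube is at most the normalised sum of the absolute values of its Fourier coefficients
(\<open>norm_le_sum_fourier_coeff\<close>).

Two devices make this work without Fourier inversion or infinitely smooth cutoffs. The bound by the sum of the coefficients
is obtained by integrating against powers of one nonnegative trigonometric polynomial with its only peak at the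
centre. And since a fixed number of iterations suffices, the cutoff need only be finitely often
differentiable; a power of \<open>max 0 (1 - 4 |y - x|\<^sup>2 / r\<^sup>2)\<close> will do.

The last reduction replaces \<open>\<delta>\<close> by \<open>min \<delta> (1/2)\<close>, which only shrinks the set of near points; the bound on
\<open>|\<xi>|\<close> for near points holds for such exponents, but can fail when \<open>\<delta> \<ge> 1\<close>.
\<close>

section \<open>Coordinate derivatives and functions with bounded derivatives\<close>

lemma has_vector_derivative_along:
  fixes f :: "'a::real_normed_vector \<Rightarrow> 'b::real_normed_vector"
  assumes "(f has_derivative f') (at (x + t *\<^sub>R e))"
  shows "((\<lambda>s. f (x + s *\<^sub>R e)) has_vector_derivative f' e) (at t)"
proof -
  have line: "((\<lambda>s::real. x + s *\<^sub>R e) has_derivative (\<lambda>s. s *\<^sub>R e)) (at t)"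
    by (auto intro!: derivative_eq_intros)
  have "((\<lambda>s. f (x + s *\<^sub>R e)) has_derivative (\<lambda>s. f' (s *\<^sub>R e))) (at t)"
    using diff_chain_at[OF line, of f f'] assms by (simp add: o_def)
  moreover have "f' (s *\<^sub>R e) = s *\<^sub>R f' e" for s
    using assms by (simp add: has_derivative_bounded_linear bounded_linear.linear linear_scale)
  ultimately show ?thesis
    by (simp add: has_vector_derivative_def)
qed

lemma D_coord_has_derivative:
  assumes "(f has_derivative f') (at x)"
  shows "D_coord i f x = - \<i> * f' (axis i 1)"
  using has_vector_derivative_along[of f f' x 0 "axis i 1"] assms
  by (simp add: D_coord_def partial_derivative_def vector_derivative_at)

lemma D_coord_eq:
  "f differentiable (at x) \<Longrightarrow> D_coord i f x = - \<i> * frechet_derivative f (at x) (axis i 1)"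
  by (rule D_coord_has_derivative) (simp add: frechet_derivative_works)

lemma differentiable_cong_open:
  assumes "open U" "x \<in> U" "\<And>y. y \<in> U \<Longrightarrow> f y = g y" "f differentiable (at x)"
  shows "g differentiable (at x)"
  using assms has_derivative_transform_within_open[of f _ x UNIV U g]
  unfolding differentiable_def by auto

lemma D_coord_cong:
  assumes U: "open U" "x \<in> U" and eq: "\<And>y. y \<in> U \<Longrightarrow> f y = g y"
  shows "D_coord i f x = D_coord i g x"
proof -
  have "((\<lambda>t. x + t *\<^sub>R axis i 1) \<longlongrightarrow> x + 0 *\<^sub>R axis i 1) (nhds (0::real))"
    by (intro tendsto_intros filterlim_ident)
  then have ev: "\<forall>\<^sub>F t in nhds (0::real). x + t *\<^sub>R axis i 1 \<in> U"
    using U by (auto dest: topological_tendstoD)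
  have "vector_derivative (\<lambda>t. f (x + t *\<^sub>R axis i 1)) (at 0)
      = vector_derivative (\<lambda>t. g (x + t *\<^sub>R axis i 1)) (at 0)"
    by (rule vector_derivative_cong_eq) (auto intro: eventually_mono[OF ev] eq)
  then show ?thesis by (simp add: D_coord_def partial_derivative_def)
qed

lemma D_coord_add:
  assumes "f differentiable (at x)" "g differentiable (at x)"
  shows "D_coord i (\<lambda>y. f y + g y) x = D_coord i f x + D_coord i g x"
proof -
  from assms obtain f' g' where f: "(f has_derivative f') (at x)" and g: "(g has_derivative g') (at x)"
    by (auto simp: differentiable_def)
  show ?thesis
    unfolding D_coord_has_derivative[OF f] D_coord_has_derivative[OF g]
      D_coord_has_derivative[OF has_derivative_add[OF f g]] by (simp add: algebra_simps)
qed

lemma D_coord_mult: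
  assumes "f differentiable (at x)" "g differentiable (at x)"
  shows "D_coord i (\<lambda>y. f y * g y) x = D_coord i f x * g x + f x * D_coord i g x"
proof -
  from assms obtain f' g' where f: "(f has_derivative f') (at x)" and g: "(g has_derivative g') (at x)"
    by (auto simp: differentiable_def)
  show ?thesis
    unfolding D_coord_has_derivative[OF f] D_coord_has_derivative[OF g]
      D_coord_has_derivative[OF has_derivative_mult[OF f g]] by (simp add: algebra_simps)
qed

lemma D_coord_const: "D_coord i (\<lambda>y. c) x = 0"
  using D_coord_has_derivative[OF has_derivative_const] by simp

lemma D_coord_vanish:
  assumes "closed K" "\<And>y. y \<notin> K \<Longrightarrow> f y = 0" "x \<notin> K"
  shows "D_coord i f x = 0"
  using D_coord_cong[of "- K" x f "\<lambda>_. 0" i] assms by (auto simp: D_coord_const)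

text \<open>
Class \<open>C\<^sup>k\<close> on \<open>U\<close>, with all derivatives of order \<open>n \<le> k\<close> bounded by \<open>A n\<close>. The bounds
are part of the predicate because constants must depend on them alone, and they are indexed by the order only so
that differentiating a function just shifts \<open>A\<close>.
\<close>

fun C_bounded :: "nat \<Rightarrow> (nat \<Rightarrow> real) \<Rightarrow> (real^'n::finite) set \<Rightarrow> (real^'n \<Rightarrow> complex) \<Rightarrow> bool" where
  "C_bounded 0 A U f \<longleftrightarrow> continuous_on U f \<and> (\<forall>x\<in>U. norm (f x) \<le> A 0)"
| "C_bounded (Suc k) A U f \<longleftrightarrow>
     (\<forall>x\<in>U. f differentiable (at x)) \<and> (\<forall>x\<in>U. norm (f x) \<le> A 0) \<and>
     (\<forall>i. C_bounded k (\<lambda>n. A (Suc n)) U (D_coord i f))"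

lemma C_bounded_norm: "C_bounded k A U f \<Longrightarrow> x \<in> U \<Longrightarrow> norm (f x) \<le> A 0"
  by (cases k) auto

lemma C_bounded_continuous: "C_bounded k A U f \<Longrightarrow> continuous_on U f"
  by (cases k) (auto intro!: continuous_at_imp_continuous_on simp: differentiable_imp_continuous_within)

lemma C_bounded_Suc: "C_bounded (Suc k) A U f \<Longrightarrow> C_bounded k A U f"
proof (induction k arbitrary: A f)
  case 0
  then show ?case using C_bounded_continuous[OF 0] by simp
next
  case (Suc k)
  then show ?case by (metis C_bounded.simps(2))
qed

lemma C_bounded_le: "C_bounded k A U f \<Longrightarrow> j \<le> k \<Longrightarrow> C_bounded j A U f"
  by (induction k) (metis le_0_eq, metis C_bounded_Suc le_Suc_eq)

lemma C_bounded_subset: "C_bounded k A U f \<Longrightarrow> W \<subseteq> U \<Longrightarrow> C_bounded k A W f"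
  by (induction k arbitrary: A f) (auto intro: continuous_on_subset)

lemma C_bounded_cong:
  assumes "open U" "C_bounded k A U f" "\<And>y. y \<in> U \<Longrightarrow> f y = g y"
  shows "C_bounded k A U g"
  using assms(2,3)
proof (induction k arbitrary: A f g)
  case 0
  then show ?case by (auto cong: continuous_on_cong)
next
  case (Suc k)
  have "C_bounded k (\<lambda>n. A (Suc n)) U (D_coord i g)" for i
    by (rule Suc.IH[of _ "D_coord i f"])
      (use Suc.prems(1) in simp, rule D_coord_cong[OF assms(1) _ Suc.prems(2)])
  moreover have "g differentiable (at x)" if "x \<in> U" for x
    using differentiable_cong_open[OF assms(1) that Suc.prems(2)] Suc.prems(1) that by simp
  ultimately show ?case using Suc.prems(1) by (simp flip: Suc.prems(2))
qed

lemma C_bounded_add: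
  assumes "open U" "C_bounded k A U f" "C_bounded k B U g"
  shows "C_bounded k (\<lambda>n. A n + B n) U (\<lambda>y. f y + g y)"
  using assms(2,3)
proof (induction k arbitrary: A B f g)
  case 0
  then show ?case by (auto intro!: continuous_intros norm_triangle_mono)
next
  case (Suc k)
  have "C_bounded k (\<lambda>n. A (Suc n) + B (Suc n)) U (D_coord i (\<lambda>y. f y + g y))" for i
    by (rule C_bounded_cong[OF assms(1) Suc.IH[of "\<lambda>n. A (Suc n)" "D_coord i f" "\<lambda>n. B (Suc n)" "D_coord i g"]])
      (use Suc.prems in \<open>auto simp: D_coord_add\<close>)
  then show ?case using Suc.prems by (auto intro!: norm_triangle_mono)
qed

text \<open>
Unfolded, this is the sum of \<open>(n choose j) A j B (n - j)\<close>; the recursion is the product rule itself.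
\<close>

primrec leibniz_bound :: "nat \<Rightarrow> (nat \<Rightarrow> real) \<Rightarrow> (nat \<Rightarrow> real) \<Rightarrow> real" where
  "leibniz_bound 0 A B = A 0 * B 0"
| "leibniz_bound (Suc n) A B = leibniz_bound n (\<lambda>j. A (Suc j)) B + leibniz_bound n A (\<lambda>j. B (Suc j))"

lemma C_bounded_mult:
  assumes "open U" "C_bounded k A U f" "C_bounded k B U g"
  shows "C_bounded k (\<lambda>n. leibniz_bound n A B) U (\<lambda>y. f y * g y)"
  using assms(2,3)
proof (induction k arbitrary: A B f g)
  case 0
  then show ?case
    by (auto intro!: continuous_intros simp: norm_mult intro!: mult_mono intro: order_trans[OF norm_ge_zero])
next
  case (Suc k)
  have "C_bounded k (\<lambda>n. leibniz_bound (Suc n) A B) U (D_coord i (\<lambda>y. f y * g y))" for i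
  proof (rule C_bounded_cong[OF assms(1)])
    show "C_bounded k (\<lambda>n. leibniz_bound (Suc n) A B) U (\<lambda>y. D_coord i f y * g y + f y * D_coord i g y)"
      unfolding leibniz_bound.simps using Suc.prems Suc.prems[THEN C_bounded_Suc]
      by (intro C_bounded_add[OF assms(1)] Suc.IH) auto
  qed (use Suc.prems in \<open>auto simp: D_coord_mult\<close>)
  moreover have "norm (f x * g x) \<le> A 0 * B 0" if "x \<in> U" for x
    using Suc.prems that by (auto simp: norm_mult intro!: mult_mono intro: order_trans[OF norm_ge_zero])
  ultimately show ?case using Suc.prems by auto
qed

lemma C_bounded_const: "C_bounded k (\<lambda>n. norm c) U (\<lambda>y. c)"
proof (induction k arbitrary: c)
  case (Suc k)
  have "C_bounded k (\<lambda>n. norm c) U (\<lambda>_. 0)" 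
  proof -
    have "C_bounded k (\<lambda>n. B) U (\<lambda>_. 0)" if "B \<ge> 0" for B
      using that by (induction k) (auto simp: D_coord_const[abs_def])
    then show ?thesis by simp
  qed
  then show ?case by (auto simp: D_coord_const[abs_def])
qed auto

text \<open>
Derivatives along a word of coordinates: integration by parts produces derivatives of \<open>V\<close> in every order, not only in the
sorted order of \<open>D_multi\<close>.
\<close>

definition iter_D :: "'n::finite list \<Rightarrow> (real^'n \<Rightarrow> complex) \<Rightarrow> real^'n \<Rightarrow> complex" where
  "iter_D l f = foldr D_coord l f"

lemma iter_D_Nil [simp]: "iter_D [] f = f"
  and iter_D_Cons [simp]: "iter_D (i # l) f = D_coord i (iter_D l f)"
  and iter_D_append: "iter_D (l @ l') f = iter_D l (iter_D l' f)"
  by (simp_all add: iter_D_def)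

lemma k_smooth_on_cong:
  assumes "open U" "k_smooth_on k U f" "\<And>y. y \<in> U \<Longrightarrow> f y = g y"
  shows "k_smooth_on k U g"
  using assms(2,3)
proof (induction k arbitrary: f g)
  case 0
  then show ?case by (auto cong: continuous_on_cong)
next
  case (Suc k)
  have *: "frechet_derivative f (at x) = frechet_derivative g (at x)" if "x \<in> U" for x
    by (rule frechet_derivative_transform_within_open[OF _ assms(1) that]) (use Suc.prems that in auto)
  have "k_smooth_on k U (\<lambda>x. frechet_derivative g (at x) v)" for v
    by (rule Suc.IH[of "\<lambda>x. frechet_derivative f (at x) v"]) (use Suc.prems * in auto)
  moreover have "g differentiable (at x)" if "x \<in> U" for x
    using differentiable_cong_open[OF assms(1) that Suc.prems(2)] Suc.prems(1) that by simp
  ultimately show ?case by auto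
qed

lemma k_smooth_on_cmult:
  fixes f :: "'a::real_normed_vector \<Rightarrow> complex"
  assumes "open U" "k_smooth_on k U f"
  shows "k_smooth_on k U (\<lambda>y. c * f y)"
  using assms(2)
proof (induction k arbitrary: f)
  case 0
  then show ?case by (auto intro!: continuous_intros)
next
  case (Suc k)
  have *: "frechet_derivative (\<lambda>y. c * f y) (at x) = (\<lambda>v. c * frechet_derivative f (at x) v)" if "x \<in> U" for x
    by (rule frechet_derivative_at[symmetric])
      (use Suc.prems that in \<open>auto intro!: has_derivative_mult_right simp: frechet_derivative_works\<close>)
  have "k_smooth_on k U (\<lambda>x. frechet_derivative (\<lambda>y. c * f y) (at x) v)" for v
    by (rule k_smooth_on_cong[OF assms(1) Suc.IH[of "\<lambda>x. frechet_derivative f (at x) v"]])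
      (use Suc.prems * in auto)
  then show ?case using Suc.prems by auto
qed

lemma smooth_on_differentiable: "smooth_on U f \<Longrightarrow> x \<in> U \<Longrightarrow> f differentiable (at x)"
  unfolding smooth_on_def by (metis k_smooth_on.simps(2))

lemma smooth_on_continuous: "smooth_on U f \<Longrightarrow> continuous_on U f"
  unfolding smooth_on_def by (metis k_smooth_on.simps(1))

lemma smooth_on_D_coord:
  assumes "open U" "smooth_on U f"
  shows "smooth_on U (D_coord i f)"
  unfolding smooth_on_def
proof
  fix k
  have "k_smooth_on (Suc k) U f" using assms(2) by (auto simp: smooth_on_def simp del: k_smooth_on.simps)
  then have "k_smooth_on k U (\<lambda>x. - \<i> * frechet_derivative f (at x) (axis i 1))"
    by (intro k_smooth_on_cmult assms) auto
  then show "k_smooth_on k U (D_coord i f)"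
    by (rule k_smooth_on_cong[OF assms(1)])
      (simp add: D_coord_eq smooth_on_differentiable[OF assms(2)])
qed

lemma smooth_on_subset: 
  assumes "smooth_on U f" "W \<subseteq> U"
  shows "smooth_on W f"
proof -
  have "k_smooth_on k U f \<Longrightarrow> k_smooth_on k W f" for k
    using assms(2) by (induction k arbitrary: f) (auto intro: continuous_on_subset)
  then show ?thesis using assms(1) by (auto simp: smooth_on_def)
qed

lemma smooth_on_iter_D: "open U \<Longrightarrow> smooth_on U f \<Longrightarrow> smooth_on U (iter_D l f)"
  by (induction l) (auto intro: smooth_on_D_coord)

section \<open>Symmetry of mixed derivatives\<close>

text \<open>
The second difference of \<open>f\<close> along \<open>u\<close> and \<open>v\<close> is the increment over \<open>[0, h]\<close> of
\<open>s \<mapsto> f (x + s u + h v) - f (x + s u)\<close>, whose derivative compares \<open>f' u\<close> at two nearby points and so is \<open>h L v\<close> up to \<open>o(h)\<close>;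
the mean value inequality turns this into an error \<open>o(h\<^sup>2)\<close>.
\<close>

lemma second_difference_estimate:
  fixes f :: "'a::real_normed_vector \<Rightarrow> 'b::real_normed_vector"
  assumes "open U" "x \<in> U"
    and f: "\<And>y. y \<in> U \<Longrightarrow> (f has_derivative f' y) (at y)"
    and f2: "((\<lambda>y. f' y u) has_derivative L) (at x)"
    and "e > 0"
  shows "\<exists>d>0. \<forall>h. 0 < h \<and> h < d \<longrightarrow>
    norm (f (x + h *\<^sub>R u + h *\<^sub>R v) - f (x + h *\<^sub>R u) - f (x + h *\<^sub>R v) + f x - (h * h) *\<^sub>R L v) \<le> e * h * h"
proof -
  define K where "K = norm u + norm v + 1"
  have K: "K > 0" by (simp add: K_def add_nonneg_pos)
  interpret L: bounded_linear L using f2 by (rule has_derivative_bounded_linear)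
  define e' where "e' = e / (2 * K)"
  have e': "e' > 0" using \<open>e > 0\<close> K by (simp add: e'_def)
  from f2 e' obtain d1 where d1: "d1 > 0"
    "\<And>y. norm (y - x) < d1 \<Longrightarrow> norm (f' y u - f' x u - L (y - x)) \<le> e' * norm (y - x)"
    unfolding has_derivative_at_alt by blast
  from assms(1,2) obtain d2 where d2: "d2 > 0" "ball x d2 \<subseteq> U"
    by (meson openE)
  \<comment> \<open>for \<open>h < d\<close> the parallelogram spanned by \<open>h u\<close> and \<open>h v\<close> stays within distance \<open>min d1 d2\<close> of \<open>x\<close>\<close>
  define d where "d = min d1 d2 / K"
  have d: "d > 0" using d1 d2 K by (simp add: d_def)
  have "norm (f (x + h *\<^sub>R u + h *\<^sub>R v) - f (x + h *\<^sub>R u) - f (x + h *\<^sub>R v) + f x - (h * h) *\<^sub>R L v) \<le> e * h * h"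
    if h: "0 < h" "h < d" for h
  proof -
    have hK: "h * K < d1" "h * K < d2"
      using h K by (auto simp: d_def field_simps min_def split: if_splits)
    have near: "norm (s *\<^sub>R u + t *\<^sub>R v) \<le> h * K" if "s \<in> {0..h}" "t \<in> {0..h}" for s t
    proof -
      have "norm (s *\<^sub>R u + t *\<^sub>R v) \<le> s * norm u + t * norm v"
        using that by (intro norm_triangle_le) auto
      also have "\<dots> \<le> h * norm u + h * norm v"
        using that by (intro add_mono mult_right_mono) auto
      also have "\<dots> \<le> h * K" using h by (simp add: K_def algebra_simps)
      finally show ?thesis .
    qed
    define \<phi> where "\<phi> s = f (x + (s *\<^sub>R u + h *\<^sub>R v)) - f (x + (s *\<^sub>R u + 0 *\<^sub>R v)) - (s * h) *\<^sub>R L v" for s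
    define \<phi>' where "\<phi>' s = f' (x + (s *\<^sub>R u + h *\<^sub>R v)) u - f' (x + (s *\<^sub>R u + 0 *\<^sub>R v)) u - h *\<^sub>R L v" for s
    have inU: "x + (s *\<^sub>R u + t *\<^sub>R v) \<in> U" if "s \<in> {0..h}" "t \<in> {0..h}" for s t
      using near[OF that] hK(2)
      by (intro subsetD[OF d2(2)]) (metis add_diff_cancel_left' dist_commute dist_norm le_less_trans mem_ball)
    have der1: "((\<lambda>s. f (x + (s *\<^sub>R u + t *\<^sub>R v))) has_derivative (\<lambda>k. k *\<^sub>R f' (x + (s *\<^sub>R u + t *\<^sub>R v)) u)) (at s within {0..h})"
      if "s \<in> {0..h}" "t \<in> {0..h}" for s t
    proof -
      have "((\<lambda>s. f (x + (s *\<^sub>R u + t *\<^sub>R v))) has_derivative (\<lambda>k. f' (x + (s *\<^sub>R u + t *\<^sub>R v)) (k *\<^sub>R u))) (at s within {0..h})"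
        by (rule has_derivative_compose[of "\<lambda>s. x + (s *\<^sub>R u + t *\<^sub>R v)" _ _ _ f, OF _ f[OF inU[OF that]]])
          (auto intro!: derivative_eq_intros)
      moreover have "linear (f' (x + (s *\<^sub>R u + t *\<^sub>R v)))"
        using f[OF inU[OF that]] by (simp add: has_derivative_bounded_linear bounded_linear.linear)
      ultimately show ?thesis by (simp add: linear_scale)
    qed
    have der: "(\<phi> has_derivative (\<lambda>k. k *\<^sub>R \<phi>' s)) (at s within {0..h})" if "s \<in> {0..h}" for s
    proof -
      have "((\<lambda>s. (s * h) *\<^sub>R L v) has_derivative (\<lambda>k. (k * h) *\<^sub>R L v)) (at s within {0..h})"
        by (auto intro!: derivative_eq_intros)
      from has_derivative_diff[OF has_derivative_diff[OF der1[OF that, of h] der1[OF that, of 0]] this]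
      show ?thesis unfolding \<phi>_def \<phi>'_def using h by (simp add: algebra_simps)
    qed
    have bd: "norm (\<phi>' s) \<le> e * h" if s: "s \<in> {0..h}" for s
    proof -
      have a: "norm (f' (x + (s *\<^sub>R u + t *\<^sub>R v)) u - f' x u - L (s *\<^sub>R u + t *\<^sub>R v)) \<le> e' * (h * K)" if "t \<in> {0..h}" for t
        using d1(2)[of "x + (s *\<^sub>R u + t *\<^sub>R v)"] near[OF s that] hK e'
        by (auto intro!: order_trans[OF _ mult_left_mono[OF near[OF s that]]])
      have eq: "\<phi>' s = (f' (x + (s *\<^sub>R u + h *\<^sub>R v)) u - f' x u - L (s *\<^sub>R u + h *\<^sub>R v)) - (f' (x + (s *\<^sub>R u + 0 *\<^sub>R v)) u - f' x u - L (s *\<^sub>R u + 0 *\<^sub>R v))"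
        unfolding \<phi>'_def by (simp add: L.add L.scaleR)
      have "norm (\<phi>' s) \<le> e' * (h * K) + e' * (h * K)"
        unfolding eq by (rule order_trans[OF norm_triangle_ineq4]) (intro add_mono a, use h in auto)
      also have "\<dots> = e * h" using K by (simp add: e'_def field_simps)
      finally show ?thesis .
    qed
    have "norm (\<phi> h - \<phi> 0) \<le> (e * h) * norm (h - 0)"
    proof (rule differentiable_bound[of "{0..h}" \<phi> "\<lambda>s k. k *\<^sub>R \<phi>' s"])
      fix s assume "s \<in> {0..h}"
      then show "onorm (\<lambda>k. k *\<^sub>R \<phi>' s) \<le> e * h"
        using bd by (intro onorm_le) (auto intro: mult_left_mono simp: mult.commute)
    qed (use der h in auto)
    then show ?thesis using h by (simp add: \<phi>_def algebra_simps)
  qed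
  then show ?thesis using d by blast
qed

text \<open>
The second difference is symmetric in \<open>u\<close> and \<open>v\<close>, so both \<open>L v\<close> and \<open>M u\<close> are its limit after division by \<open>h\<^sup>2\<close>.
\<close>

lemma mixed_derivatives_commute:
  fixes f :: "'a::real_normed_vector \<Rightarrow> 'b::real_normed_vector"
  assumes "open U" "x \<in> U"
    and f: "\<And>y. y \<in> U \<Longrightarrow> (f has_derivative f' y) (at y)"
    and fu: "((\<lambda>y. f' y u) has_derivative L) (at x)"
    and fv: "((\<lambda>y. f' y v) has_derivative M) (at x)"
  shows "L v = M u"
proof (rule ccontr)
  assume ne: "L v \<noteq> M u"
  define e where "e = norm (L v - M u) / 3"
  have e: "e > 0" using ne by (simp add: e_def)
  obtain d1 where d1: "d1 > 0" "\<And>h. 0 < h \<and> h < d1 \<Longrightarrow>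
    norm (f (x + h *\<^sub>R u + h *\<^sub>R v) - f (x + h *\<^sub>R u) - f (x + h *\<^sub>R v) + f x - (h * h) *\<^sub>R L v) \<le> e * h * h"
    using second_difference_estimate[OF assms(1-3) fu e, of v] by blast
  obtain d2 where d2: "d2 > 0" "\<And>h. 0 < h \<and> h < d2 \<Longrightarrow>
    norm (f (x + h *\<^sub>R v + h *\<^sub>R u) - f (x + h *\<^sub>R v) - f (x + h *\<^sub>R u) + f x - (h * h) *\<^sub>R M u) \<le> e * h * h"
    using second_difference_estimate[OF assms(1-3) fv e, of u] by blast
  define h where "h = min d1 d2 / 2"
  have h: "0 < h" "h < d1" "h < d2" using d1(1) d2(1) by (auto simp: h_def)
  define D where "D = f (x + h *\<^sub>R u + h *\<^sub>R v) - f (x + h *\<^sub>R u) - f (x + h *\<^sub>R v) + f x"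
  have "norm (D - (h * h) *\<^sub>R L v) \<le> e * h * h" using d1(2)[of h] h by (simp add: D_def)
  moreover have "norm (D - (h * h) *\<^sub>R M u) \<le> e * h * h" using d2(2)[of h] h
    by (simp add: D_def algebra_simps)
  ultimately have "norm ((D - (h * h) *\<^sub>R M u) - (D - (h * h) *\<^sub>R L v)) \<le> e * h * h + e * h * h"
    by (meson add_mono norm_triangle_ineq4 order_trans)
  also have "(D - (h * h) *\<^sub>R M u) - (D - (h * h) *\<^sub>R L v) = (h * h) *\<^sub>R (L v - M u)"
    by (simp add: algebra_simps)
  also have "norm ((h * h) *\<^sub>R (L v - M u)) = h * h * (3 * e)"
    unfolding norm_scaleR by (simp add: e_def)
  finally have "h * h * (3 * e) \<le> h * h * (2 * e)" by (simp add: algebra_simps)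
  then show False using h e by simp
qed

lemma D_coord_commute:
  assumes U: "open U" "x \<in> U" and f: "smooth_on U f"
  shows "D_coord i (D_coord j f) x = D_coord j (D_coord i f) x"
proof -
  let ?f' = "\<lambda>y. frechet_derivative f (at y)"
  have f': "(f has_derivative ?f' y) (at y)" if "y \<in> U" for y
    using smooth_on_differentiable[OF f that] by (simp add: frechet_derivative_works)
  have "k_smooth_on (Suc (Suc 0)) U f" using f by (auto simp: smooth_on_def simp del: k_smooth_on.simps)
  then have d: "((\<lambda>y. ?f' y u) has_derivative frechet_derivative (\<lambda>y. ?f' y u) (at x)) (at x)" for u
    using U by (simp add: frechet_derivative_works)
  have D2: "D_coord i (D_coord j f) x = - frechet_derivative (\<lambda>y. ?f' y (axis j 1)) (at x) (axis i 1)" for i j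
  proof -
    have "D_coord i (D_coord j f) x = D_coord i (\<lambda>y. - \<i> * ?f' y (axis j 1)) x"
      by (rule D_coord_cong[OF U]) (simp add: D_coord_eq smooth_on_differentiable[OF f])
    also have "\<dots> = - \<i> * (- \<i> * frechet_derivative (\<lambda>y. ?f' y (axis j 1)) (at x) (axis i 1))"
      by (rule D_coord_has_derivative) (intro has_derivative_mult_right d)
    finally show ?thesis by (simp add: mult.assoc[symmetric])
  qed
  show ?thesis
    unfolding D2 using mixed_derivatives_commute[OF U f' d d] by simp
qed

lemma iter_D_swap:
  assumes U: "open U" and f: "smooth_on U f"
  shows "x \<in> U \<Longrightarrow> iter_D (p @ [i]) f x = iter_D (i # p) f x"
proof (induction p arbitrary: x)
  case (Cons j p)
  have "iter_D ((j # p) @ [i]) f x = D_coord j (D_coord i (iter_D p f)) x"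
    using D_coord_cong[OF U Cons.prems, of "iter_D (p @ [i]) f" "iter_D (i # p) f"] Cons.IH by auto
  also have "\<dots> = iter_D (i # j # p) f x"
    using D_coord_commute[OF U Cons.prems smooth_on_iter_D[OF U f]] by simp
  finally show ?case .
qed simp

text \<open>
By symmetry of mixed derivatives the first letter of one word can be moved to the front of the other.
\<close>

lemma iter_D_mset:
  assumes U: "open U" and f: "smooth_on U f"
  shows "mset l = mset l' \<Longrightarrow> x \<in> U \<Longrightarrow> iter_D l f x = iter_D l' f x"
proof (induction l arbitrary: l' x)
  case (Cons i k)
  have "i \<in> set l'" using Cons.prems(1) by (metis list.set_intros(1) mset_eq_setD)
  then obtain p q where l': "l' = p @ i # q" by (auto simp: in_set_conv_decomp)
  then have k: "mset k = mset (p @ q)" using Cons.prems by simp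
  have "iter_D l' f x = iter_D (p @ [i]) (iter_D q f) x" by (simp add: l' iter_D_append)
  also have "\<dots> = D_coord i (iter_D (p @ q) f) x"
    using iter_D_swap[OF U smooth_on_iter_D[OF U f] Cons.prems(2)] by (simp add: iter_D_append)
  also have "\<dots> = D_coord i (iter_D k f) x"
    by (rule D_coord_cong[OF U Cons.prems(2)]) (use Cons.IH[OF k] in auto)
  finally show ?case by simp
qed auto

definition mi_list :: "'n::{finite,linorder} multi_index \<Rightarrow> 'n list" where
  "mi_list \<alpha> = concat (map (\<lambda>i. replicate (\<alpha> i) i) (sorted_list_of_set UNIV))"

lemma D_multi_eq_iter_D: "D_multi \<alpha> f = iter_D (mi_list \<alpha>) f"
proof -
  have rep: "(D_coord i ^^ n) f = iter_D (replicate n i) f" for i :: "'n::{finite,linorder}" and n f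
    by (induction n) auto
  have "foldr (\<lambda>i. D_coord i ^^ \<alpha> i) L f = iter_D (concat (map (\<lambda>i. replicate (\<alpha> i) i) L)) f" for L
    by (induction L) (simp_all add: rep iter_D_append)
  then show ?thesis by (simp add: D_multi_def mi_list_def)
qed

lemma count_mi_list: "count (mset (mi_list \<alpha>)) i = \<alpha> i"
proof -
  have *: "distinct L \<Longrightarrow> count (mset (concat (map (\<lambda>i. replicate (\<alpha> i) i) L))) i = (if i \<in> set L then \<alpha> i else 0)" for L
    by (induction L) auto
  show ?thesis using *[of "sorted_list_of_set UNIV"] by (simp add: mi_list_def)
qed

lemma mi_list_count: "mset (mi_list (count (mset l))) = mset l"
  by (rule multiset_eqI) (simp add: count_mi_list)

lemma length_mi_list: "length (mi_list \<alpha>) = mi_abs \<alpha>"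
proof -
  have "sum_list (map \<alpha> (sorted_list_of_set UNIV)) = sum \<alpha> UNIV"
    by (subst sum_list_distinct_conv_sum_set) auto
  then show ?thesis
    by (simp add: mi_list_def mi_abs_def length_concat o_def)
qed

lemma C_bounded_iter_D:
  assumes U: "open U" and f: "smooth_on U f" and A: "\<And>l x. x \<in> U \<Longrightarrow> norm (iter_D l f x) \<le> A (length l)"
  shows "C_bounded k (\<lambda>n. A (length l + n)) U (iter_D l f)"
proof (induction k arbitrary: l)
  case 0
  then show ?case using smooth_on_continuous[OF smooth_on_iter_D[OF U f]] A by auto
next
  case (Suc k)
  have "C_bounded k (\<lambda>n. A (length l + Suc n)) U (D_coord i (iter_D l f))" for i
    using Suc[of "i # l"] by simp
  then show ?case using smooth_on_differentiable[OF smooth_on_iter_D[OF U f]] A by auto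
qed

text \<open>
Every word of length \<open>n\<close> is a rearrangement of the sorted word of a multi-index of order \<open>n\<close>, so the sum of the
bounds \<open>M\<close> over that order dominates all derivatives of order \<open>n\<close>.
\<close>

lemma C_bounded_of_D_multi:
  assumes U: "open U" and f: "smooth_on U f" and M: "\<And>\<beta>. M \<beta> \<ge> 0"
    and A: "\<And>\<beta> x. x \<in> U \<Longrightarrow> norm (D_multi \<beta> f x) \<le> M \<beta>"
  shows "C_bounded k (\<lambda>n. \<Sum>\<beta> | mi_abs \<beta> = n. M \<beta>) U f"
proof -
  have "norm (iter_D l f x) \<le> (\<Sum>\<beta> | mi_abs \<beta> = length l. M \<beta>)" if "x \<in> U" for l x
  proof -
    let ?\<beta> = "count (mset l)"
    have eq: "iter_D l f x = D_multi ?\<beta> f x"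
      unfolding D_multi_eq_iter_D by (rule iter_D_mset[OF U f _ that]) (simp add: mi_list_count)
    have "mi_abs ?\<beta> = length l"
      by (metis length_mi_list mi_list_count size_mset)
    then have "M ?\<beta> \<le> (\<Sum>\<beta> | mi_abs \<beta> = length l. M \<beta>)"
      by (intro member_le_sum finite_mi_abs_eq) (auto simp: M)
    then show ?thesis using A[OF that, of ?\<beta>] eq by simp
  qed
  from C_bounded_iter_D[OF U f this, of k "[]"] show ?thesis by simp
qed

section \<open>Fourier coefficients on a period cube\<close>

definition integer_lattice :: "(real^'n) set" where
  "integer_lattice = {\<xi>. \<forall>i. \<xi> $ i \<in> \<int>}"

definition period_cube :: "real^'n \<Rightarrow> (real^'n::finite) set" where
  "period_cube x = cbox (x - (\<chi> i. pi)) (x + (\<chi> i. pi))"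

lemma mem_period_cube: "y \<in> period_cube x \<longleftrightarrow> (\<forall>i. \<bar>y $ i - x $ i\<bar> \<le> pi)"
  by (auto simp: period_cube_def mem_box_cart abs_le_iff algebra_simps)

lemma compact_period_cube [simp]: "compact (period_cube x)"
  by (simp add: period_cube_def)

lemma sets_period_cube [measurable]: "period_cube x \<in> sets borel"
  by (simp add: period_cube_def)

lemma integrable_on_compact:
  fixes f :: "real^'n \<Rightarrow> 'b::{banach,second_countable_topology}"
  assumes "compact S" "continuous_on S f"
  shows "integrable lborel (\<lambda>y. indicator S y *\<^sub>R f y)"
  using borel_integrable_compact[OF assms] by simp

lemma integral_cis_period:
  fixes a :: real
  assumes "k \<in> \<int>"
  shows "(LINT t|lborel. indicator {a - pi..a + pi} t *\<^sub>R cis (k * t)) = (if k = 0 then 2 * pi else 0)"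
proof (cases "k = 0")
  case True
  then show ?thesis by (simp add: scaleR_conv_of_real)
next
  case False
  define G where "G t = cis (k * t) / (\<i> * k)" for t
  have G: "(G has_vector_derivative cis (k * t)) (at t within {a - pi..a + pi})" for t
  proof -
    have "((\<lambda>t. cis (k * t)) has_vector_derivative (k *\<^sub>R (\<i> * cis (k * t)))) (at t within {a - pi..a + pi})"
      unfolding has_vector_derivative_def
      by (auto intro!: derivative_eq_intros simp: algebra_simps scaleR_conv_of_real)
    then have "(G has_vector_derivative (k *\<^sub>R (\<i> * cis (k * t))) / (\<i> * k)) (at t within {a - pi..a + pi})"
      unfolding G_def by (rule has_vector_derivative_divide)
    then show ?thesis using False by (simp add: scaleR_conv_of_real field_simps)
  qed
  have "(LINT t|lborel. indicator {a - pi..a + pi} t *\<^sub>R cis (k * t)) = G (a + pi) - G (a - pi)"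
    by (rule integral_FTC_Icc) (auto intro!: G continuous_intros)
  also have "cis (k * (a + pi)) = cis (k * (a - pi)) * cis (2 * pi * k)"
    by (simp add: cis_mult algebra_simps)
  then have "G (a + pi) = G (a - pi)"
    using assms by (simp add: G_def cis_multiple_2pi)
  finally show ?thesis using False by simp
qed

text \<open>
Orthogonality of the lattice characters: the integral is a product of one-dimensional integrals, and a factor vanishes
as soon as the corresponding component of \<open>\<xi>\<close> is a nonzero integer.
\<close>

lemma integral_cis_period_cube:
  fixes x \<xi> :: "real^'n::finite"
  assumes "\<xi> \<in> integer_lattice"
  shows "(LINT y|lborel. indicator (period_cube x) y *\<^sub>R cis (\<xi> \<bullet> y))
    = (if \<xi> = 0 then (2 * pi) ^ CARD('n) else 0)"
proof -
  define u where "u b t = indicator {x \<bullet> b - pi..x \<bullet> b + pi} t *\<^sub>R cis ((\<xi> \<bullet> b) * t)" for b :: "real^'n" and t :: real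
  interpret P: product_sigma_finite "\<lambda>_::real^'n. lborel :: real measure" ..
  have meas: "u b \<in> borel_measurable borel" for b
    unfolding u_def cis_conv_exp by measurable
  have integ: "integrable lborel (u b)" for b
    unfolding u_def
    by (rule borel_integrable_compact) (auto intro!: continuous_intros)
  have prod: "indicator (period_cube x) y *\<^sub>R cis (\<xi> \<bullet> y) = (\<Prod>b\<in>Basis. u b (y \<bullet> b))" for y
  proof -
    have "(\<Prod>b\<in>Basis. indicator {x \<bullet> b - pi..x \<bullet> b + pi} (y \<bullet> b)) = (indicator (period_cube x) y :: real)"
    proof -
      have "y \<in> period_cube x \<longleftrightarrow> (\<forall>b\<in>Basis. y \<bullet> b \<in> {x \<bullet> b - pi..x \<bullet> b + pi})"
        by (auto simp: period_cube_def mem_box inner_diff_left inner_add_left Basis_vec_def inner_axis)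
      then show ?thesis
        by (cases "y \<in> period_cube x") (auto simp: indicator_def intro: prod_zero)
    qed
    moreover have "(\<Prod>b\<in>Basis. cis ((\<xi> \<bullet> b) * (y \<bullet> b))) = cis (\<xi> \<bullet> y)"
      by (subst (3) euclidean_inner) (simp add: cis_conv_exp exp_sum sum_distrib_left)
    ultimately show ?thesis
      by (simp add: u_def scaleR_conv_of_real prod.distrib flip: of_real_prod)
  qed
  have one: "(LINT t|lborel. u b t) = (if \<xi> \<bullet> b = 0 then 2 * pi else 0)" if "b \<in> Basis" for b
    unfolding u_def using that assms
    by (intro integral_cis_period) (auto simp: Basis_vec_def inner_axis integer_lattice_def)
  have "(LINT y|lborel. indicator (period_cube x) y *\<^sub>R cis (\<xi> \<bullet> y)) = (LINT y|lborel. (\<Prod>b\<in>Basis. u b (y \<bullet> b)))"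
    by (simp add: prod)
  also have "\<dots> = (LINT f|(\<Pi>\<^sub>M b\<in>Basis. lborel). (\<Prod>b\<in>Basis. u b ((\<Sum>b\<in>Basis. f b *\<^sub>R b) \<bullet> b)))"
    using meas by (subst lborel_eq, subst integral_distr) (auto intro!: borel_measurable_prod measurable_compose[OF _ meas])
  also have "\<dots> = (LINT f|(\<Pi>\<^sub>M b\<in>Basis. lborel). (\<Prod>b\<in>Basis. u b (f b)))"
    by simp
  also have "\<dots> = (\<Prod>b\<in>Basis. LINT t|lborel. u b t)"
    by (rule P.product_integral_prod) (auto simp: integ)
  also have "\<dots> = (\<Prod>b\<in>(Basis::(real^'n) set). (if \<xi> \<bullet> b = 0 then 2 * complex_of_real pi else 0))"
    by (rule prod.cong) (auto simp: one)
  also have "\<dots> = (if \<xi> = 0 then (2 * pi) ^ CARD('n) else 0)"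
  proof (cases "\<xi> = 0")
    case False
    then obtain b where "b \<in> Basis" "\<xi> \<bullet> b \<noteq> 0" using euclidean_all_zero_iff by blast
    then show ?thesis using False by (simp, intro prod_zero bexI[of _ b]) auto
  qed simp
  finally show ?thesis .
qed

definition fourier_coeff :: "(real^'n::finite \<Rightarrow> complex) \<Rightarrow> real^'n \<Rightarrow> complex" where
  "fourier_coeff f \<xi> = (LINT y|lborel. f y * cis (- (\<xi> \<bullet> y)))"

lemma integrable_compact_support:
  fixes f :: "real^'n::finite \<Rightarrow> 'b::{banach,second_countable_topology}"
  assumes "continuous_on UNIV f" "compact K" "\<And>y. y \<notin> K \<Longrightarrow> f y = 0"
  shows "integrable lborel f"
proof -
  have "f = (\<lambda>y. indicator K y *\<^sub>R f y)" using assms(3) by (auto simp: indicator_def)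
  then show ?thesis
    using integrable_on_compact[OF assms(2) continuous_on_subset[OF assms(1)]] by simp
qed

text \<open>
Expand the square of the distance between \<open>f\<close> and the partial Fourier sum \<open>g\<close>: the pairings of \<open>f\<close> with \<open>g\<close> and of \<open>g\<close>
with itself are all the same number.
\<close>

lemma bessel_inequality:
  fixes f :: "real^'n::finite \<Rightarrow> complex"
  assumes f: "continuous_on UNIV f" and supp: "\<And>y. y \<notin> period_cube x \<Longrightarrow> f y = 0"
    and F: "finite F" "F \<subseteq> integer_lattice"
  shows "(\<Sum>\<xi>\<in>F. (norm (fourier_coeff f \<xi>))\<^sup>2) \<le> (2 * pi) ^ CARD('n) * (LINT y|lborel. (norm (f y))\<^sup>2)"
proof -
  let ?Q = "period_cube x"
  define T :: real where "T = (2 * pi) ^ CARD('n)"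
  have T: "T > 0" by (simp add: T_def)
  define a where "a \<xi> = fourier_coeff f \<xi> / T" for \<xi>
  define g where "g y = (\<Sum>\<xi>\<in>F. a \<xi> * cis (\<xi> \<bullet> y))" for y
  define S where "S = (\<Sum>\<xi>\<in>F. (norm (fourier_coeff f \<xi>))\<^sup>2)"
  have cg: "continuous_on UNIV g" unfolding g_def by (intro continuous_intros)
  have I: "integrable lborel (\<lambda>y. indicator ?Q y *\<^sub>R h y)" if "continuous_on UNIV h" for h :: "real^'n \<Rightarrow> complex"
    by (intro integrable_on_compact) (auto intro: continuous_on_subset[OF that])
  have ff: "(LINT y|lborel. indicator ?Q y *\<^sub>R (f y * cnj (f y))) = of_real (LINT y|lborel. (norm (f y))\<^sup>2)"
    unfolding integral_complex_of_real[symmetric]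
    by (rule Bochner_Integration.integral_cong) (use supp in \<open>auto simp: indicator_def complex_norm_square simp del: of_real_power\<close>)
  have fg: "(LINT y|lborel. indicator ?Q y *\<^sub>R (f y * cnj (g y))) = of_real (S / T)"
  proof -
    have "(LINT y|lborel. indicator ?Q y *\<^sub>R (f y * cnj (g y)))
        = (LINT y|lborel. (\<Sum>\<xi>\<in>F. cnj (a \<xi>) * (f y * cis (- (\<xi> \<bullet> y)))))"
      by (rule Bochner_Integration.integral_cong)
        (use supp in \<open>auto simp: indicator_def g_def cis_cnj sum_distrib_left algebra_simps\<close>)
    also have "\<dots> = (\<Sum>\<xi>\<in>F. cnj (a \<xi>) * fourier_coeff f \<xi>)"
      unfolding fourier_coeff_def
      by (subst Bochner_Integration.integral_sum)
        (auto intro!: integrable_mult_right integrable_compact_support[of _ ?Q] continuous_intros f simp: supp)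
    also have "\<dots> = of_real (S / T)"
      by (simp add: a_def S_def complex_norm_square sum_divide_distrib mult.commute del: of_real_power)
    finally show ?thesis .
  qed
  have gf: "(LINT y|lborel. indicator ?Q y *\<^sub>R (g y * cnj (f y))) = of_real (S / T)"
  proof -
    have "(LINT y|lborel. indicator ?Q y *\<^sub>R (g y * cnj (f y))) = (LINT y|lborel. cnj (indicator ?Q y *\<^sub>R (f y * cnj (g y))))"
      by (rule Bochner_Integration.integral_cong) auto
    also have "\<dots> = cnj (of_real (S / T))"
      unfolding fg[symmetric] by (rule Bochner_Integration.integral_cnj)
    finally show ?thesis by simp
  qed
  have regroup: "(u * cis s) * (v * cis t) = (u * v) * cis (s + t)" for u v s t
    by (simp add: cis_mult[symmetric])
  have gg: "(LINT y|lborel. indicator ?Q y *\<^sub>R (g y * cnj (g y))) = of_real (S / T)"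
  proof -
    have "(LINT y|lborel. indicator ?Q y *\<^sub>R (g y * cnj (g y)))
       = (LINT y|lborel. (\<Sum>\<xi>\<in>F. \<Sum>\<eta>\<in>F. (a \<xi> * cnj (a \<eta>)) * (indicator ?Q y *\<^sub>R cis ((\<xi> - \<eta>) \<bullet> y))))"
      by (rule Bochner_Integration.integral_cong)
        (auto simp: g_def cis_cnj sum_product scaleR_sum_right inner_diff_left regroup)
    also have "\<dots> = (\<Sum>\<xi>\<in>F. \<Sum>\<eta>\<in>F. (a \<xi> * cnj (a \<eta>)) * (LINT y|lborel. indicator ?Q y *\<^sub>R cis ((\<xi> - \<eta>) \<bullet> y)))"
      by (subst Bochner_Integration.integral_sum Bochner_Integration.integral_mult_right_zero
          | intro Bochner_Integration.integrable_sum integrable_mult_right I continuous_intros sum.cong refl)+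
    also have "\<dots> = (\<Sum>\<xi>\<in>F. \<Sum>\<eta>\<in>F. if \<eta> = \<xi> then a \<xi> * cnj (a \<xi>) * T else 0)"
      using F by (intro sum.cong refl, subst integral_cis_period_cube)
        (auto simp: integer_lattice_def T_def subset_iff)
    also have "\<dots> = (\<Sum>\<xi>\<in>F. a \<xi> * cnj (a \<xi>) * T)"
      using F by simp
    also have "\<dots> = of_real (S / T)"
      using T by (simp add: a_def S_def complex_norm_square sum_divide_distrib del: of_real_power)
    finally show ?thesis .
  qed
  have "complex_of_real (LINT y|lborel. indicator ?Q y *\<^sub>R (norm (f y - g y))\<^sup>2) = (LINT y|lborel. indicator ?Q y *\<^sub>R (f y * cnj (f y)) - indicator ?Q y *\<^sub>R (f y * cnj (g y))
      - (indicator ?Q y *\<^sub>R (g y * cnj (f y)) - indicator ?Q y *\<^sub>R (g y * cnj (g y))))"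
    unfolding integral_complex_of_real[symmetric]
    by (rule Bochner_Integration.integral_cong) (auto simp: complex_norm_square algebra_simps indicator_def simp del: of_real_power)
  also have "\<dots> = of_real ((LINT y|lborel. (norm (f y))\<^sup>2) - S / T)"
  proof -
    have "integrable lborel (\<lambda>y. indicator ?Q y *\<^sub>R (f y * cnj (f y)))"
      "integrable lborel (\<lambda>y. indicator ?Q y *\<^sub>R (f y * cnj (g y)))"
      "integrable lborel (\<lambda>y. indicator ?Q y *\<^sub>R (g y * cnj (f y)))"
      "integrable lborel (\<lambda>y. indicator ?Q y *\<^sub>R (g y * cnj (g y)))"
      by (intro I continuous_intros f cg)+
    then show ?thesis
      by (simp only: Bochner_Integration.integral_diff Bochner_Integration.integrable_diff ff fg gf gg) simp
  qed
  finally have "(LINT y|lborel. indicator ?Q y *\<^sub>R (norm (f y - g y))\<^sup>2) = (LINT y|lborel. (norm (f y))\<^sup>2) - S / T"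
    by (simp only: of_real_eq_iff)
  moreover have "0 \<le> (LINT y|lborel. indicator ?Q y *\<^sub>R (norm (f y - g y))\<^sup>2)"
    by (intro integral_nonneg_AE) auto
  ultimately have "S / T \<le> (LINT y|lborel. (norm (f y))\<^sup>2)" by linarith
  then have "S \<le> T * (LINT y|lborel. (norm (f y))\<^sup>2)" using T by (simp add: field_simps)
  then show ?thesis by (simp only: S_def T_def)
qed

lemma fourier_coeff_uminus: "fourier_coeff f (- \<xi>) = (LINT y|lborel. f y * cis (\<xi> \<bullet> y))"
  by (simp add: fourier_coeff_def)

section \<open>A pointwise bound by the sum of the Fourier coefficients\<close>

definition trig_polys :: "(real^'n::finite \<Rightarrow> complex) set" where
  "trig_polys = {p. \<exists>F k. finite F \<and> F \<subseteq> integer_lattice \<and> p = (\<lambda>y. \<Sum>\<xi>\<in>F. k \<xi> * cis (\<xi> \<bullet> y))}"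

lemma trig_polysI:
  "finite F \<Longrightarrow> F \<subseteq> integer_lattice \<Longrightarrow> p = (\<lambda>y. \<Sum>\<xi>\<in>F. k \<xi> * cis (\<xi> \<bullet> y)) \<Longrightarrow> p \<in> trig_polys"
  unfolding trig_polys_def by blast

lemma trig_polys_cis: "\<eta> \<in> integer_lattice \<Longrightarrow> (\<lambda>y. c * cis (\<eta> \<bullet> y)) \<in> trig_polys"
  unfolding trig_polys_def by (auto intro!: exI[of _ "{\<eta>}"] exI[of _ "\<lambda>_. c"])

lemma trig_polys_add:
  assumes "p \<in> trig_polys" "q \<in> trig_polys"
  shows "(\<lambda>y. p y + q y) \<in> trig_polys"
proof -
  from assms obtain F k G l where p: "finite F" "F \<subseteq> integer_lattice" "p = (\<lambda>y. \<Sum>\<xi>\<in>F. k \<xi> * cis (\<xi> \<bullet> y))"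
    and q: "finite G" "G \<subseteq> integer_lattice" "q = (\<lambda>y. \<Sum>\<xi>\<in>G. l \<xi> * cis (\<xi> \<bullet> y))"
    unfolding trig_polys_def by blast
  have extend: "(\<Sum>\<xi>\<in>A. f \<xi> * cis (\<xi> \<bullet> y)) = (\<Sum>\<xi>\<in>B. (if \<xi> \<in> A then f \<xi> else 0) * cis (\<xi> \<bullet> y))"
    if "finite B" "A \<subseteq> B" for A B f and y :: "real^'n"
    using that by (intro sum.mono_neutral_cong_left) auto
  have "(\<lambda>y. p y + q y) = (\<lambda>y. \<Sum>\<xi>\<in>F \<union> G. ((if \<xi> \<in> F then k \<xi> else 0) + (if \<xi> \<in> G then l \<xi> else 0)) * cis (\<xi> \<bullet> y))"
    unfolding p(3) q(3) distrib_right sum.distrib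
    using p(1) q(1) extend[of "F \<union> G" F k] extend[of "F \<union> G" G l] by (intro ext) simp
  then show ?thesis
    by (rule trig_polysI[rotated 2]) (use p(1,2) q(1,2) in auto)
qed

lemma trig_polys_sum:
  "finite A \<Longrightarrow> (\<And>i. i \<in> A \<Longrightarrow> f i \<in> trig_polys) \<Longrightarrow> (\<lambda>y. \<Sum>i\<in>A. f i y) \<in> trig_polys"
proof (induction A rule: finite_induct)
  case empty
  then show ?case using trig_polys_cis[of 0 0] by (simp add: integer_lattice_def)
next
  case (insert a A)
  then show ?case using trig_polys_add[of "f a" "\<lambda>y. \<Sum>i\<in>A. f i y"] by simp
qed

lemma trig_polys_mult:
  assumes "p \<in> trig_polys" "q \<in> trig_polys"
  shows "(\<lambda>y. p y * q y) \<in> trig_polys"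
proof -
  from assms obtain F k G l where p: "finite F" "F \<subseteq> integer_lattice" "p = (\<lambda>y. \<Sum>\<xi>\<in>F. k \<xi> * cis (\<xi> \<bullet> y))"
    and q: "finite G" "G \<subseteq> integer_lattice" "q = (\<lambda>y. \<Sum>\<xi>\<in>G. l \<xi> * cis (\<xi> \<bullet> y))"
    unfolding trig_polys_def by blast
  have "(\<lambda>y. p y * q y) = (\<lambda>y. \<Sum>\<xi>\<in>F. \<Sum>\<eta>\<in>G. (k \<xi> * l \<eta>) * cis ((\<xi> + \<eta>) \<bullet> y))"
    unfolding p(3) q(3) by (simp only: sum_product inner_add_left cis_mult[symmetric] mult_ac)
  also have "\<dots> \<in> trig_polys"
    using p q by (intro trig_polys_sum trig_polys_cis) (auto simp: integer_lattice_def subset_iff)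
  finally show ?thesis .
qed

lemma trig_polys_prod:
  "finite A \<Longrightarrow> (\<And>i. i \<in> A \<Longrightarrow> f i \<in> trig_polys) \<Longrightarrow> (\<lambda>y. \<Prod>i\<in>A. f i y) \<in> trig_polys"
proof (induction A rule: finite_induct)
  case empty
  then show ?case using trig_polys_cis[of 0 1] by (simp add: integer_lattice_def)
next
  case (insert a A)
  then show ?case using trig_polys_mult[of "f a" "\<lambda>y. \<Prod>i\<in>A. f i y"] by simp
qed

text \<open>
The coefficients of a nonnegative trigonometric polynomial are in absolute value at most its mean, which is the coefficient of
frequency 0. Hence pairing it with \<open>f\<close> costs at most its integral times the sum of the coefficients of \<open>f\<close>.
\<close>

lemma trig_poly_pairing:
  fixes f :: "real^'n::finite \<Rightarrow> complex" and w :: "real^'n \<Rightarrow> real"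
  assumes f: "continuous_on UNIV f" and supp: "\<And>y. y \<notin> period_cube x \<Longrightarrow> f y = 0"
    and B: "\<And>F. finite F \<Longrightarrow> F \<subseteq> integer_lattice \<Longrightarrow> (\<Sum>\<xi>\<in>F. norm (fourier_coeff f \<xi>)) \<le> B"
    and w: "(\<lambda>y. of_real (w y)) \<in> trig_polys" "\<And>y. w y \<ge> 0"
  shows "(2 * pi) ^ CARD('n) * norm (LINT y|lborel. w (y - x) *\<^sub>R f y)
    \<le> B * (LINT y|lborel. indicator (period_cube x) y *\<^sub>R w (y - x))"
proof -
  let ?Q = "period_cube x"
  define T :: real where "T = (2 * pi) ^ CARD('n)"
  have T: "T > 0" by (simp add: T_def)
  define W where "W = (LINT y|lborel. indicator ?Q y *\<^sub>R w (y - x))"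
  from w(1) obtain F k where F: "finite F" "F \<subseteq> integer_lattice" 
    and k: "\<And>y. complex_of_real (w y) = (\<Sum>\<xi>\<in>F. k \<xi> * cis (\<xi> \<bullet> y))"
    unfolding trig_polys_def by (auto simp: fun_eq_iff)
  have I: "integrable lborel (\<lambda>y. indicator ?Q y *\<^sub>R h y)" if "continuous_on UNIV h" for h :: "real^'n \<Rightarrow> complex"
    by (intro integrable_on_compact) (auto intro: continuous_on_subset[OF that])
  have coeff: "T * norm (k \<eta>) \<le> W" if "\<eta> \<in> F" for \<eta>
  proof -
    have shift: "of_real (w (y - x)) * cis (- (\<eta> \<bullet> (y - x)))
      = (\<Sum>\<xi>\<in>F. (k \<xi> * cis (- ((\<xi> - \<eta>) \<bullet> x))) * cis ((\<xi> - \<eta>) \<bullet> y))" for y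
      unfolding k sum_distrib_right
      by (rule sum.cong, simp, simp add: mult.assoc cis_mult) (simp add: inner_diff_left inner_diff_right algebra_simps)
    have eq: "(LINT y|lborel. indicator ?Q y *\<^sub>R (of_real (w (y - x)) * cis (- (\<eta> \<bullet> (y - x)))))
      = (LINT y|lborel. (\<Sum>\<xi>\<in>F. (k \<xi> * cis (- ((\<xi> - \<eta>) \<bullet> x))) * (indicator ?Q y *\<^sub>R cis ((\<xi> - \<eta>) \<bullet> y))))"
      by (rule Bochner_Integration.integral_cong)
        (auto simp: shift indicator_def)
    also have "\<dots> = (\<Sum>\<xi>\<in>F. (k \<xi> * cis (- ((\<xi> - \<eta>) \<bullet> x))) * (LINT y|lborel. indicator ?Q y *\<^sub>R cis ((\<xi> - \<eta>) \<bullet> y)))"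
      by (subst Bochner_Integration.integral_sum)
        (auto intro!: integrable_mult_right I continuous_intros simp del: mult_scaleR_right)
    also have "\<dots> = (\<Sum>\<xi>\<in>F. if \<xi> = \<eta> then k \<eta> * T else 0)"
      using F that by (intro sum.cong refl, subst integral_cis_period_cube)
        (auto simp: integer_lattice_def T_def subset_iff)
    also have "\<dots> = k \<eta> * T" using F that by simp
    finally have "norm (k \<eta> * T) \<le> (LINT y|lborel. norm (indicator ?Q y *\<^sub>R (of_real (w (y - x)) * cis (- (\<eta> \<bullet> (y - x))))))"
      using integral_norm_bound[of lborel "\<lambda>y. indicator ?Q y *\<^sub>R (of_real (w (y - x)) * cis (- (\<eta> \<bullet> (y - x))))"]
      by (simp only:)
    also have "\<dots> = W"
      unfolding W_def by (rule Bochner_Integration.integral_cong) (auto simp: norm_mult w(2))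
    finally show ?thesis using T by (simp add: norm_mult mult.commute)
  qed
  have W: "W \<ge> 0" unfolding W_def by (intro integral_nonneg_AE) (auto simp: w(2))
  have split: "cis (\<xi> \<bullet> (y - x)) = cis (\<xi> \<bullet> y) * cis (- (\<xi> \<bullet> x))" for \<xi> y
    by (simp add: cis_mult inner_diff_right)
  have "(LINT y|lborel. w (y - x) *\<^sub>R f y) = (LINT y|lborel. (\<Sum>\<xi>\<in>F. (k \<xi> * cis (- (\<xi> \<bullet> x))) * (f y * cis (\<xi> \<bullet> y))))"
    by (rule Bochner_Integration.integral_cong)
      (simp_all only: scaleR_conv_of_real k sum_distrib_right sum_distrib_left split mult_ac)
  also have "\<dots> = (\<Sum>\<xi>\<in>F. (k \<xi> * cis (- (\<xi> \<bullet> x))) * fourier_coeff f (- \<xi>))"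
    unfolding fourier_coeff_uminus
    by (subst Bochner_Integration.integral_sum)
      (auto intro!: integrable_mult_right integrable_compact_support[of _ ?Q] continuous_intros f simp: supp)
  finally have "T * norm (LINT y|lborel. w (y - x) *\<^sub>R f y) \<le> (\<Sum>\<xi>\<in>F. (T * norm (k \<xi>)) * norm (fourier_coeff f (- \<xi>)))"
    using T by (simp add: sum_distrib_left[symmetric] mult.assoc) 
      (rule order_trans[OF norm_sum], simp add: norm_mult)
  also have "\<dots> \<le> (\<Sum>\<xi>\<in>F. W * norm (fourier_coeff f (- \<xi>)))"
    by (intro sum_mono mult_right_mono coeff) auto
  also have "\<dots> = W * (\<Sum>\<xi>\<in>uminus ` F. norm (fourier_coeff f \<xi>))"
    by (simp add: sum.reindex sum_distrib_left)
  also have "\<dots> \<le> W * B"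
    using F W by (intro mult_left_mono B) (auto simp: integer_lattice_def)
  finally show ?thesis by (simp add: T_def W_def mult.commute)
qed

text \<open>
A nonnegative trigonometric polynomial that attains its maximum 1 over the period cube only at the origin, so its
powers, normalised to mean 1, form an approximate identity.
\<close>

definition peak :: "real^'n::finite \<Rightarrow> real" where
  "peak y = (\<Prod>i\<in>UNIV. (1 + cos (y $ i)) / 2)"

lemma half_one_plus_cos_bounds:
  fixes t :: real
  shows "0 \<le> (1 + cos t) / 2" "(1 + cos t) / 2 \<le> 1"
  using cos_ge_minus_one[of t] cos_le_one[of t] by (simp_all, linarith)

lemma peak_nonneg: "peak y \<ge> 0"
  unfolding peak_def by (intro prod_nonneg half_one_plus_cos_bounds)

lemma peak_zero: "peak 0 = 1"
  by (simp add: peak_def)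

lemma continuous_peak [continuous_intros]:
  fixes f :: "'a::t2_space \<Rightarrow> real^'n::finite"
  shows "continuous_on S f \<Longrightarrow> continuous_on S (\<lambda>y. peak (f y))"
  unfolding peak_def
  by (intro continuous_intros continuous_on_cos bounded_linear.continuous_on[OF bounded_linear_vec_nth]) auto

lemma peak_less_1:
  assumes "\<And>i. \<bar>y $ i\<bar> \<le> pi" "y \<noteq> 0"
  shows "peak y < 1"
proof -
  obtain j where j: "y $ j \<noteq> 0" using assms(2) by (auto simp: vec_eq_iff)
  have c: "0 \<le> (1 + cos (y $ i)) / 2" "(1 + cos (y $ i)) / 2 \<le> 1" for i
    by (rule half_one_plus_cos_bounds)+
  have "cos (y $ j) = cos \<bar>y $ j\<bar>" by simp
  also have "\<dots> < cos 0" using j assms(1)[of j] by (intro cos_monotone_0_pi) auto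
  finally have "(1 + cos (y $ j)) / 2 < 1" by simp
  moreover have "peak y \<le> (1 + cos (y $ j)) / 2"
    unfolding peak_def
    by (subst prod.remove[of _ j]) (simp, simp, intro mult_right_le_one_le prod_nonneg prod_le_1 conjI c)
  ultimately show ?thesis by simp
qed

lemma peak_power_trig_poly: "(\<lambda>y. complex_of_real (peak y ^ n)) \<in> trig_polys"
proof -
  have ax: "axis i 1 \<in> integer_lattice" "- axis i 1 \<in> integer_lattice" "0 \<in> integer_lattice" for i :: "'n::finite"
    by (auto simp: integer_lattice_def axis_def)
  have one: "complex_of_real ((1 + cos (y $ i)) / 2)
      = (1/2 * cis (0 \<bullet> y) + 1/4 * cis (axis i 1 \<bullet> y)) + 1/4 * cis ((- axis i 1) \<bullet> y)" for y :: "real^'n" and i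
    by (simp add: inner_axis' complex_eq_iff)
  have "(\<lambda>y. \<Prod>j\<in>{..<n}. \<Prod>i\<in>UNIV. complex_of_real ((1 + cos (y $ i)) / 2)) \<in> trig_polys"
    unfolding one by (intro trig_polys_prod trig_polys_add trig_polys_cis ax) auto
  then show ?thesis by (simp add: peak_def prod_power_distrib)
qed

text \<open>
Outside a neighbourhood of \<open>x\<close> the powers of the peak decay like \<open>q ^ n\<close>, whereas their integral decays no faster than
\<open>q' ^ n\<close> for some \<open>q' > q\<close>. So asymptotically only the values of \<open>f\<close> near \<open>x\<close> count.
\<close>

lemma peak_concentrates:
  fixes f :: "real^'n::finite \<Rightarrow> complex"
  assumes f: "continuous_on UNIV f" and supp: "\<And>y. y \<notin> period_cube x \<Longrightarrow> f y = 0"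
    and le: "\<And>n. a * norm (LINT y|lborel. (peak (y - x) ^ n) *\<^sub>R f y)
       \<le> B * (LINT y|lborel. indicator (period_cube x) y *\<^sub>R peak (y - x) ^ n)"
    and a: "a > 0"
  shows "a * norm (f x) \<le> B"
proof (rule ccontr)
  let ?Q = "period_cube x"
  assume contra: "\<not> a * norm (f x) \<le> B"
  define \<epsilon> where "\<epsilon> = (a * norm (f x) - B) / (2 * a)"
  have \<epsilon>: "\<epsilon> > 0" "a * norm (f x) - B = 2 * a * \<epsilon>" using a contra by (auto simp: \<epsilon>_def)
  define W where "W n = (LINT y|lborel. indicator ?Q y *\<^sub>R peak (y - x) ^ n)" for n
  have "isCont f x" using f by (simp add: continuous_on_eq_continuous_at)
  then obtain \<eta> where \<eta>: "\<eta> > 0" "\<And>y. dist y x < \<eta> \<Longrightarrow> dist (f y) (f x) < \<epsilon>"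
    using \<epsilon>(1) unfolding continuous_at_eps_delta by blast
  have "bounded (f ` ?Q)" 
    by (intro compact_imp_bounded compact_continuous_image continuous_on_subset[OF f]) auto
  then obtain S where S: "S > 0" "\<And>y. y \<in> ?Q \<Longrightarrow> norm (f y) \<le> S"
    by (auto simp: bounded_pos)
  have xQ: "x \<in> ?Q" by (simp add: mem_period_cube)
  obtain q where q: "0 \<le> q" "q < 1" "\<And>y. y \<in> ?Q - ball x \<eta> \<Longrightarrow> peak (y - x) \<le> q"
  proof (cases "?Q - ball x \<eta> = {}")
    case True
    then show ?thesis by (intro that[of 0]) (simp, simp, blast)
  next
    case False
    have "compact (?Q - ball x \<eta>)" by (intro compact_diff) auto
    moreover have "continuous_on (?Q - ball x \<eta>) (\<lambda>y. peak (y - x))" by (intro continuous_intros)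
    ultimately obtain y0 where y0: "y0 \<in> ?Q - ball x \<eta>" "\<And>y. y \<in> ?Q - ball x \<eta> \<Longrightarrow> peak (y - x) \<le> peak (y0 - x)"
      using continuous_attains_sup[OF _ False] by blast
    have "peak (y0 - x) < 1"
      using y0(1) \<eta>(1) by (intro peak_less_1) (auto simp: mem_period_cube)
    then show ?thesis using that[of "peak (y0 - x)"] y0 peak_nonneg by blast
  qed
  \<comment> \<open>any value strictly between \<open>q\<close> and 1: near \<open>x\<close> the peak exceeds it\<close>
  define q' where "q' = (1 + q) / 2"
  have q': "q < q'" "q' < 1" "0 < q'" using q by (auto simp: q'_def)
  have "isCont (\<lambda>y. peak (y - x)) x"
    by (rule continuous_on_interior[of UNIV]) (auto intro!: continuous_intros)
  then obtain \<rho> where \<rho>: "\<rho> > 0" "\<And>y. dist y x < \<rho> \<Longrightarrow> dist (peak (y - x)) 1 < 1 - q'"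
    using q'(2) unfolding continuous_at_eps_delta by (metis diff_self peak_zero diff_gt_0_iff_gt)
  define \<sigma> where "\<sigma> = min \<rho> pi"
  have \<sigma>: "\<sigma> > 0" "ball x \<sigma> \<subseteq> ?Q" 
  proof -
    show "\<sigma> > 0" using \<rho> by (simp add: \<sigma>_def)
    show "ball x \<sigma> \<subseteq> ?Q"
    proof
      fix y assume "y \<in> ball x \<sigma>"
      then have "norm (y - x) < pi" by (simp add: \<sigma>_def dist_norm norm_minus_commute)
      then show "y \<in> ?Q" unfolding mem_period_cube
        by (metis component_le_norm_cart le_less_trans less_imp_le vector_minus_component)
    qed
  qed
  define v where "v = measure lborel (ball x \<sigma>)"
  have v: "v > 0" unfolding v_def using \<sigma>(1) content_ball_pos by blast
  have IQ: "integrable lborel (\<lambda>y. indicator ?Q y *\<^sub>R h y)" if "continuous_on UNIV h" for h :: "real^'n \<Rightarrow> real"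
    by (intro integrable_on_compact) (auto intro: continuous_on_subset[OF that])
  have W_ge: "v * q' ^ n \<le> W n" for n
  proof -
    have "v * q' ^ n = (LINT y|lborel. indicator (ball x \<sigma>) y *\<^sub>R q' ^ n)"
      by (simp add: v_def)
    also have "\<dots> \<le> W n" unfolding W_def
    proof (rule integral_mono)
      show "integrable lborel (\<lambda>y. indicator (ball x \<sigma>) y *\<^sub>R q' ^ n)"
        using emeasure_lborel_ball_finite by (intro integrable_scaleR_left integrable_real_indicator) auto
      show "integrable lborel (\<lambda>y. indicator ?Q y *\<^sub>R peak (y - x) ^ n)"
        by (intro IQ continuous_intros)
      fix y
      have "q' \<le> peak (y - x)" if "y \<in> ball x \<sigma>"
        using \<rho>(2)[of y] that by (auto simp: \<sigma>_def dist_commute dist_real_def)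
      then show "indicator (ball x \<sigma>) y *\<^sub>R q' ^ n \<le> indicator ?Q y *\<^sub>R peak (y - x) ^ n"
        using \<sigma>(2) q'(3) by (auto simp: indicator_def peak_nonneg intro!: power_mono)
    qed
    finally show ?thesis .
  qed
  define T where "T = measure lborel ?Q"
  have main: "\<epsilon> * W n \<le> 2 * S * T * q ^ n" for n
  proof -
    let ?w = "\<lambda>y. peak (y - x) ^ n"
    have w: "continuous_on UNIV ?w" by (intro continuous_intros)
    have If: "integrable lborel (\<lambda>y. ?w y *\<^sub>R f y)"
      by (rule integrable_compact_support[of _ ?Q]) (auto intro!: continuous_intros f simp: supp)
    have IW: "integrable lborel (\<lambda>y. indicator ?Q y *\<^sub>R (?w y *\<^sub>R f x))"
      by (intro integrable_on_compact continuous_intros) auto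
    have "W n *\<^sub>R f x - (LINT y|lborel. ?w y *\<^sub>R f y) = (LINT y|lborel. indicator ?Q y *\<^sub>R (?w y *\<^sub>R f x) - ?w y *\<^sub>R f y)"
    proof -
      have "(LINT y|lborel. indicator ?Q y *\<^sub>R (?w y *\<^sub>R f x)) = W n *\<^sub>R f x"
        using integral_scaleR_left[of "f x" lborel "\<lambda>y. indicator ?Q y *\<^sub>R ?w y", OF IQ[OF w]] by (simp add: W_def)
      then show ?thesis by (simp only: Bochner_Integration.integral_diff[OF IW If])
    qed
    then have "norm (W n *\<^sub>R f x - (LINT y|lborel. ?w y *\<^sub>R f y)) \<le> (LINT y|lborel. norm (indicator ?Q y *\<^sub>R (?w y *\<^sub>R f x) - ?w y *\<^sub>R f y))"
      by simp
    also have "\<dots> \<le> (LINT y|lborel. \<epsilon> * (indicator ?Q y *\<^sub>R ?w y) + (2 * S * q ^ n) * indicator ?Q y)"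
    proof (rule integral_mono)
      show "integrable lborel (\<lambda>y. norm (indicator ?Q y *\<^sub>R (?w y *\<^sub>R f x) - ?w y *\<^sub>R f y))"
        using IW If by (intro integrable_norm Bochner_Integration.integrable_diff)
      show "integrable lborel (\<lambda>y. \<epsilon> * (indicator ?Q y *\<^sub>R ?w y) + (2 * S * q ^ n) * indicator ?Q y)"
        using IQ[OF w] emeasure_compact_finite[OF compact_period_cube, of x]
        by (intro Bochner_Integration.integrable_add integrable_mult_right) auto
      fix y
      show "norm (indicator ?Q y *\<^sub>R (?w y *\<^sub>R f x) - ?w y *\<^sub>R f y) \<le> \<epsilon> * (indicator ?Q y *\<^sub>R ?w y) + (2 * S * q ^ n) * indicator ?Q y"
      proof (cases "y \<in> ?Q")
        case True
        have "norm (?w y *\<^sub>R f x - ?w y *\<^sub>R f y) = ?w y * norm (f y - f x)"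
          by (simp add: scaleR_diff_right[symmetric] peak_nonneg norm_minus_commute)
        also have "\<dots> \<le> \<epsilon> * ?w y + 2 * S * q ^ n"
        proof (cases "y \<in> ball x \<eta>")
          case True
          then have "norm (f y - f x) \<le> \<epsilon>" using \<eta>(2)[of y] by (simp add: dist_norm norm_minus_commute)
          then have "?w y * norm (f y - f x) \<le> ?w y * \<epsilon>" by (intro mult_left_mono) (simp_all add: peak_nonneg)
          then show ?thesis using S(1) q(1) by (simp add: mult.commute add_increasing2)
        next
          case False
          have "norm (f y - f x) \<le> 2 * S"
            using norm_triangle_ineq4[of "f y" "f x"] S(2)[OF xQ] S(2)[OF \<open>y \<in> ?Q\<close>] by linarith
          moreover have "?w y \<le> q ^ n" using q(3)[of y] False True by (intro power_mono) (auto simp: peak_nonneg)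
          ultimately have "?w y * norm (f y - f x) \<le> q ^ n * (2 * S)"
            using q(1) by (intro mult_mono) (auto simp: peak_nonneg)
          then show ?thesis using \<epsilon>(1) by (simp add: mult_ac add_increasing peak_nonneg)
        qed
        finally show ?thesis using True by simp
      qed (simp add: supp)
    qed
    also have "\<dots> = \<epsilon> * W n + 2 * S * q ^ n * T"
      using IQ[OF w] emeasure_compact_finite[OF compact_period_cube, of x]
      by (subst Bochner_Integration.integral_add) (auto simp: W_def T_def)
    finally have est: "norm (W n *\<^sub>R f x - (LINT y|lborel. ?w y *\<^sub>R f y)) \<le> \<epsilon> * W n + 2 * S * q ^ n * T" .
    have Wn: "W n \<ge> 0" unfolding W_def by (intro integral_nonneg_AE) (auto simp: peak_nonneg)
    have "W n * norm (f x) - norm (LINT y|lborel. ?w y *\<^sub>R f y) \<le> \<epsilon> * W n + 2 * S * q ^ n * T"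
      using est norm_triangle_ineq2[of "W n *\<^sub>R f x" "LINT y|lborel. ?w y *\<^sub>R f y"] Wn by simp
    then have "a * (W n * norm (f x) - norm (LINT y|lborel. ?w y *\<^sub>R f y)) \<le> a * (\<epsilon> * W n + 2 * S * q ^ n * T)"
      using a by (intro mult_left_mono) auto
    moreover have "a * norm (LINT y|lborel. ?w y *\<^sub>R f y) \<le> B * W n"
      using le[of n] by (simp add: W_def)
    ultimately have "(a * norm (f x) - B) * W n \<le> a * (\<epsilon> * W n + 2 * S * q ^ n * T)"
      by (simp add: algebra_simps)
    then have "a * (2 * \<epsilon> * W n) \<le> a * (\<epsilon> * W n + 2 * S * q ^ n * T)" unfolding \<epsilon>(2) by (simp add: mult_ac)
    then show ?thesis using a by (simp add: mult_ac)
  qed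
  have bound: "\<epsilon> * v \<le> 2 * S * T * (q / q') ^ n" for n
  proof -
    have "\<epsilon> * (v * q' ^ n) \<le> 2 * S * T * q ^ n"
      using main[of n] mult_left_mono[OF W_ge[of n], of \<epsilon>] \<epsilon>(1) by linarith
    then show ?thesis using q'(3) by (simp add: power_divide field_simps)
  qed
  have "(\<lambda>n. 2 * S * T * (q / q') ^ n) \<longlonglongrightarrow> 2 * S * T * 0"
    using q q' by (intro tendsto_intros LIMSEQ_power_zero) auto
  then have "\<epsilon> * v \<le> 2 * S * T * 0"
    by (rule LIMSEQ_le_const) (use bound in auto)
  then show False using \<epsilon>(1) v by (simp add: mult_le_0_iff)
qed

text \<open>
This takes the place of Fourier inversion; the bound \<open>B\<close> on the finite partial sums stands for absolute convergence.
\<close>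

lemma norm_le_sum_fourier_coeff:
  fixes f :: "real^'n::finite \<Rightarrow> complex"
  assumes f: "continuous_on UNIV f" and supp: "\<And>y. y \<notin> period_cube x \<Longrightarrow> f y = 0"
    and B: "\<And>F. finite F \<Longrightarrow> F \<subseteq> integer_lattice \<Longrightarrow> (\<Sum>\<xi>\<in>F. norm (fourier_coeff f \<xi>)) \<le> B"
  shows "(2 * pi) ^ CARD('n) * norm (f x) \<le> B"
  by (rule peak_concentrates[OF f supp trig_poly_pairing[OF f supp B peak_power_trig_poly]])
    (auto simp: peak_nonneg)

section \<open>A convergent lattice sum\<close>

lemma sum_inverse_square_int:
  "\<exists>S::real. \<forall>K::int set. finite K \<longrightarrow> (\<Sum>k\<in>K. 1 / (1 + \<bar>real_of_int k\<bar>)\<^sup>2) \<le> S"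
proof -
  let ?u = "\<lambda>n::nat. 1 / (1 + real n)\<^sup>2"
  have sm: "summable ?u"
    using inverse_squares_sums by (auto simp: sums_iff add.commute)
  have "(\<Sum>k\<in>K. 1 / (1 + \<bar>real_of_int k\<bar>)\<^sup>2) \<le> suminf ?u + suminf ?u" if "finite K" for K :: "int set"
  proof -
    define A where "A = (nat \<circ> abs) ` K"
    have A: "finite A" using that by (simp add: A_def)
    have le: "sum ?u A \<le> suminf ?u" by (rule sum_le_suminf[OF sm A]) auto
    have "K \<subseteq> int ` A \<union> (\<lambda>n. - int n) ` A"
    proof
      fix k assume "k \<in> K"
      then have "nat \<bar>k\<bar> \<in> A" by (auto simp: A_def)
      moreover have "k = int (nat \<bar>k\<bar>) \<or> k = - int (nat \<bar>k\<bar>)" by auto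
      ultimately show "k \<in> int ` A \<union> (\<lambda>n. - int n) ` A" by blast
    qed
    then have "(\<Sum>k\<in>K. 1 / (1 + \<bar>real_of_int k\<bar>)\<^sup>2) \<le> (\<Sum>k\<in>int ` A \<union> (\<lambda>n. - int n) ` A. 1 / (1 + \<bar>real_of_int k\<bar>)\<^sup>2)"
      using A by (intro sum_mono2) auto
    also have "\<dots> \<le> (\<Sum>k\<in>int ` A. 1 / (1 + \<bar>real_of_int k\<bar>)\<^sup>2) + (\<Sum>k\<in>(\<lambda>n. - int n) ` A. 1 / (1 + \<bar>real_of_int k\<bar>)\<^sup>2)"
      using A by (subst sum.union_inter[symmetric]) (auto intro!: sum_nonneg)
    also have "\<dots> = sum ?u A + sum ?u A"
      by (simp add: sum.reindex inj_on_def)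
    finally show ?thesis using le by linarith
  qed
  then show ?thesis by blast
qed

lemma integer_lattice_norm_ge_1:
  assumes "\<xi> \<in> integer_lattice" "\<xi> \<noteq> 0"
  shows "norm \<xi> \<ge> 1"
proof -
  obtain i where "\<xi> $ i \<noteq> 0" using assms(2) by (auto simp: vec_eq_iff)
  then have "\<bar>\<xi> $ i\<bar> \<ge> 1" using assms(1) by (auto simp: integer_lattice_def intro: Ints_nonzero_abs_ge1)
  then show ?thesis using component_le_norm_cart[of \<xi> i] by linarith
qed

text \<open>
The exponent \<open>2 d\<close> is convenient rather than sharp: \<open>1 / |\<xi>|\<^sup>2\<^sup>d\<close> is dominated by the product over the
coordinates of \<open>4 / (1 + |\<xi>\<^sub>i|)\<^sup>2\<close>, and the sum of that product factorises.
\<close>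

lemma lattice_sum_bounded:
  "\<exists>S. \<forall>F::(real^'n::finite) set. finite F \<longrightarrow> F \<subseteq> integer_lattice - {0} \<longrightarrow>
     (\<Sum>\<xi>\<in>F. 1 / norm \<xi> ^ (2 * CARD('n))) \<le> S"
proof -
  let ?u = "\<lambda>k::int. 1 / (1 + \<bar>real_of_int k\<bar>)\<^sup>2"
  obtain S where S: "\<And>K. finite K \<Longrightarrow> (\<Sum>k\<in>K. ?u k) \<le> S"
    using sum_inverse_square_int by blast
  have "(\<Sum>\<xi>\<in>F. 1 / norm \<xi> ^ (2 * CARD('n))) \<le> 4 ^ CARD('n) * S ^ CARD('n)"
    if F: "finite F" "F \<subseteq> integer_lattice - {0}" for F :: "(real^'n) set"
  proof -
    define \<Phi> where "\<Phi> \<xi> = (\<lambda>i. \<lfloor>\<xi> $ i\<rfloor>)" for \<xi> :: "real^'n"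
    define K where "K = (\<Union>\<xi>\<in>F. range (\<Phi> \<xi>))"
    have K: "finite K" using F by (auto simp: K_def)
    have fl: "real_of_int \<lfloor>\<xi> $ i\<rfloor> = \<xi> $ i" if "\<xi> \<in> F" for \<xi> i
      using F that by (auto simp: integer_lattice_def subset_iff)
    have inj: "inj_on \<Phi> F"
    proof (rule inj_onI)
      fix \<xi> \<eta> assume *: "\<xi> \<in> F" "\<eta> \<in> F" "\<Phi> \<xi> = \<Phi> \<eta>"
      then have "\<lfloor>\<xi> $ i\<rfloor> = \<lfloor>\<eta> $ i\<rfloor>" for i by (auto simp: \<Phi>_def dest: fun_cong)
      then show "\<xi> = \<eta>" using fl[OF *(1)] fl[OF *(2)] by (metis vec_eq_iff)
    qed
    have summand: "1 / norm \<xi> ^ (2 * CARD('n)) \<le> 4 ^ CARD('n) * (\<Prod>i\<in>UNIV. ?u (\<Phi> \<xi> i))" if "\<xi> \<in> F" for \<xi>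
    proof -
      have n1: "norm \<xi> \<ge> 1" using integer_lattice_norm_ge_1 F that by blast
      have "(\<Prod>i\<in>(UNIV::'n set). 1 / (4 * (norm \<xi>)\<^sup>2)) \<le> (\<Prod>i\<in>UNIV. ?u (\<Phi> \<xi> i))"
      proof (rule prod_mono, safe)
        fix i
        have "1 + \<bar>\<xi> $ i\<bar> \<le> 2 * norm \<xi>" using component_le_norm_cart[of \<xi> i] n1 by linarith
        then have "(1 + \<bar>\<xi> $ i\<bar>)\<^sup>2 \<le> (2 * norm \<xi>)\<^sup>2" by (intro power_mono) auto
        then show "1 / (4 * (norm \<xi>)\<^sup>2) \<le> ?u (\<Phi> \<xi> i)"
          by (auto simp: \<Phi>_def fl[OF that] power_mult_distrib intro!: divide_left_mono mult_pos_pos)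
      qed (use n1 in auto)
      then have "4 ^ CARD('n) * (1 / (4 ^ CARD('n) * norm \<xi> ^ (2 * CARD('n)))) \<le> 4 ^ CARD('n) * (\<Prod>i\<in>UNIV. ?u (\<Phi> \<xi> i))"
        by (intro mult_left_mono) (simp_all add: power_mult_distrib power_mult power_divide)
      then show ?thesis by simp
    qed
    have "(\<Sum>\<xi>\<in>F. 1 / norm \<xi> ^ (2 * CARD('n))) \<le> (\<Sum>\<xi>\<in>F. 4 ^ CARD('n) * (\<Prod>i\<in>UNIV. ?u (\<Phi> \<xi> i)))"
      by (rule sum_mono) (rule summand)
    also have "\<dots> = 4 ^ CARD('n) * (\<Sum>g\<in>\<Phi> ` F. \<Prod>i\<in>UNIV. ?u (g i))"
      by (simp add: sum.reindex[OF inj] sum_distrib_left)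
    also have "(\<Sum>g\<in>\<Phi> ` F. \<Prod>i\<in>UNIV. ?u (g i)) \<le> (\<Sum>g\<in>PiE (UNIV::'n set) (\<lambda>_. K). \<Prod>i\<in>UNIV. ?u (g i))"
    proof (rule sum_mono2)
      show "finite (UNIV \<rightarrow>\<^sub>E K :: ('n \<Rightarrow> int) set)" using K by (simp add: finite_PiE)
      show "\<Phi> ` F \<subseteq> UNIV \<rightarrow>\<^sub>E K" by (auto simp: K_def)
    qed (auto intro!: prod_nonneg)
    also have "(\<Sum>g\<in>PiE (UNIV::'n set) (\<lambda>_. K). \<Prod>i\<in>UNIV. ?u (g i)) = (\<Prod>i\<in>(UNIV::'n set). \<Sum>k\<in>K. ?u k)"
      using K by (subst prod_sum_PiE) auto
    also have "4 ^ CARD('n) * (\<Prod>i\<in>(UNIV::'n set). \<Sum>k\<in>K. ?u k) \<le> 4 ^ CARD('n) * S ^ CARD('n)"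
      using S[OF K] by (auto intro!: mult_left_mono power_mono sum_nonneg)
    finally show ?thesis by simp
  qed
  then show ?thesis by blast
qed

section \<open>Integration by parts against a plane wave\<close>

lemma has_vector_derivative_along_axis:
  assumes "f differentiable (at (y + t *\<^sub>R axis i 1))"
  shows "((\<lambda>s. f (y + s *\<^sub>R axis i 1)) has_vector_derivative \<i> * D_coord i f (y + t *\<^sub>R axis i 1)) (at t)"
proof -
  from assms obtain f' where f': "(f has_derivative f') (at (y + t *\<^sub>R axis i 1))"
    by (auto simp: differentiable_def)
  show ?thesis
    using has_vector_derivative_along[OF f'] by (simp add: D_coord_has_derivative[OF f'] mult.assoc[symmetric])
qed

text \<open>
The difference quotients of \<open>F\<close> along an axis integrate to 0 by translation invariance, and they converge to the
derivative dominatedly, since they are bounded by its supremum and supported in a slightly larger ball.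
\<close>

lemma integral_D_coord_zero:
  fixes F :: "real^'n::finite \<Rightarrow> complex"
  assumes dF: "\<And>y. F differentiable (at y)" and cont: "continuous_on UNIV (D_coord i F)"
    and supp: "\<And>y. y \<notin> cball x \<rho> \<Longrightarrow> F y = 0"
  shows "(LINT y|lborel. D_coord i F y) = 0"
proof -
  let ?e = "axis i 1 :: real^'n"
  have contF: "continuous_on UNIV F"
    using dF by (auto intro!: continuous_at_imp_continuous_on differentiable_imp_continuous_within)
  have IF: "integrable lborel F"
    by (rule integrable_compact_support[OF contF compact_cball supp])
  have "bounded (D_coord i F ` cball x \<rho>)"
    by (intro compact_imp_bounded compact_continuous_image continuous_on_subset[OF cont]) auto
  then obtain B where B: "B > 0" "\<And>y. y \<in> cball x \<rho> \<Longrightarrow> norm (D_coord i F y) \<le> B"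
    by (auto simp: bounded_pos)
  have B': "norm (D_coord i F y) \<le> B" for y
    using B D_coord_vanish[OF closed_cball, of x \<rho> F y i] supp by (cases "y \<in> cball x \<rho>") auto
  define h where "h n = 1 / (real n + 1)" for n
  have h: "0 < h n" "h n \<le> 1" for n by (auto simp: h_def)
  define G where "G n y = (F (h n *\<^sub>R ?e + y) - F y) /\<^sub>R h n" for n y
  have intG: "(LINT y|lborel. G n y) = 0" for n
  proof -
    have meas: "F \<in> borel_measurable borel" using IF by auto
    have "(LINT y|lborel. F (h n *\<^sub>R ?e + y)) = (LINT y|distr lborel borel ((+) (h n *\<^sub>R ?e)). F y)"
      by (rule integral_distr[symmetric]) (use meas in auto)
    then have eq: "(LINT y|lborel. F (h n *\<^sub>R ?e + y)) = (LINT y|lborel. F y)"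
      by (simp add: lborel_distr_plus)
    have "integrable lborel (\<lambda>y. F (h n *\<^sub>R ?e + y))"
    proof -
      have "integrable (distr lborel borel ((+) (h n *\<^sub>R ?e))) F" using IF by (simp add: lborel_distr_plus)
      then show ?thesis by (subst (asm) integrable_distr_eq) (use meas in auto)
    qed
    then show ?thesis unfolding G_def using IF eq by simp
  qed
  have G_le: "norm (G n y) \<le> indicator (cball x (\<rho> + 1)) y *\<^sub>R B" for n y
  proof (cases "y \<in> cball x (\<rho> + 1)")
    case True
    have "norm (F (y + h n *\<^sub>R ?e) - F (y + 0 *\<^sub>R ?e)) \<le> B * norm (h n - 0)"
    proof (rule differentiable_bound[of "{0..h n}" "\<lambda>t. F (y + t *\<^sub>R ?e)" "\<lambda>t s. s *\<^sub>R (\<i> * D_coord i F (y + t *\<^sub>R ?e))"])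
      fix t
      show "((\<lambda>t. F (y + t *\<^sub>R ?e)) has_derivative (\<lambda>s. s *\<^sub>R (\<i> * D_coord i F (y + t *\<^sub>R ?e)))) (at t within {0..h n})"
        using has_vector_derivative_along_axis[OF dF] unfolding has_vector_derivative_def
        by (rule has_derivative_at_withinI)
      show "onorm (\<lambda>s. s *\<^sub>R (\<i> * D_coord i F (y + t *\<^sub>R ?e))) \<le> B"
        using B' by (intro onorm_le) (auto simp: norm_mult mult.commute[of B] intro: mult_left_mono)
    qed (use h[of n] in auto)
    then have "norm (F (h n *\<^sub>R ?e + y) - F y) \<le> B * h n" using h(1)[of n] by (simp add: add.commute)
    moreover have "norm (G n y) = norm (F (h n *\<^sub>R ?e + y) - F y) / h n"
      using h(1)[of n] by (simp add: G_def divide_inverse mult.commute)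
    ultimately show ?thesis using h(1)[of n] True by (simp add: pos_divide_le_eq)
  next
    case False
    have "y \<notin> cball x \<rho>" using False by auto
    moreover have "h n *\<^sub>R ?e + y \<notin> cball x \<rho>"
    proof
      assume "h n *\<^sub>R ?e + y \<in> cball x \<rho>"
      then have "dist x y \<le> \<rho> + dist (h n *\<^sub>R ?e + y) y"
        by (metis add_mono_thms_linordered_semiring(3) dist_triangle mem_cball order_trans)
      also have "dist (h n *\<^sub>R ?e + y) y = h n" using h(1)[of n] by (simp add: dist_norm norm_axis_1)
      finally show False using False h(2)[of n] by auto
    qed
    ultimately show ?thesis using supp False by (simp add: G_def)
  qed
  have lim: "(\<lambda>n. G n y) \<longlonglongrightarrow> \<i> * D_coord i F y" for y
  proof -
    have "((\<lambda>s. F (y + s *\<^sub>R ?e)) has_vector_derivative \<i> * D_coord i F y) (at 0)"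
      using has_vector_derivative_along_axis[of F y 0 i] dF by simp
    then have "((\<lambda>s. norm (F (y + s *\<^sub>R ?e) - F y - s *\<^sub>R (\<i> * D_coord i F y)) / norm s) \<longlongrightarrow> 0) (at 0)"
      by (simp add: has_vector_derivative_def has_derivative_at)
    moreover have "\<forall>\<^sub>F s in at 0. norm (F (y + s *\<^sub>R ?e) - F y - s *\<^sub>R (\<i> * D_coord i F y)) / norm s
        = norm ((F (y + s *\<^sub>R ?e) - F y) /\<^sub>R s - \<i> * D_coord i F y)"
      unfolding eventually_at_filter
    proof (intro always_eventually allI impI)
      fix s :: real assume "s \<noteq> 0"
      then have "(F (y + s *\<^sub>R ?e) - F y) /\<^sub>R s - \<i> * D_coord i F y
          = (F (y + s *\<^sub>R ?e) - F y - s *\<^sub>R (\<i> * D_coord i F y)) /\<^sub>R s"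
        by (simp add: scaleR_diff_right)
      then show "norm (F (y + s *\<^sub>R ?e) - F y - s *\<^sub>R (\<i> * D_coord i F y)) / norm s
        = norm ((F (y + s *\<^sub>R ?e) - F y) /\<^sub>R s - \<i> * D_coord i F y)"
        by (simp add: divide_inverse mult.commute)
    qed
    ultimately have "((\<lambda>s. norm ((F (y + s *\<^sub>R ?e) - F y) /\<^sub>R s - \<i> * D_coord i F y)) \<longlongrightarrow> 0) (at 0)"
      by (rule Lim_transform_eventually)
    then have "((\<lambda>s. (F (y + s *\<^sub>R ?e) - F y) /\<^sub>R s) \<longlongrightarrow> \<i> * D_coord i F y) (at 0)"
      by (subst Lim_null) (rule tendsto_norm_zero_cancel)
    moreover have "filterlim h (at 0) sequentially"
    proof -
      have "h \<longlonglongrightarrow> 0"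
        unfolding h_def using LIMSEQ_inverse_real_of_nat by (simp add: inverse_eq_divide add.commute)
      then show ?thesis using h(1) by (auto simp: filterlim_at less_imp_neq[symmetric])
    qed
    ultimately have "(\<lambda>n. (F (y + h n *\<^sub>R ?e) - F y) /\<^sub>R h n) \<longlonglongrightarrow> \<i> * D_coord i F y"
      by (rule filterlim_compose)
    then show ?thesis unfolding G_def by (simp only: add.commute)
  qed
  have "(\<lambda>n. LINT y|lborel. G n y) \<longlonglongrightarrow> (LINT y|lborel. \<i> * D_coord i F y)"
  proof (rule integral_dominated_convergence[where w = "\<lambda>y. indicator (cball x (\<rho> + 1)) y *\<^sub>R B"])
    show "integrable lborel (\<lambda>y. indicator (cball x (\<rho> + 1)) y *\<^sub>R B)"
      by (rule integrable_on_compact) auto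
    have "continuous_on UNIV (\<lambda>y. \<i> * D_coord i F y)" by (intro continuous_intros cont)
    then show "(\<lambda>y. \<i> * D_coord i F y) \<in> borel_measurable lborel"
      by (simp add: borel_measurable_continuous_onI)
    have "continuous_on UNIV (G n)" for n
      unfolding G_def by (intro continuous_intros continuous_on_compose2[OF contF]) auto
    then show "G n \<in> borel_measurable lborel" for n
      by (simp add: borel_measurable_continuous_onI)
  qed (use lim G_le in auto)
  then have "(LINT y|lborel. \<i> * D_coord i F y) = 0"
    by (simp add: intG LIMSEQ_const_iff)
  then show ?thesis by simp
qed

lemma has_derivative_plane_wave:
  "((\<lambda>y. cis (- (\<xi> \<bullet> y))) has_derivative (\<lambda>v. - \<i> * of_real (\<xi> \<bullet> v) * cis (- (\<xi> \<bullet> y)))) (at y)"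
proof -
  have "((\<lambda>y. - (\<i> * complex_of_real (\<xi> \<bullet> y))) has_derivative (\<lambda>v. - (\<i> * complex_of_real (\<xi> \<bullet> v)))) (at y)"
    by (auto intro!: derivative_eq_intros)
  from has_derivative_compose[OF this DERIV_exp[unfolded has_field_derivative_def]]
  show ?thesis by (simp add: cis_conv_exp mult_ac)
qed

lemma D_coord_plane_wave:
  "D_coord i (\<lambda>y. cis (- (\<xi> \<bullet> y))) y = - of_real (\<xi> $ i) * cis (- (\<xi> \<bullet> y))"
  unfolding D_coord_has_derivative[OF has_derivative_plane_wave]
  by (simp add: inner_axis algebra_simps)

text \<open>
The vanishing condition is imposed on the whole space, so that a product with a function that is only controlled on
the open ball still extends continuously by 0. The gap between the radii \<open>r / 2\<close> and \<open>r\<close> leaves room for this.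
\<close>

definition test_fun :: "nat \<Rightarrow> (nat \<Rightarrow> real) \<Rightarrow> real^'n::finite \<Rightarrow> real \<Rightarrow> (real^'n \<Rightarrow> complex) \<Rightarrow> bool" where
  "test_fun k A x r \<phi> \<longleftrightarrow> C_bounded k A (ball x r) \<phi> \<and> (\<forall>y. y \<notin> cball x (r / 2) \<longrightarrow> \<phi> y = 0)"

lemma test_fun_le: "test_fun k A x r \<phi> \<Longrightarrow> j \<le> k \<Longrightarrow> test_fun j A x r \<phi>"
  by (auto simp: test_fun_def intro: C_bounded_le)

lemma test_fun_continuous: "test_fun k A x r \<phi> \<Longrightarrow> continuous_on (ball x r) \<phi>"
  by (auto simp: test_fun_def intro: C_bounded_continuous)

lemma test_fun_zero: "test_fun k A x r \<phi> \<Longrightarrow> y \<notin> cball x (r / 2) \<Longrightarrow> \<phi> y = 0"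
  by (auto simp: test_fun_def)

lemma test_fun_D_coord:
  "test_fun (Suc k) A x r \<phi> \<Longrightarrow> test_fun k (\<lambda>n. A (Suc n)) x r (D_coord i \<phi>)"
  using D_coord_vanish[OF closed_cball, of x "r / 2" \<phi>] by (auto simp: test_fun_def)

lemma test_fun_mult:
  "C_bounded k B (ball x r) V \<Longrightarrow> test_fun k A x r \<phi> \<Longrightarrow> test_fun k (\<lambda>n. leibniz_bound n B A) x r (\<lambda>y. V y * \<phi> y)"
  by (auto simp: test_fun_def intro: C_bounded_mult)

lemma test_fun_bound_nonneg: "test_fun k A x r \<phi> \<Longrightarrow> r > 0 \<Longrightarrow> A 0 \<ge> 0"
  unfolding test_fun_def by (metis C_bounded_norm centre_in_ball norm_ge_zero order_trans)

lemma continuous_on_extend_zero: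
  fixes f :: "real^'n::finite \<Rightarrow> complex"
  assumes "continuous_on (ball x r) f" "\<And>y. y \<notin> cball x (r / 2) \<Longrightarrow> f y = 0" "r > 0"
  shows "continuous_on UNIV f"
proof -
  have U: "UNIV = ball x r \<union> - cball x (r / 2)" using assms(3) by auto
  have "continuous_on (- cball x (r / 2)) f"
    using continuous_on_const[of "- cball x (r / 2)" 0] assms(2)
    by (subst continuous_on_cong[of _ "- cball x (r / 2)" _ "\<lambda>_. 0"]) auto
  then show ?thesis
    unfolding U using assms(1) by (intro continuous_on_open_Un) auto
qed

lemma cball_subset_period_cube: "r \<le> 1 \<Longrightarrow> cball x (r / 2) \<subseteq> period_cube x"
proof
  fix y assume "r \<le> 1" "y \<in> cball x (r / 2)"
  then have "norm (y - x) \<le> 1" by (simp add: dist_norm norm_minus_commute)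
  then show "y \<in> period_cube x" unfolding mem_period_cube
    by (metis component_le_norm_cart pi_ge_two order_trans one_le_numeral vector_minus_component)
qed

definition pairing :: "real^'n::finite \<Rightarrow> 'n list \<Rightarrow> (real^'n \<Rightarrow> complex) \<Rightarrow> (real^'n \<Rightarrow> complex) \<Rightarrow> complex" where
  "pairing \<xi> l \<phi> \<psi> = fourier_coeff (\<lambda>y. \<phi> y * iter_D l \<psi> y) \<xi>"

lemma test_fun_times_continuous:
  assumes "test_fun k A x r \<phi>" "continuous_on (ball x r) g" "r > 0"
  shows "continuous_on UNIV (\<lambda>y. \<phi> y * g y)"
  by (rule continuous_on_extend_zero)
    (auto intro!: continuous_intros test_fun_continuous[OF assms(1)] assms simp: test_fun_zero[OF assms(1)])

lemma integrable_test_fun: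
  assumes "test_fun k A x r \<phi>" "continuous_on (ball x r) g" "r > 0"
  shows "integrable lborel (\<lambda>y. \<phi> y * g y * cis (- (\<xi> \<bullet> y)))"
  by (rule integrable_compact_support[of _ "cball x (r / 2)"])
    (auto intro!: continuous_intros test_fun_times_continuous[OF assms] simp: test_fun_zero[OF assms(1)])

lemma continuous_iter_D: "smooth_on (ball x r) \<psi> \<Longrightarrow> continuous_on (ball x r) (iter_D l \<psi>)"
  by (rule smooth_on_continuous[OF smooth_on_iter_D]) auto

text \<open>
The total derivative of \<open>\<phi> \<cdot> D\<^sub>l \<psi> \<cdot> e\<close>, with \<open>e\<close> the plane wave, integrates to 0; its three terms are those of the claim.
Repeated use trades derivatives of \<open>\<psi>\<close> for powers of \<open>\<xi>\<close> and derivatives of \<open>\<phi>\<close>.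
\<close>

lemma pairing_Cons:
  fixes \<phi> :: "real^'n::finite \<Rightarrow> complex"
  assumes \<phi>: "test_fun (Suc 0) A x r \<phi>" and \<psi>: "smooth_on (ball x r) \<psi>" and r: "r > 0"
  shows "pairing \<xi> (i # l) \<phi> \<psi> = of_real (\<xi> $ i) * pairing \<xi> l \<phi> \<psi> - pairing \<xi> l (D_coord i \<phi>) \<psi>"
proof -
  define g where "g = iter_D l \<psi>"
  define e where "e y = cis (- (\<xi> \<bullet> y))" for y
  define F where "F y = \<phi> y * g y * e y" for y
  have dg: "g differentiable (at y)" if "y \<in> ball x r" for y
    unfolding g_def using that by (intro smooth_on_differentiable[OF smooth_on_iter_D[OF _ \<psi>]]) auto
  have d\<phi>: "\<phi> differentiable (at y)" if "y \<in> ball x r" for y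
    using \<phi> that by (auto simp: test_fun_def)
  have de: "e differentiable (at y)" for y
    unfolding e_def differentiable_def using has_derivative_plane_wave by blast
  have D\<phi>: "test_fun 0 (\<lambda>n. A (Suc n)) x r (D_coord i \<phi>)" by (rule test_fun_D_coord[OF \<phi>])
  have cg: "continuous_on (ball x r) g" "continuous_on (ball x r) (D_coord i g)"
    unfolding g_def using continuous_iter_D[OF \<psi>, of l] continuous_iter_D[OF \<psi>, of "i # l"] by auto
  have F0: "F y = 0" if "y \<notin> cball x (r / 2)" for y
    using test_fun_zero[OF \<phi> that] by (simp add: F_def)
  have dF: "F differentiable (at y)" for y
  proof (cases "y \<in> ball x r")
    case True
    then show ?thesis unfolding F_def by (intro differentiable_mult dg d\<phi> de)
  next
    case False
    then have "y \<in> - cball x (r / 2)" using r by auto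
    then show ?thesis
      by (rule differentiable_cong_open[of "- cball x (r / 2)" y "\<lambda>_. 0", rotated]) (use F0 in auto)
  qed
  have DF: "D_coord i F y = D_coord i \<phi> y * g y * e y + \<phi> y * D_coord i g y * e y - of_real (\<xi> $ i) * (\<phi> y * g y * e y)" for y
  proof (cases "y \<in> ball x r")
    case True
    have "D_coord i F y = (D_coord i \<phi> y * g y + \<phi> y * D_coord i g y) * e y + \<phi> y * g y * D_coord i e y"
      unfolding F_def using True by (simp add: D_coord_mult dg d\<phi> de differentiable_mult)
    also have "D_coord i e y = - of_real (\<xi> $ i) * e y"
      unfolding e_def[abs_def] by (rule D_coord_plane_wave)
    finally show ?thesis by (simp add: algebra_simps)
  next
    case False
    then have y: "y \<notin> cball x (r / 2)" using r by auto
    show ?thesis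
      using D_coord_vanish[OF closed_cball F0 y] test_fun_zero[OF \<phi> y] test_fun_zero[OF D\<phi> y] by simp
  qed
  have I: "integrable lborel (\<lambda>y. D_coord i \<phi> y * g y * e y)" "integrable lborel (\<lambda>y. \<phi> y * D_coord i g y * e y)"
    "integrable lborel (\<lambda>y. \<phi> y * g y * e y)"
    unfolding e_def by (intro integrable_test_fun[OF D\<phi> cg(1) r] integrable_test_fun[OF \<phi> cg(2) r] integrable_test_fun[OF \<phi> cg(1) r])+
  have ce: "continuous_on UNIV e" unfolding e_def by (intro continuous_intros)
  have "continuous_on UNIV (D_coord i F)"
    unfolding DF[abs_def]
    by (intro continuous_intros ce test_fun_times_continuous[OF D\<phi> cg(1) r] test_fun_times_continuous[OF \<phi> cg(2) r]
        test_fun_times_continuous[OF \<phi> cg(1) r])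
  from integral_D_coord_zero[OF dF this F0]
  have "(LINT y|lborel. D_coord i \<phi> y * g y * e y + \<phi> y * D_coord i g y * e y - of_real (\<xi> $ i) * (\<phi> y * g y * e y)) = 0"
    unfolding DF .
  then have "(LINT y|lborel. D_coord i \<phi> y * g y * e y) + (LINT y|lborel. \<phi> y * D_coord i g y * e y)
      - of_real (\<xi> $ i) * (LINT y|lborel. \<phi> y * g y * e y) = 0"
    using I by simp
  then show ?thesis
    by (simp add: pairing_def fourier_coeff_def g_def e_def algebra_simps)
qed

definition local_norm :: "real^'n::finite \<Rightarrow> real \<Rightarrow> (real^'n \<Rightarrow> complex) \<Rightarrow> real" where
  "local_norm x r \<psi> = sqrt (LINT y|lborel. indicator (cball x (r / 2)) y *\<^sub>R (norm (\<psi> y))\<^sup>2)"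

lemma local_norm_nonneg: "local_norm x r \<psi> \<ge> 0"
  unfolding local_norm_def by (intro real_sqrt_ge_zero integral_nonneg_AE) auto

section \<open>Mean-square and pointwise bounds on the pairings\<close>

lemma pairing_Nil_L2:
  fixes \<phi> :: "real^'n::finite \<Rightarrow> complex"
  assumes \<phi>: "test_fun k A x r \<phi>" and \<psi>: "continuous_on (ball x r) \<psi>" and r: "0 < r" "r \<le> 1"
    and F: "finite F" "F \<subseteq> integer_lattice"
  shows "L2_set (\<lambda>\<xi>. norm (pairing \<xi> [] \<phi> \<psi>)) F \<le> sqrt ((2 * pi) ^ CARD('n)) * A 0 * local_norm x r \<psi>"
proof -
  let ?K = "cball x (r / 2)"
  have A0: "A 0 \<ge> 0" using test_fun_bound_nonneg[OF \<phi> r(1)] .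
  have KU: "?K \<subseteq> ball x r" using r by auto
  have cont: "continuous_on UNIV (\<lambda>y. \<phi> y * \<psi> y)" by (rule test_fun_times_continuous[OF \<phi> \<psi> r(1)])
  have supp: "\<phi> y * \<psi> y = 0" if "y \<notin> ?K" for y using test_fun_zero[OF \<phi> that] by simp
  have supp': "\<phi> y * \<psi> y = 0" if "y \<notin> period_cube x" for y
    using supp cball_subset_period_cube[OF r(2), of x] that by blast
  have "(\<Sum>\<xi>\<in>F. (norm (pairing \<xi> [] \<phi> \<psi>))\<^sup>2) \<le> (2 * pi) ^ CARD('n) * (LINT y|lborel. (norm (\<phi> y * \<psi> y))\<^sup>2)"
    using bessel_inequality[OF cont supp' F] by (simp add: pairing_def)
  also have "(LINT y|lborel. (norm (\<phi> y * \<psi> y))\<^sup>2) \<le> (LINT y|lborel. (A 0)\<^sup>2 * (indicator ?K y *\<^sub>R (norm (\<psi> y))\<^sup>2))"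
  proof (rule integral_mono)
    show "integrable lborel (\<lambda>y. (norm (\<phi> y * \<psi> y))\<^sup>2)"
      by (rule integrable_compact_support[of _ ?K]) (use cont supp in \<open>auto intro!: continuous_intros\<close>)
    show "integrable lborel (\<lambda>y. (A 0)\<^sup>2 * (indicator ?K y *\<^sub>R (norm (\<psi> y))\<^sup>2))"
      by (intro integrable_mult_right integrable_on_compact continuous_intros continuous_on_subset[OF \<psi> KU]) auto
    fix y
    show "(norm (\<phi> y * \<psi> y))\<^sup>2 \<le> (A 0)\<^sup>2 * (indicator ?K y *\<^sub>R (norm (\<psi> y))\<^sup>2)"
    proof (cases "y \<in> ?K")
      case True
      then have "norm (\<phi> y) \<le> A 0"
        using \<phi> C_bounded_norm[OF _ subsetD[OF KU True]] unfolding test_fun_def by blast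
      then have "(norm (\<phi> y))\<^sup>2 \<le> (A 0)\<^sup>2" by (intro power_mono) auto
      then show ?thesis using True by (simp add: norm_mult power_mult_distrib mult_right_mono)
    qed (use supp in simp)
  qed
  also have "\<dots> = (A 0)\<^sup>2 * (LINT y|lborel. indicator ?K y *\<^sub>R (norm (\<psi> y))\<^sup>2)"
    by (rule integral_mult_right_zero)
  finally have le: "(\<Sum>\<xi>\<in>F. (norm (pairing \<xi> [] \<phi> \<psi>))\<^sup>2) \<le> (2 * pi) ^ CARD('n) * ((A 0)\<^sup>2 * (LINT y|lborel. indicator ?K y *\<^sub>R (norm (\<psi> y))\<^sup>2))"
    by simp
  show ?thesis unfolding L2_set_def local_norm_def
    using real_sqrt_le_mono[OF le] A0 by (simp add: real_sqrt_mult)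
qed

lemma le_mult_of_one_le: "1 \<le> w \<Longrightarrow> 0 \<le> a \<Longrightarrow> a \<le> w * a" for a w :: real
  using mult_right_mono[of 1 w a] by simp

text \<open>
Each derivative removed from \<open>\<psi>\<close> costs at most a factor \<open>|\<xi>| \<le> R\<close> or a derivative of the cutoff; without derivatives
this is Bessel's inequality. The cutoff dependence is confined to \<open>A\<close>, hence to the constant.
\<close>

lemma pairing_L2:
  assumes r: "0 < r" "r \<le> 1"
  shows "\<exists>C\<ge>0. \<forall>(x::real^'n::finite) \<phi> \<psi> F R. test_fun (length l) A x r \<phi> \<longrightarrow> smooth_on (ball x r) \<psi> \<longrightarrow>
    finite F \<longrightarrow> F \<subseteq> integer_lattice \<longrightarrow> R \<ge> 1 \<longrightarrow> (\<forall>\<xi>\<in>F. norm \<xi> \<le> R) \<longrightarrow>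
    L2_set (\<lambda>\<xi>. norm (pairing \<xi> l \<phi> \<psi>)) F \<le> C * R ^ length l * local_norm x r \<psi>"
proof (induction l arbitrary: A)
  case Nil
  show ?case
  proof (rule exI[of _ "sqrt ((2 * pi) ^ CARD('n)) * \<bar>A 0\<bar>"], intro conjI allI impI)
    fix x :: "real^'n" and \<phi> \<psi> :: "real^'n \<Rightarrow> complex" and F :: "(real^'n) set" and R :: real
    assume a: "test_fun (length []) A x r \<phi>" "smooth_on (ball x r) \<psi>" "finite F" "F \<subseteq> integer_lattice"
    have "A 0 \<ge> 0" using test_fun_bound_nonneg[OF a(1) r(1)] .
    then show "L2_set (\<lambda>\<xi>. norm (pairing \<xi> [] \<phi> \<psi>)) F \<le> sqrt ((2 * pi) ^ CARD('n)) * \<bar>A 0\<bar> * R ^ length [] * local_norm x r \<psi>"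
      using pairing_Nil_L2[OF a(1) smooth_on_continuous[OF a(2)] r a(3,4)] by simp
  qed auto
next
  case (Cons i l)
  obtain C1 where C1: "C1 \<ge> 0" "\<And>(x::real^'n) \<phi> \<psi> F R. \<lbrakk>test_fun (length l) A x r \<phi>; smooth_on (ball x r) \<psi>;
    finite F; F \<subseteq> integer_lattice; R \<ge> 1; \<forall>\<xi>\<in>F. norm \<xi> \<le> R\<rbrakk> \<Longrightarrow>
    L2_set (\<lambda>\<xi>. norm (pairing \<xi> l \<phi> \<psi>)) F \<le> C1 * R ^ length l * local_norm x r \<psi>"
    using Cons.IH[of A] by blast
  obtain C2 where C2: "C2 \<ge> 0" "\<And>(x::real^'n) \<phi> \<psi> F R. \<lbrakk>test_fun (length l) (\<lambda>n. A (Suc n)) x r \<phi>; smooth_on (ball x r) \<psi>;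
    finite F; F \<subseteq> integer_lattice; R \<ge> 1; \<forall>\<xi>\<in>F. norm \<xi> \<le> R\<rbrakk> \<Longrightarrow>
    L2_set (\<lambda>\<xi>. norm (pairing \<xi> l \<phi> \<psi>)) F \<le> C2 * R ^ length l * local_norm x r \<psi>"
    using Cons.IH[of "\<lambda>n. A (Suc n)"] by blast
  show ?case
  proof (rule exI[of _ "C1 + C2"], intro conjI allI impI)
    fix x :: "real^'n" and \<phi> \<psi> :: "real^'n \<Rightarrow> complex" and F :: "(real^'n) set" and R :: real
    assume a: "test_fun (length (i # l)) A x r \<phi>" "smooth_on (ball x r) \<psi>" "finite F" "F \<subseteq> integer_lattice"
      and R: "R \<ge> 1" "\<forall>\<xi>\<in>F. norm \<xi> \<le> R"
    let ?L = "local_norm x r \<psi>"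
    have t1: "test_fun (length l) A x r \<phi>" "test_fun (Suc 0) A x r \<phi>" using a(1) by (auto intro: test_fun_le)
    have t2: "test_fun (length l) (\<lambda>n. A (Suc n)) x r (D_coord i \<phi>)" using test_fun_D_coord a(1) by auto
    have "L2_set (\<lambda>\<xi>. norm (pairing \<xi> (i # l) \<phi> \<psi>)) F
        \<le> L2_set (\<lambda>\<xi>. R * norm (pairing \<xi> l \<phi> \<psi>) + norm (pairing \<xi> l (D_coord i \<phi>) \<psi>)) F"
    proof (rule L2_set_mono)
      fix \<xi> assume "\<xi> \<in> F"
      then have "\<bar>\<xi> $ i\<bar> \<le> R" using R(2) component_le_norm_cart[of \<xi> i] by fastforce
      then have "norm (of_real (\<xi> $ i) * pairing \<xi> l \<phi> \<psi>) \<le> R * norm (pairing \<xi> l \<phi> \<psi>)"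
        by (simp add: norm_mult mult_right_mono)
      then show "norm (pairing \<xi> (i # l) \<phi> \<psi>) \<le> R * norm (pairing \<xi> l \<phi> \<psi>) + norm (pairing \<xi> l (D_coord i \<phi>) \<psi>)"
        unfolding pairing_Cons[OF t1(2) a(2) r(1)]
        by (intro order_trans[OF norm_triangle_ineq4] add_right_mono)
    qed auto
    also have "\<dots> \<le> L2_set (\<lambda>\<xi>. R * norm (pairing \<xi> l \<phi> \<psi>)) F + L2_set (\<lambda>\<xi>. norm (pairing \<xi> l (D_coord i \<phi>) \<psi>)) F"
      by (rule L2_set_triangle_ineq)
    also have "L2_set (\<lambda>\<xi>. R * norm (pairing \<xi> l \<phi> \<psi>)) F = R * L2_set (\<lambda>\<xi>. norm (pairing \<xi> l \<phi> \<psi>)) F"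
      using R by (simp add: L2_set_right_distrib)
    also have "\<dots> + L2_set (\<lambda>\<xi>. norm (pairing \<xi> l (D_coord i \<phi>) \<psi>)) F
        \<le> R * (C1 * R ^ length l * ?L) + C2 * R ^ length l * ?L"
      using R by (intro add_mono mult_left_mono C1(2)[OF t1(1) a(2-4) R] C2(2)[OF t2 a(2-4) R]) auto
    also have "C2 * R ^ length l * ?L \<le> R * (C2 * R ^ length l * ?L)"
      using R C2(1) local_norm_nonneg[of x r \<psi>] by (intro le_mult_of_one_le mult_nonneg_nonneg) auto
    finally show "L2_set (\<lambda>\<xi>. norm (pairing \<xi> (i # l) \<phi> \<psi>)) F \<le> (C1 + C2) * R ^ length (i # l) * ?L"
      by (simp add: algebra_simps)
  qed (use C1 C2 in auto)
qed

definition monomial :: "real^'n::finite \<Rightarrow> 'n list \<Rightarrow> real" where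
  "monomial \<xi> l = prod_list (map (\<lambda>i. \<xi> $ i) l)"

lemma monomial_mi_list: "monomial \<xi> (mi_list \<alpha>) = mi_power \<xi> \<alpha>"
proof -
  have "distinct L \<Longrightarrow> monomial \<xi> (concat (map (\<lambda>i. replicate (\<alpha> i) i) L)) = (\<Prod>i\<in>set L. (\<xi> $ i) ^ \<alpha> i)" for L
    by (induction L) (auto simp: monomial_def prod_list_replicate)
  from this[of "sorted_list_of_set UNIV"] show ?thesis by (simp add: mi_list_def mi_power_def)
qed

text \<open>
A bound \<open>E\<close> on the undifferentiated pairings, valid for all cutoffs, propagates to the pairings with derivatives. The
second estimate says that the leading term \<open>\<xi>\<^sup>l\<close> is exact up to one power of \<open>|\<xi>|\<close> less, since every other term has spent a
derivative on the cutoff. The predicate \<open>P\<close> stands for whatever data \<open>E\<close> depends on.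
\<close>

lemma pairing_growth:
  fixes P :: "real^'n::finite \<Rightarrow> (real^'n \<Rightarrow> complex) \<Rightarrow> real^'n \<Rightarrow> real \<Rightarrow> bool"
  assumes P: "\<And>x \<psi> \<xi> E. P x \<psi> \<xi> E \<Longrightarrow> smooth_on (ball x r) \<psi> \<and> norm \<xi> \<ge> 1 \<and> E \<ge> 0"
    and base: "\<And>A. \<exists>C\<ge>0. \<forall>x \<psi> \<xi> E \<phi>. P x \<psi> \<xi> E \<longrightarrow> test_fun k A x r \<phi> \<longrightarrow> norm (pairing \<xi> [] \<phi> \<psi>) \<le> C * E"
    and r: "r > 0"
  shows "\<exists>C\<ge>0. \<forall>x \<psi> \<xi> E \<phi>. P x \<psi> \<xi> E \<longrightarrow> test_fun (k + length l) A x r \<phi> \<longrightarrow>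
    norm (pairing \<xi> l \<phi> \<psi>) \<le> C * (norm \<xi> ^ length l * E) \<and>
    norm \<xi> * norm (pairing \<xi> l \<phi> \<psi> - of_real (monomial \<xi> l) * pairing \<xi> [] \<phi> \<psi>) \<le> C * (norm \<xi> ^ length l * E)"
proof (induction l arbitrary: A)
  case Nil
  from base[of A] obtain C where "C \<ge> 0"
    "\<And>x \<psi> \<xi> E \<phi>. P x \<psi> \<xi> E \<Longrightarrow> test_fun k A x r \<phi> \<Longrightarrow> norm (pairing \<xi> [] \<phi> \<psi>) \<le> C * E" by blast
  then show ?case using P by (intro exI[of _ C]) (auto simp: monomial_def)
next
  case (Cons i l)
  let ?X = "\<lambda>C \<xi> E. C * (norm \<xi> ^ length l * E)"
  obtain C1 where C1: "C1 \<ge> 0" "\<And>x \<psi> \<xi> E \<phi>. P x \<psi> \<xi> E \<Longrightarrow> test_fun (k + length l) A x r \<phi> \<Longrightarrow>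
    norm (pairing \<xi> l \<phi> \<psi>) \<le> ?X C1 \<xi> E \<and>
    norm \<xi> * norm (pairing \<xi> l \<phi> \<psi> - of_real (monomial \<xi> l) * pairing \<xi> [] \<phi> \<psi>) \<le> ?X C1 \<xi> E"
    using Cons.IH[of A] by blast
  obtain C2 where C2: "C2 \<ge> 0" "\<And>x \<psi> \<xi> E \<phi>. P x \<psi> \<xi> E \<Longrightarrow> test_fun (k + length l) (\<lambda>n. A (Suc n)) x r \<phi> \<Longrightarrow>
    norm (pairing \<xi> l \<phi> \<psi>) \<le> ?X C2 \<xi> E"
    using Cons.IH[of "\<lambda>n. A (Suc n)"] by blast
  show ?case
  proof (rule exI[of _ "C1 + C2"], intro conjI[of "0 \<le> C1 + C2"] allI impI)
    fix x :: "real^'n" and \<psi> \<xi> E \<phi>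
    assume a: "P x \<psi> \<xi> E" "test_fun (k + length (i # l)) A x r \<phi>"
    from P[OF a(1)] have \<psi>: "smooth_on (ball x r) \<psi>" and w: "norm \<xi> \<ge> 1" and E: "E \<ge> 0" by auto
    have t1: "test_fun (k + length l) A x r \<phi>" "test_fun (Suc 0) A x r \<phi>" using a(2) by (auto intro: test_fun_le)
    have t2: "test_fun (k + length l) (\<lambda>n. A (Suc n)) x r (D_coord i \<phi>)" using test_fun_D_coord a(2) by auto
    note b1 = C1(2)[OF a(1) t1(1)] and b2 = C2(2)[OF a(1) t2]
    define p where "p = pairing \<xi> l \<phi> \<psi>"
    define q where "q = pairing \<xi> l (D_coord i \<phi>) \<psi>"
    define s where "s = p - of_real (monomial \<xi> l) * pairing \<xi> [] \<phi> \<psi>"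
    have \<xi>i: "\<bar>\<xi> $ i\<bar> \<le> norm \<xi>" by (rule component_le_norm_cart)
    have X2: "?X C2 \<xi> E \<le> norm \<xi> * ?X C2 \<xi> E" using w C2(1) E by (intro le_mult_of_one_le mult_nonneg_nonneg) auto
    have "norm (of_real (\<xi> $ i) * p - q) \<le> norm \<xi> * norm p + norm q"
      by (rule order_trans[OF norm_triangle_ineq4]) (simp add: norm_mult mult_right_mono \<xi>i)
    also have "\<dots> \<le> norm \<xi> * ?X C1 \<xi> E + ?X C2 \<xi> E"
      using b1 b2 by (intro add_mono mult_left_mono) (auto simp: p_def q_def)
    finally have g1: "norm (of_real (\<xi> $ i) * p - q) \<le> norm \<xi> * ?X C1 \<xi> E + norm \<xi> * ?X C2 \<xi> E" using X2 by linarith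
    have "norm \<xi> * norm (of_real (\<xi> $ i) * s - q) \<le> norm \<xi> * (norm \<xi> * norm s + norm q)"
      by (intro mult_left_mono order_trans[OF norm_triangle_ineq4]) (simp_all add: norm_mult mult_right_mono \<xi>i)
    also have "\<dots> = norm \<xi> * (norm \<xi> * norm s) + norm \<xi> * norm q" by (rule distrib_left)
    also have "\<dots> \<le> norm \<xi> * ?X C1 \<xi> E + norm \<xi> * ?X C2 \<xi> E"
      using b1 b2 by (intro add_mono mult_left_mono) (auto simp: s_def p_def q_def)
    finally have g2: "norm \<xi> * norm (of_real (\<xi> $ i) * s - q) \<le> norm \<xi> * ?X C1 \<xi> E + norm \<xi> * ?X C2 \<xi> E" .
    have pc: "pairing \<xi> (i # l) \<phi> \<psi> = of_real (\<xi> $ i) * p - q"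
      unfolding p_def q_def by (rule pairing_Cons[OF t1(2) \<psi> r])
    have pc': "pairing \<xi> (i # l) \<phi> \<psi> - of_real (monomial \<xi> (i # l)) * pairing \<xi> [] \<phi> \<psi> = of_real (\<xi> $ i) * s - q"
      unfolding pc s_def by (simp add: monomial_def algebra_simps)
    show "norm (pairing \<xi> (i # l) \<phi> \<psi>) \<le> (C1 + C2) * (norm \<xi> ^ length (i # l) * E) \<and>
      norm \<xi> * norm (pairing \<xi> (i # l) \<phi> \<psi> - of_real (monomial \<xi> (i # l)) * pairing \<xi> [] \<phi> \<psi>) \<le> (C1 + C2) * (norm \<xi> ^ length (i # l) * E)"
      unfolding pc' unfolding pc using g1 g2 by (simp add: algebra_simps)
  qed (use C1 C2 in auto)
qed

section \<open>Decay away from the near lattice points\<close>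

text \<open>
The hypotheses on \<open>V\<close> enter only through the bounds \<open>B\<close> on its derivatives by order.
\<close>

definition schroedinger_on ::
  "nat \<Rightarrow> ('n::{finite,linorder} multi_index \<Rightarrow> complex) \<Rightarrow> (nat \<Rightarrow> real) \<Rightarrow> (real^'n::{finite,linorder}) set \<Rightarrow>
   (real^'n::{finite,linorder} \<Rightarrow> complex) \<Rightarrow> complex \<Rightarrow> (real^'n::{finite,linorder} \<Rightarrow> complex) \<Rightarrow> bool" where
  "schroedinger_on m c B U V z \<psi> \<longleftrightarrow>
     (\<forall>k. C_bounded k B U V) \<and> smooth_on U \<psi> \<and> (\<forall>y\<in>U. diff_op m c \<psi> y + V y * \<psi> y = z * \<psi> y)"

text \<open>
The equation integrated against \<open>\<phi>\<close> times a plane wave. Subtracting the leading terms leaves on the right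
expressions of order at most \<open>m - 1\<close> in \<open>\<xi>\<close>.
\<close>

lemma symbol_pairing:
  fixes \<phi> :: "real^'n::{finite,linorder} \<Rightarrow> complex"
  assumes \<phi>: "test_fun k A x r \<phi>" and H: "schroedinger_on m c B (ball x r) V z \<psi>" and r: "r > 0"
  shows "(symbol m c \<xi> - z) * pairing \<xi> [] \<phi> \<psi> =
    - (\<Sum>\<alpha> | mi_abs \<alpha> \<le> m. c \<alpha> * (pairing \<xi> (mi_list \<alpha>) \<phi> \<psi> - of_real (mi_power \<xi> \<alpha>) * pairing \<xi> [] \<phi> \<psi>))
    - pairing \<xi> [] (\<lambda>y. V y * \<phi> y) \<psi>"
proof -
  let ?I = "{\<alpha> :: 'n multi_index. mi_abs \<alpha> \<le> m}"
  from H have V: "C_bounded k B (ball x r) V" and \<psi>: "smooth_on (ball x r) \<psi>"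
    and eq: "\<And>y. y \<in> ball x r \<Longrightarrow> (\<Sum>\<alpha>\<in>?I. c \<alpha> * iter_D (mi_list \<alpha>) \<psi> y) + V y * \<psi> y = z * \<psi> y"
    unfolding schroedinger_on_def diff_op_def D_multi_eq_iter_D by blast+
  have V\<phi>: "test_fun k (\<lambda>n. leibniz_bound n B A) x r (\<lambda>y. V y * \<phi> y)"
    by (rule test_fun_mult[OF V \<phi>])
  let ?e = "\<lambda>y. cis (- (\<xi> \<bullet> y))"
  have I: "integrable lborel (\<lambda>y. \<phi> y * iter_D l \<psi> y * ?e y)" for l
    by (rule integrable_test_fun[OF \<phi> continuous_iter_D[OF \<psi>] r])
  have I0: "integrable lborel (\<lambda>y. \<phi> y * \<psi> y * ?e y)" using I[of "[]"] by simp
  have IV: "integrable lborel (\<lambda>y. V y * \<phi> y * \<psi> y * ?e y)"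
    by (rule integrable_test_fun[OF V\<phi> smooth_on_continuous[OF \<psi>] r])
  have pw: "(\<Sum>\<alpha>\<in>?I. c \<alpha> * (\<phi> y * iter_D (mi_list \<alpha>) \<psi> y * ?e y)) + V y * \<phi> y * \<psi> y * ?e y = z * (\<phi> y * \<psi> y * ?e y)" for y
  proof (cases "y \<in> ball x r")
    case True
    have "(\<Sum>\<alpha>\<in>?I. c \<alpha> * (\<phi> y * iter_D (mi_list \<alpha>) \<psi> y * ?e y)) + V y * \<phi> y * \<psi> y * ?e y
      = \<phi> y * ?e y * ((\<Sum>\<alpha>\<in>?I. c \<alpha> * iter_D (mi_list \<alpha>) \<psi> y) + V y * \<psi> y)"
      by (simp add: sum_distrib_left distrib_left mult_ac)
    then show ?thesis unfolding eq[OF True] by (simp add: mult_ac)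
  next
    case False
    then have "\<phi> y = 0" using r by (intro test_fun_zero[OF \<phi>]) auto
    then show ?thesis by simp
  qed
  have "(LINT y|lborel. (\<Sum>\<alpha>\<in>?I. c \<alpha> * (\<phi> y * iter_D (mi_list \<alpha>) \<psi> y * ?e y)) + V y * \<phi> y * \<psi> y * ?e y)
      = (LINT y|lborel. z * (\<phi> y * \<psi> y * ?e y))"
    by (simp only: pw)
  moreover have "(LINT y|lborel. (\<Sum>\<alpha>\<in>?I. c \<alpha> * (\<phi> y * iter_D (mi_list \<alpha>) \<psi> y * ?e y)) + V y * \<phi> y * \<psi> y * ?e y)
     = (\<Sum>\<alpha>\<in>?I. c \<alpha> * pairing \<xi> (mi_list \<alpha>) \<phi> \<psi>) + pairing \<xi> [] (\<lambda>y. V y * \<phi> y) \<psi>"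
  proof -
    have J: "integrable lborel (\<lambda>y. c \<alpha> * (\<phi> y * iter_D (mi_list \<alpha>) \<psi> y * ?e y))" for \<alpha>
      by (intro integrable_mult_right I)
    have "(LINT y|lborel. (\<Sum>\<alpha>\<in>?I. c \<alpha> * (\<phi> y * iter_D (mi_list \<alpha>) \<psi> y * ?e y)))
      = (\<Sum>\<alpha>\<in>?I. c \<alpha> * pairing \<xi> (mi_list \<alpha>) \<phi> \<psi>)"
      unfolding Bochner_Integration.integral_sum[OF J] by (simp add: pairing_def fourier_coeff_def)
    then show ?thesis
      by (subst Bochner_Integration.integral_add[OF Bochner_Integration.integrable_sum[OF J] IV])
        (simp add: pairing_def fourier_coeff_def)
  qed
  moreover have "(LINT y|lborel. z * (\<phi> y * \<psi> y * ?e y)) = z * pairing \<xi> [] \<phi> \<psi>"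
    by (simp add: pairing_def fourier_coeff_def)
  ultimately have zp: "z * pairing \<xi> [] \<phi> \<psi> = (\<Sum>\<alpha>\<in>?I. c \<alpha> * pairing \<xi> (mi_list \<alpha>) \<phi> \<psi>) + pairing \<xi> [] (\<lambda>y. V y * \<phi> y) \<psi>"
    by (simp only:)
  have "(\<Sum>\<alpha>\<in>?I. c \<alpha> * (pairing \<xi> (mi_list \<alpha>) \<phi> \<psi> - of_real (mi_power \<xi> \<alpha>) * pairing \<xi> [] \<phi> \<psi>))
     = (\<Sum>\<alpha>\<in>?I. c \<alpha> * pairing \<xi> (mi_list \<alpha>) \<phi> \<psi>) - symbol m c \<xi> * pairing \<xi> [] \<phi> \<psi>"
    by (simp add: symbol_def right_diff_distrib sum_subtractf sum_distrib_right mult.assoc)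
  then show ?thesis by (simp add: left_diff_distrib zp)
qed

definition far_frequency ::
  "nat \<Rightarrow> ('n::{finite,linorder} multi_index \<Rightarrow> complex) \<Rightarrow> real \<Rightarrow> complex \<Rightarrow> real^'n::{finite,linorder} \<Rightarrow> bool" where
  "far_frequency m c \<delta> z \<xi> \<longleftrightarrow> \<xi> \<in> integer_lattice - {0} \<and> norm \<xi> powr (real m - 1 + \<delta>) < norm (symbol m c \<xi> - z)"

text \<open>
Induction on the number \<open>N\<close> of gained factors. Bessel's inequality for a single frequency starts it. In the step the right
hand side of \<open>symbol_pairing\<close> is at most \<open>|\<xi>|\<^sup>m\<^sup>-\<^sup>1\<close> times the previous bound, used for the cutoffs that arise from
\<open>\<phi>\<close> by up to \<open>m\<close> derivatives or by multiplication with \<open>V\<close>; this is why \<open>N m\<close> derivatives of \<open>\<phi>\<close> are required.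
\<close>

lemma pairing_decay:
  fixes c :: "'n::{finite,linorder} multi_index \<Rightarrow> complex"
  assumes r: "0 < r" "r \<le> 1" and m: "m \<ge> 1"
  shows "\<exists>C\<ge>0. \<forall>x V z \<psi> \<xi> \<phi>. schroedinger_on m c B (ball x r) V z \<psi> \<longrightarrow> far_frequency m c \<delta> z \<xi> \<longrightarrow>
    test_fun (N * m) A x r \<phi> \<longrightarrow> norm (pairing \<xi> [] \<phi> \<psi>) \<le> C * (norm \<xi> powr (- (real N * \<delta>)) * local_norm x r \<psi>)"
proof (induction N arbitrary: A)
  case 0
  show ?case
  proof (rule exI[of _ "sqrt ((2 * pi) ^ CARD('n)) * \<bar>A 0\<bar>"], intro conjI allI impI)
    fix x :: "real^'n::{finite,linorder}" and V z \<psi> \<xi> \<phi>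
    assume a: "schroedinger_on m c B (ball x r) V z \<psi>" "far_frequency m c \<delta> z \<xi>" "test_fun (0 * m) A x r \<phi>"
    have "A 0 \<ge> 0" using test_fun_bound_nonneg[OF a(3) r(1)] .
    moreover have "continuous_on (ball x r) \<psi>" using a(1) by (auto simp: schroedinger_on_def intro: smooth_on_continuous)
    moreover have "\<xi> \<noteq> 0" "\<xi> \<in> integer_lattice" using a(2) by (auto simp: far_frequency_def)
    ultimately show "norm (pairing \<xi> [] \<phi> \<psi>) \<le> sqrt ((2 * pi) ^ CARD('n)) * \<bar>A 0\<bar> * (norm \<xi> powr (- (real 0 * \<delta>)) * local_norm x r \<psi>)"
      using pairing_Nil_L2[OF a(3) _ r, of \<psi> "{\<xi>}"] by (simp add: L2_set_def)
  qed auto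
next
  case (Suc N)
  define P where "P x \<psi> \<xi> E \<longleftrightarrow> (\<exists>V z. schroedinger_on m c B (ball x r) V z \<psi> \<and> far_frequency m c \<delta> z \<xi> \<and>
     E = norm \<xi> powr (- (real N * \<delta>)) * local_norm x r \<psi>)" for x :: "real^'n::{finite,linorder}" and \<psi> \<xi> E
  have P: "smooth_on (ball x r) \<psi> \<and> norm \<xi> \<ge> 1 \<and> E \<ge> 0" if "P x \<psi> \<xi> E" for x \<psi> \<xi> E
    using that integer_lattice_norm_ge_1 local_norm_nonneg[of x r \<psi>]
    by (auto simp: P_def schroedinger_on_def far_frequency_def intro!: mult_nonneg_nonneg)
  have base: "\<exists>C\<ge>0. \<forall>x \<psi> \<xi> E \<phi>. P x \<psi> \<xi> E \<longrightarrow> test_fun (N * m) A x r \<phi> \<longrightarrow> norm (pairing \<xi> [] \<phi> \<psi>) \<le> C * E" for A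
    using Suc[of A] unfolding P_def by blast
  let ?I = "{\<alpha> :: 'n multi_index. mi_abs \<alpha> \<le> m}"
  have "\<forall>\<alpha>. \<exists>C\<ge>0. \<forall>x \<psi> \<xi> E \<phi>. P x \<psi> \<xi> E \<longrightarrow> test_fun (N * m + mi_abs \<alpha>) A x r \<phi> \<longrightarrow>
    norm \<xi> * norm (pairing \<xi> (mi_list \<alpha>) \<phi> \<psi> - of_real (mi_power \<xi> \<alpha>) * pairing \<xi> [] \<phi> \<psi>) \<le> C * (norm \<xi> ^ mi_abs \<alpha> * E)"
    using pairing_growth[OF P base r(1)] unfolding length_mi_list[symmetric] monomial_mi_list[symmetric] by meson
  then obtain K where K: "\<And>\<alpha>. K \<alpha> \<ge> 0" "\<And>\<alpha> x \<psi> \<xi> E \<phi>. P x \<psi> \<xi> E \<Longrightarrow> test_fun (N * m + mi_abs \<alpha>) A x r \<phi> \<Longrightarrow>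
    norm \<xi> * norm (pairing \<xi> (mi_list \<alpha>) \<phi> \<psi> - of_real (mi_power \<xi> \<alpha>) * pairing \<xi> [] \<phi> \<psi>) \<le> K \<alpha> * (norm \<xi> ^ mi_abs \<alpha> * E)"
    by metis
  obtain KV where KV: "KV \<ge> 0" "\<And>x \<psi> \<xi> E \<phi>. P x \<psi> \<xi> E \<Longrightarrow> test_fun (N * m) (\<lambda>n. leibniz_bound n B A) x r \<phi> \<Longrightarrow>
    norm (pairing \<xi> [] \<phi> \<psi>) \<le> KV * E"
    using base[of "\<lambda>n. leibniz_bound n B A"] by blast
  define C where "C = (\<Sum>\<alpha>\<in>?I. norm (c \<alpha>) * K \<alpha>) + KV"
  have "C \<ge> 0" unfolding C_def using K(1) KV(1) by (intro add_nonneg_nonneg sum_nonneg mult_nonneg_nonneg) auto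
  moreover have "norm (pairing \<xi> [] \<phi> \<psi>) \<le> C * (norm \<xi> powr (- (real (Suc N) * \<delta>)) * local_norm x r \<psi>)"
    if H: "schroedinger_on m c B (ball x r) V z \<psi>" and far: "far_frequency m c \<delta> z \<xi>" and \<phi>: "test_fun (Suc N * m) A x r \<phi>"
    for x V z \<psi> \<xi> \<phi>
  proof -
    define w where "w = norm \<xi>"
    define E where "E = w powr (- (real N * \<delta>)) * local_norm x r \<psi>"
    have PE: "P x \<psi> \<xi> E" unfolding P_def E_def w_def using H far by blast
    have w: "w \<ge> 1" and E: "E \<ge> 0" using P[OF PE] by (auto simp: w_def)
    let ?a = "pairing \<xi> [] \<phi> \<psi>"
    let ?d = "\<lambda>\<alpha>. pairing \<xi> (mi_list \<alpha>) \<phi> \<psi> - of_real (mi_power \<xi> \<alpha>) * ?a"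
    have d: "norm (c \<alpha> * ?d \<alpha>) \<le> norm (c \<alpha>) * K \<alpha> * (w ^ (m - 1) * E)" if "\<alpha> \<in> ?I" for \<alpha>
    proof -
      have "test_fun (N * m + mi_abs \<alpha>) A x r \<phi>" using that \<phi> by (auto intro: test_fun_le)
      then have "w * norm (?d \<alpha>) \<le> K \<alpha> * (w ^ mi_abs \<alpha> * E)" using K(2)[OF PE] by (simp add: w_def)
      also have "\<dots> \<le> K \<alpha> * (w ^ m * E)"
        using that w E K(1) by (intro mult_left_mono mult_right_mono power_increasing) auto
      also have "w ^ m = w * w ^ (m - 1)" using m by (simp add: power_eq_if)
      finally have "w * norm (?d \<alpha>) \<le> w * (K \<alpha> * (w ^ (m - 1) * E))" by (simp add: mult_ac)
      then have "norm (?d \<alpha>) \<le> K \<alpha> * (w ^ (m - 1) * E)" using w by simp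
      then show ?thesis by (simp add: norm_mult mult.assoc mult_left_mono)
    qed
    have "test_fun (N * m) A x r \<phi>" by (rule test_fun_le[OF \<phi>]) auto
    then have V: "norm (pairing \<xi> [] (\<lambda>y. V y * \<phi> y) \<psi>) \<le> KV * E"
      using H by (intro KV(2)[OF PE] test_fun_mult) (auto simp: schroedinger_on_def)
    also have "KV * E \<le> KV * (w ^ (m - 1) * E)"
      using w E KV(1) by (intro mult_left_mono le_mult_of_one_le one_le_power) auto
    finally have V: "norm (pairing \<xi> [] (\<lambda>y. V y * \<phi> y) \<psi>) \<le> KV * (w ^ (m - 1) * E)" .
    have "norm (symbol m c \<xi> - z) * norm ?a \<le> (\<Sum>\<alpha>\<in>?I. norm (c \<alpha> * ?d \<alpha>)) + norm (pairing \<xi> [] (\<lambda>y. V y * \<phi> y) \<psi>)"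
      unfolding norm_mult[symmetric] symbol_pairing[OF \<phi> H r(1)]
      by (rule order_trans[OF norm_triangle_ineq4]) (simp add: norm_sum)
    also have "\<dots> \<le> (\<Sum>\<alpha>\<in>?I. norm (c \<alpha>) * K \<alpha> * (w ^ (m - 1) * E)) + KV * (w ^ (m - 1) * E)"
      by (intro add_mono sum_mono d V)
    also have "\<dots> = C * (w ^ (m - 1) * E)"
      unfolding C_def by (simp add: sum_distrib_right distrib_right)
    finally have up: "norm (symbol m c \<xi> - z) * norm ?a \<le> C * (w ^ (m - 1) * E)" .
    have "w powr (real m - 1 + \<delta>) = w ^ (m - 1) * w powr \<delta>"
      using w m by (simp add: powr_add powr_realpow[symmetric] of_nat_diff)
    then have "(w ^ (m - 1) * w powr \<delta>) * norm ?a \<le> norm (symbol m c \<xi> - z) * norm ?a"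
      using far by (intro mult_right_mono) (auto simp: far_frequency_def w_def)
    then have "w ^ (m - 1) * (w powr \<delta> * norm ?a) \<le> w ^ (m - 1) * (C * E)"
      using up by (simp add: mult_ac)
    then have "w powr \<delta> * norm ?a \<le> C * E" using w by (simp add: mult_le_cancel_left_pos)
    then have "w powr (- \<delta>) * (w powr \<delta> * norm ?a) \<le> w powr (- \<delta>) * (C * E)"
      by (intro mult_left_mono) auto
    moreover have "w powr (- \<delta>) * w powr \<delta> = 1" using w by (simp add: powr_add[symmetric])
    ultimately have "norm ?a \<le> w powr (- \<delta>) * (C * E)" by (simp add: mult.assoc[symmetric])
    also have "\<dots> = C * (w powr (- (real (Suc N) * \<delta>)) * local_norm x r \<psi>)"
      using w by (simp add: E_def powr_add[symmetric] algebra_simps)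
    finally show ?thesis by (simp add: w_def)
  qed
  ultimately show ?case by blast
qed

section \<open>Ellipticity confines the near lattice points\<close>

lemma mi_power_scaleR: "mi_power (t *\<^sub>R \<xi>) \<alpha> = t ^ mi_abs \<alpha> * mi_power \<xi> \<alpha>"
  by (simp add: mi_power_def mi_abs_def power_mult_distrib prod.distrib power_sum)

lemma abs_mi_power_le: "\<bar>mi_power \<xi> \<alpha>\<bar> \<le> norm \<xi> ^ mi_abs \<alpha>"
proof -
  have "\<bar>mi_power \<xi> \<alpha>\<bar> = (\<Prod>i\<in>UNIV. \<bar>\<xi> $ i\<bar> ^ \<alpha> i)"
    by (simp add: mi_power_def abs_prod power_abs)
  also have "\<dots> \<le> (\<Prod>i\<in>UNIV. norm \<xi> ^ \<alpha> i)"
    by (intro prod_mono conjI power_mono component_le_norm_cart) auto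
  finally show ?thesis by (simp add: mi_abs_def power_sum)
qed

text \<open>
By homogeneity it is enough to look at the unit sphere, where compactness gives a positive minimum.
\<close>

lemma elliptic_lower_bound:
  fixes c :: "'n::finite multi_index \<Rightarrow> complex"
  assumes "elliptic m c"
  obtains c0 where "c0 > 0" "\<And>\<xi>. c0 * norm \<xi> ^ m \<le> norm (\<Sum>\<alpha> | mi_abs \<alpha> = m. c \<alpha> * of_real (mi_power \<xi> \<alpha>))"
proof -
  define p where "p \<xi> = (\<Sum>\<alpha> | mi_abs \<alpha> = m. c \<alpha> * of_real (mi_power \<xi> \<alpha>))" for \<xi> :: "real^'n"
  have "continuous_on (sphere 0 1) (\<lambda>\<xi>. norm (p \<xi>))"
    unfolding p_def mi_power_def
    by (intro continuous_intros bounded_linear.continuous_on[OF bounded_linear_vec_nth])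
  moreover have "axis undefined 1 \<in> sphere (0::real^'n) 1" by (simp add: norm_axis_1)
  ultimately obtain \<eta> where \<eta>: "\<eta> \<in> sphere 0 1" "\<And>\<xi>. \<xi> \<in> sphere 0 1 \<Longrightarrow> norm (p \<eta>) \<le> norm (p \<xi>)"
    using continuous_attains_inf[of "sphere (0::real^'n) 1" "\<lambda>\<xi>. norm (p \<xi>)"] by auto
  have "\<eta> \<noteq> 0" using \<eta>(1) by auto
  then have pos: "norm (p \<eta>) > 0" using assms by (simp add: elliptic_def p_def)
  have hom: "p (t *\<^sub>R \<xi>) = of_real (t ^ m) * p \<xi>" for t \<xi>
    unfolding p_def sum_distrib_left by (rule sum.cong) (auto simp: mi_power_scaleR)
  have "norm (p \<eta>) * norm \<xi> ^ m \<le> norm (p \<xi>)" for \<xi>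
  proof (cases "\<xi> = 0")
    case True
    show ?thesis
    proof (cases "m = 0")
      case True
      have "p \<eta> = p 0" using hom[of 0 \<eta>] True by simp
      then show ?thesis using \<open>\<xi> = 0\<close> True by simp
    qed (use True in \<open>simp add: power_0_left\<close>)
  next
    case False
    have "p \<xi> = of_real (norm \<xi> ^ m) * p (\<xi> /\<^sub>R norm \<xi>)"
      using hom[of "norm \<xi>" "\<xi> /\<^sub>R norm \<xi>"] False by simp
    then have "norm (p \<xi>) = norm \<xi> ^ m * norm (p (\<xi> /\<^sub>R norm \<xi>))"
      by (simp add: norm_mult norm_power)
    moreover have "norm (p \<eta>) \<le> norm (p (\<xi> /\<^sub>R norm \<xi>))" using False by (intro \<eta>(2)) simp
    ultimately show ?thesis by (simp add: mult.commute[of "norm (p \<eta>)"] mult_left_mono)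
  qed
  then show ?thesis using that pos unfolding p_def by blast
qed

text \<open>
For large \<open>|\<xi>|\<close> the principal part exceeds both the lower order terms and \<open>|\<xi>|\<^sup>m\<^sup>-\<^sup>1\<^sup>+\<^sup>\<delta>\<close>, as \<open>\<delta> < 1\<close>, so that a near
point has \<open>|\<xi>|\<^sup>m\<close> at most of the order of \<open>|z|\<close>. Bounded \<open>\<xi>\<close> are harmless because \<open>|z| \<ge> 1\<close>.
\<close>

lemma near_lattice_points_norm_le:
  fixes c :: "'n::finite multi_index \<Rightarrow> complex"
  assumes ell: "elliptic m c" and m: "m \<ge> 1" and \<delta>: "\<delta> \<le> 1 / 2"
  obtains C where "C \<ge> 1" "\<And>z \<xi>. norm z \<ge> 1 \<Longrightarrow> \<xi> \<in> near_lattice_points m c \<delta> z \<Longrightarrow> norm \<xi> \<le> C * norm z powr (1 / real m)"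
proof -
  obtain c0 where c0: "c0 > 0" "\<And>\<xi>. c0 * norm \<xi> ^ m \<le> norm (\<Sum>\<alpha> | mi_abs \<alpha> = m. c \<alpha> * of_real (mi_power \<xi> \<alpha>))"
    using elliptic_lower_bound[OF ell] by blast
  let ?J = "{\<alpha> :: 'n multi_index. mi_abs \<alpha> \<le> m - 1}"
  define L where "L = 1 + (\<Sum>\<alpha>\<in>?J. norm (c \<alpha>))"
  have L: "L \<ge> 1" by (simp add: L_def sum_nonneg)
  \<comment> \<open>the summands cover \<open>|\<xi>| \<le> 1\<close>, a dominant principal part, and the bounded range in which it does not dominate\<close>
  define C where "C = 1 + (2 / c0) powr (1 / real m) + (2 * L / c0)\<^sup>2"
  have C: "C \<ge> 1" "(2 / c0) powr (1 / real m) \<le> C" "(2 * L / c0)\<^sup>2 \<le> C" by (auto simp: C_def)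
  have "norm \<xi> \<le> C * norm z powr (1 / real m)" if z: "norm z \<ge> 1" and near: "\<xi> \<in> near_lattice_points m c \<delta> z" for z \<xi>
  proof -
    define w where "w = norm \<xi>"
    have zp: "norm z powr (1 / real m) \<ge> 1" using z by (simp add: ge_one_powr_ge_zero)
    have C_le: "C \<le> C * norm z powr (1 / real m)" using zp C(1) by simp
    have "w \<le> C * norm z powr (1 / real m)"
    proof (cases "w \<le> 1")
      case True
      then show ?thesis using C(1) C_le by linarith
    next
      case False
      then have w: "w > 1" by simp
      let ?p = "\<Sum>\<alpha> | mi_abs \<alpha> = m. c \<alpha> * of_real (mi_power \<xi> \<alpha>)"
      let ?q = "\<Sum>\<alpha>\<in>?J. c \<alpha> * of_real (mi_power \<xi> \<alpha>)"
      have set_eq: "{\<alpha> :: 'n multi_index. mi_abs \<alpha> \<le> m} = {\<alpha>. mi_abs \<alpha> = m} \<union> ?J" using m by auto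
      have sym: "symbol m c \<xi> = ?p + ?q"
        unfolding symbol_def set_eq
        by (rule sum.union_disjoint) (use m in \<open>auto simp: finite_mi_abs_eq finite_mi_abs_le\<close>)
      have "norm ?q \<le> (\<Sum>\<alpha>\<in>?J. norm (c \<alpha>) * w ^ (m - 1))"
      proof (rule sum_norm_le)
        fix \<alpha> :: "'n multi_index" assume "\<alpha> \<in> ?J"
        then have "w ^ mi_abs \<alpha> \<le> w ^ (m - 1)" using w by (intro power_increasing) auto
        then have "\<bar>mi_power \<xi> \<alpha>\<bar> \<le> w ^ (m - 1)"
          using abs_mi_power_le[of \<xi> \<alpha>] by (simp add: w_def)
        then show "norm (c \<alpha> * of_real (mi_power \<xi> \<alpha>)) \<le> norm (c \<alpha>) * w ^ (m - 1)"
          by (simp add: norm_mult mult_left_mono)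
      qed
      also have "\<dots> = (L - 1) * w ^ (m - 1)" by (simp add: L_def sum_distrib_right)
      also have "w ^ (m - 1) \<le> w powr (real m - 1 / 2)"
        using w m by (simp add: powr_realpow[symmetric] of_nat_diff)
      finally have q: "norm ?q \<le> (L - 1) * w powr (real m - 1 / 2)" using L by (simp add: mult_left_mono)
      have "norm (symbol m c \<xi> - z) \<le> w powr (real m - 1 + \<delta>)"
        using near by (simp add: near_lattice_points_def w_def)
      also have "\<dots> \<le> w powr (real m - 1 / 2)" using w \<delta> by (intro powr_mono) auto
      finally have s: "norm (symbol m c \<xi> - z) \<le> w powr (real m - 1 / 2)" .
      have p_eq: "?p = (symbol m c \<xi> - z) + z - ?q" by (simp add: sym)
      have "norm ?p \<le> norm (symbol m c \<xi> - z) + norm z + norm ?q"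
        unfolding p_eq using norm_triangle_ineq4[of "(symbol m c \<xi> - z) + z" ?q] norm_triangle_ineq[of "symbol m c \<xi> - z" z]
        by linarith
      then have "c0 * w ^ m \<le> w powr (real m - 1 / 2) + norm z + (L - 1) * w powr (real m - 1 / 2)"
        using c0(2)[of \<xi>] s q by (simp add: w_def)
      then have main: "c0 * w ^ m \<le> L * w powr (real m - 1 / 2) + norm z" by (simp add: algebra_simps)
      have split: "w powr (real m - 1 / 2) = w ^ m / w powr (1 / 2)"
        using w by (simp add: powr_diff powr_realpow)
      show ?thesis
      proof (cases "L / w powr (1 / 2) \<le> c0 / 2")
        case True
        then have "L / w powr (1 / 2) * w ^ m \<le> c0 / 2 * w ^ m" using w by (intro mult_right_mono) auto
        moreover have "L * w powr (real m - 1 / 2) = L / w powr (1 / 2) * w ^ m" unfolding split by simp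
        ultimately have "c0 * w ^ m \<le> c0 / 2 * w ^ m + norm z" using main by linarith
        then have "w ^ m \<le> 2 / c0 * norm z" using c0(1) by (simp add: field_simps)
        then have "(w ^ m) powr (1 / real m) \<le> (2 / c0 * norm z) powr (1 / real m)"
          using w by (intro powr_mono2) auto
        moreover have "(w ^ m) powr (1 / real m) = w"
          using w m by (simp add: powr_realpow[symmetric] powr_powr)
        moreover have "(2 / c0 * norm z) powr (1 / real m) = (2 / c0) powr (1 / real m) * norm z powr (1 / real m)"
          by (rule powr_mult)
        ultimately have "w \<le> (2 / c0) powr (1 / real m) * norm z powr (1 / real m)" by linarith
        also have "\<dots> \<le> C * norm z powr (1 / real m)" using C(2) by (intro mult_right_mono) auto
        finally show ?thesis .
      next
        case False
        then have "w powr (1 / 2) \<le> 2 * L / c0" using c0(1) w by (simp add: field_simps)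
        then have "(w powr (1 / 2))\<^sup>2 \<le> (2 * L / c0)\<^sup>2" by (intro power_mono) auto
        then have "w \<le> (2 * L / c0)\<^sup>2" using w by (simp add: powr_half_sqrt)
        then show ?thesis using C(3) C_le by linarith
      qed
    qed
    then show ?thesis by (simp add: w_def)
  qed
  then show ?thesis using that C(1) by blast
qed

section \<open>Cutoff functions of finite smoothness\<close>

lemma DERIV_max_0_power:
  "((\<lambda>t. max 0 t ^ Suc (Suc k)) has_real_derivative real (Suc (Suc k)) * max 0 t ^ Suc k) (at t)"
proof -
  consider "t < 0" | "t > 0" | "t = 0" by linarith
  then show ?thesis
  proof cases
    case 1
    have "((\<lambda>t. 0) has_real_derivative 0) (at t)" by simp
    then have "((\<lambda>t::real. max 0 t ^ Suc (Suc k)) has_real_derivative 0) (at t)"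
      by (rule has_field_derivative_transform_within_open[of _ _ _ "{..<0}"]) (use 1 in auto)
    then show ?thesis using 1 by simp
  next
    case 2
    have "((\<lambda>t. t ^ Suc (Suc k)) has_real_derivative real (Suc (Suc k)) * t ^ Suc k) (at t)"
      using DERIV_pow[of "Suc (Suc k)" t] by simp
    then have "((\<lambda>t::real. max 0 t ^ Suc (Suc k)) has_real_derivative real (Suc (Suc k)) * t ^ Suc k) (at t)"
      by (rule has_field_derivative_transform_within_open[of _ _ _ "{0<..}"]) (use 2 in auto)
    then show ?thesis using 2 by simp
  next
    case 3
    have "isCont (\<lambda>h::real. max 0 h ^ Suc k) 0" by (intro continuous_intros)
    then have lim: "((\<lambda>h::real. max 0 h ^ Suc k) \<longlongrightarrow> 0) (at 0)" by (simp add: isCont_def)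
    have le: "norm (max 0 h ^ Suc (Suc k) / h) \<le> max 0 h ^ Suc k" for h :: real
    proof (cases "h > 0")
      case True
      then have "max 0 h = h" by simp
      then show ?thesis using True by simp
    next
      case False
      then have "max 0 h = 0" by simp
      then show ?thesis by simp
    qed
    have "((\<lambda>h::real. max 0 h ^ Suc (Suc k) / h) \<longlongrightarrow> 0) (at 0)"
      by (rule Lim_null_comparison[OF always_eventually lim]) (use le in blast)
    then show ?thesis using 3 by (simp add: DERIV_def)
  qed
qed

text \<open>
Equal to 1 at \<open>x\<close> and supported in the ball of radius \<open>r / 2\<close>; its powers are as smooth as desired.
\<close>

definition cutoff_profile :: "real^'n::finite \<Rightarrow> real \<Rightarrow> real^'n \<Rightarrow> real" where
  "cutoff_profile x r y = max 0 (1 - (4 / r\<^sup>2) * ((y - x) \<bullet> (y - x)))"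

lemma cutoff_profile_zero: "r > 0 \<Longrightarrow> y \<notin> cball x (r / 2) \<Longrightarrow> cutoff_profile x r y = 0"
proof -
  assume r: "r > 0" and "y \<notin> cball x (r / 2)"
  then have "r / 2 < norm (y - x)" by (simp add: dist_norm norm_minus_commute)
  then have "(r / 2)\<^sup>2 < (norm (y - x))\<^sup>2" using r by (intro power_strict_mono) auto
  then have "1 < (4 / r\<^sup>2) * ((y - x) \<bullet> (y - x))" using r
    by (simp add: power2_norm_eq_inner field_simps)
  then show "cutoff_profile x r y = 0" unfolding cutoff_profile_def by simp
qed

lemma cutoff_profile_bounds: "0 \<le> cutoff_profile x r y" "cutoff_profile x r y \<le> 1"
  by (auto simp: cutoff_profile_def)

lemma has_derivative_cutoff_profile_power:
  "((\<lambda>y. complex_of_real (cutoff_profile x r y ^ Suc (Suc k))) has_derivative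
     (\<lambda>v. of_real (real (Suc (Suc k)) * cutoff_profile x r y ^ Suc k * (- (8 / r\<^sup>2) * ((y - x) \<bullet> v))))) (at y)"
proof -
  define t where "t y = 1 - (4 / r\<^sup>2) * ((y - x) \<bullet> (y - x))" for y
  have "((\<lambda>y. 1 - \<kappa> * ((y - x) \<bullet> (y - x))) has_derivative (\<lambda>v. - (2 * \<kappa>) * ((y - x) \<bullet> v))) (at y)" for \<kappa>
    by (auto intro!: derivative_eq_intros simp: inner_commute algebra_simps)
  from this[of "4 / r\<^sup>2"] have t: "(t has_derivative (\<lambda>v. - (8 / r\<^sup>2) * ((y - x) \<bullet> v))) (at y)"
    unfolding t_def by simp
  show ?thesis
    unfolding cutoff_profile_def t_def[symmetric]
    by (intro has_derivative_of_real
       has_derivative_compose[OF t DERIV_max_0_power[unfolded has_field_derivative_def]])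
qed

lemma C_bounded_mono:
  "C_bounded k A U f \<Longrightarrow> (\<And>n. A n \<le> B n) \<Longrightarrow> C_bounded k B U f"
proof (induction k arbitrary: A B f)
  case (Suc k)
  have "C_bounded k (\<lambda>n. B (Suc n)) U (D_coord i f)" for i
    by (rule Suc.IH[of "\<lambda>n. A (Suc n)"]) (use Suc.prems in auto)
  then show ?case using Suc.prems by (auto intro: order_trans)
qed (auto intro: order_trans)

lemma C_bounded_coordinate:
  assumes "r \<le> 1"
  shows "C_bounded k (\<lambda>n. 1) (ball x r) (\<lambda>y. complex_of_real (y $ i - x $ i))"
proof -
  have le: "norm (complex_of_real (y $ i - x $ i)) \<le> 1" if "y \<in> ball x r" for y
    using component_le_norm_cart[of "y - x" i] that assms by (auto simp: dist_norm norm_minus_commute simp flip: of_real_diff)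
  have der: "((\<lambda>y. complex_of_real (y $ i - x $ i)) has_derivative (\<lambda>v. of_real (v $ i))) (at y)" for y
    by (auto intro!: derivative_eq_intros bounded_linear.has_derivative[OF bounded_linear_vec_nth])
  show ?thesis
  proof (cases k)
    case 0
    have "continuous_on (ball x r) (\<lambda>y. complex_of_real (y $ i - x $ i))"
      by (intro continuous_intros bounded_linear.continuous_on[OF bounded_linear_vec_nth])
    then show ?thesis using 0 le by simp
  next
    case (Suc j)
    have "D_coord l (\<lambda>y. complex_of_real (y $ i - x $ i)) = (\<lambda>y. - \<i> * of_real (axis l 1 $ i))" for l
      using D_coord_has_derivative[OF der] by (simp add: fun_eq_iff)
    moreover have "C_bounded j (\<lambda>n. 1) (ball x r) (\<lambda>y. - \<i> * of_real (axis l 1 $ i))" for l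
      by (rule C_bounded_mono[OF C_bounded_const]) (simp add: axis_def norm_mult)
    moreover have "(\<lambda>y. complex_of_real (y $ i - x $ i)) differentiable (at y)" for y
      using der by (auto simp: differentiable_def)
    ultimately show ?thesis using Suc le by simp
  qed
qed

text \<open>
Differentiating \<open>s\<^sup>k\<^sup>+\<^sup>2\<close> for the profile \<open>s\<close> gives \<open>s\<^sup>k\<^sup>+\<^sup>1\<close> times a multiple of a coordinate of \<open>y - x\<close>, so the bounds come
from the product rule, and they do not depend on the centre.
\<close>

lemma cutoff_exists:
  assumes r: "0 < r" "r \<le> 1"
  shows "\<exists>A. \<forall>x::real^'n::finite. test_fun k A x r (\<lambda>y. of_real (cutoff_profile x r y ^ Suc k))"
proof -
  have "\<exists>A. \<forall>x::real^'n. C_bounded k A (ball x r) (\<lambda>y. of_real (cutoff_profile x r y ^ Suc k))"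
  proof (induction k)
    case 0
    have "continuous_on (ball x r) (\<lambda>y. complex_of_real (cutoff_profile x r y))" for x :: "real^'n"
      unfolding cutoff_profile_def by (intro continuous_intros)
    moreover have "norm (complex_of_real (cutoff_profile x r y)) \<le> 1" for x y :: "real^'n"
      using cutoff_profile_bounds[of x r y] by simp
    ultimately show ?case by (intro exI[of _ "\<lambda>_. 1"]) simp
  next
    case (Suc k)
    then obtain A where A: "\<And>x::real^'n. C_bounded k A (ball x r) (\<lambda>y. of_real (cutoff_profile x r y ^ Suc k))"
      by blast
    define \<kappa> where "\<kappa> = \<i> * complex_of_real (real (Suc (Suc k)) * (8 / r\<^sup>2))"
    define A' where "A' = (\<lambda>n. leibniz_bound n (\<lambda>n. leibniz_bound n (\<lambda>n. norm \<kappa>) (\<lambda>n. 1)) A)"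
    have "C_bounded (Suc k) (case_nat 1 A') (ball x r) (\<lambda>y. of_real (cutoff_profile x r y ^ Suc (Suc k)))" for x :: "real^'n"
    proof -
      let ?f = "\<lambda>y. complex_of_real (cutoff_profile x r y ^ Suc (Suc k))"
      have D: "D_coord i ?f = (\<lambda>y. (\<kappa> * of_real (y $ i - x $ i)) * of_real (cutoff_profile x r y ^ Suc k))" for i
      proof
        fix y
        have "(y - x) \<bullet> axis i 1 = y $ i - x $ i" by (simp add: inner_axis)
        then show "D_coord i ?f y = (\<kappa> * of_real (y $ i - x $ i)) * of_real (cutoff_profile x r y ^ Suc k)"
          unfolding D_coord_has_derivative[OF has_derivative_cutoff_profile_power] \<kappa>_def
          by (simp only: of_real_mult of_real_minus mult_minus_left mult_minus_right minus_minus mult_ac)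
      qed
      have "C_bounded k A' (ball x r) (D_coord i ?f)" for i
        unfolding D A'_def
        by (intro C_bounded_mult C_bounded_const C_bounded_coordinate A r open_ball)
      moreover have "?f differentiable (at y)" for y
        unfolding differentiable_def by (rule exI, rule has_derivative_cutoff_profile_power)
      moreover have "norm (?f y) \<le> 1" for y
        using cutoff_profile_bounds[of x r y] by (simp add: norm_power power_le_one del: power_Suc)
      ultimately show ?thesis by simp
    qed
    then show ?case by blast
  qed
  then obtain A where A: "\<And>x::real^'n. C_bounded k A (ball x r) (\<lambda>y. of_real (cutoff_profile x r y ^ Suc k))"
    by blast
  have "test_fun k A x r (\<lambda>y. of_real (cutoff_profile x r y ^ Suc k))" for x :: "real^'n"
    unfolding test_fun_def
    by (intro conjI allI impI A) (subst cutoff_profile_zero[OF r(1)], assumption, simp)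
  then show ?thesis by blast
qed

section \<open>The estimate on a ball and the theorem\<close>

text \<open>
The coefficients of \<open>\<phi> \<cdot> D\<^sub>l \<psi>\<close> are summed over three groups of lattice points: the near ones, by
Cauchy-Schwarz and \<open>pairing_L2\<close>; the origin, which is excluded from the decay estimate; and the far ones, where the
decay beats both \<open>|\<xi>|\<close> to the power of the length of \<open>l\<close> and the lattice sum. As \<open>\<phi> x = 1\<close>, this bounds the derivative at the centre.
\<close>

lemma local_derivative_estimate:
  fixes c :: "'n::{finite,linorder} multi_index \<Rightarrow> complex"
  assumes r: "0 < r" "r \<le> 1" and m: "m \<ge> 1" and ell: "elliptic m c" and \<delta>: "0 < \<delta>" "\<delta> \<le> 1 / 2"
  shows "\<exists>C\<ge>0. \<forall>x V z \<psi>. schroedinger_on m c B (ball x r) V z \<psi> \<longrightarrow> norm z \<ge> 1 \<longrightarrow>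
    finite (near_lattice_points m c \<delta> z) \<longrightarrow>
    norm (iter_D l \<psi> x) \<le> C * (norm z powr (real (length l) / real m) *
      (1 + sqrt (real (card (near_lattice_points m c \<delta> z)))) * local_norm x r \<psi>)"
proof -
  define d where "d = CARD('n)"
  \<comment> \<open>enough gained powers to absorb the \<open>length l\<close> derivatives and leave the exponent \<open>2 d\<close> of the lattice sum\<close>
  obtain N :: nat where N: "real N * \<delta> \<ge> real (length l + 2 * d)"
    using reals_Archimedean3[OF \<delta>(1)] less_imp_le by blast
  define k where "k = N * m + length l"
  obtain A where A: "\<And>x::real^'n::{finite,linorder}. test_fun k A x r (\<lambda>y. of_real (cutoff_profile x r y ^ Suc k))"
    using cutoff_exists[OF r] by blast
  define P where "P x \<psi> \<xi> E \<longleftrightarrow> (\<exists>V z. schroedinger_on m c B (ball x r) V z \<psi> \<and> far_frequency m c \<delta> z \<xi> \<and>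
     E = norm \<xi> powr (- (real N * \<delta>)) * local_norm x r \<psi>)" for x :: "real^'n::{finite,linorder}" and \<psi> \<xi> E
  have P: "smooth_on (ball x r) \<psi> \<and> norm \<xi> \<ge> 1 \<and> E \<ge> 0" if "P x \<psi> \<xi> E" for x \<psi> \<xi> E
    using that integer_lattice_norm_ge_1 local_norm_nonneg[of x r \<psi>]
    by (auto simp: P_def schroedinger_on_def far_frequency_def intro!: mult_nonneg_nonneg)
  have base: "\<exists>C\<ge>0. \<forall>x \<psi> \<xi> E \<phi>. P x \<psi> \<xi> E \<longrightarrow> test_fun (N * m) A x r \<phi> \<longrightarrow> norm (pairing \<xi> [] \<phi> \<psi>) \<le> C * E" for A
    using pairing_decay[OF r m, of c B \<delta> N A] unfolding P_def by blast
  obtain Cf where Cf: "Cf \<ge> 0" "\<And>x \<psi> \<xi> E \<phi>. P x \<psi> \<xi> E \<Longrightarrow> test_fun k A x r \<phi> \<Longrightarrow>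
     norm (pairing \<xi> l \<phi> \<psi>) \<le> Cf * (norm \<xi> ^ length l * E)"
    using pairing_growth[OF P base r(1), of l A] unfolding k_def by blast
  obtain Cn where Cn: "Cn \<ge> 0" "\<And>(x::real^'n::{finite,linorder}) \<phi> \<psi> F R. \<lbrakk>test_fun (length l) A x r \<phi>; smooth_on (ball x r) \<psi>;
    finite F; F \<subseteq> integer_lattice; R \<ge> 1; \<forall>\<xi>\<in>F. norm \<xi> \<le> R\<rbrakk> \<Longrightarrow>
    L2_set (\<lambda>\<xi>. norm (pairing \<xi> l \<phi> \<psi>)) F \<le> Cn * R ^ length l * local_norm x r \<psi>"
    using pairing_L2[OF r, of l A] by blast
  obtain C1 where C1: "C1 \<ge> 1" "\<And>z \<xi>. norm z \<ge> 1 \<Longrightarrow> \<xi> \<in> near_lattice_points m c \<delta> z \<Longrightarrow> norm \<xi> \<le> C1 * norm z powr (1 / real m)"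
    using near_lattice_points_norm_le[OF ell m \<delta>(2)] by blast
  obtain S where S: "\<And>F::(real^'n::{finite,linorder}) set. finite F \<Longrightarrow> F \<subseteq> integer_lattice - {0} \<Longrightarrow> (\<Sum>\<xi>\<in>F. 1 / norm \<xi> ^ (2 * d)) \<le> S"
    using lattice_sum_bounded unfolding d_def by blast
  have S0: "S \<ge> 0" using S[of "{}"] by simp
  define C where "C = Cn * C1 ^ length l + Cn + Cf * S"
  have C: "C \<ge> 0" using Cn(1) C1(1) Cf(1) S0 by (simp add: C_def)
  moreover have "norm (iter_D l \<psi> x) \<le> C * (norm z powr (real (length l) / real m) *
      (1 + sqrt (real (card (near_lattice_points m c \<delta> z)))) * local_norm x r \<psi>)"
    if H: "schroedinger_on m c B (ball x r) V z \<psi>" and z: "norm z \<ge> 1" and fin: "finite (near_lattice_points m c \<delta> z)"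
    for x V z \<psi>
  proof -
    let ?near = "near_lattice_points m c \<delta> z"
    define \<phi> where "\<phi> = (\<lambda>y. complex_of_real (cutoff_profile x r y ^ Suc k))"
    have \<phi>: "test_fun k A x r \<phi>" "test_fun (length l) A x r \<phi>"
      using A[of x] by (auto simp: \<phi>_def k_def intro: test_fun_le)
    have \<psi>: "smooth_on (ball x r) \<psi>" using H by (simp add: schroedinger_on_def)
    define n where "n = local_norm x r \<psi>"
    have n: "n \<ge> 0" by (simp add: n_def local_norm_nonneg)
    define p where "p \<xi> = norm (pairing \<xi> l \<phi> \<psi>)" for \<xi>
    define \<Lambda> where "\<Lambda> = norm z powr (real (length l) / real m)"
    define Q where "Q = sqrt (real (card ?near))"
    have \<Lambda>: "\<Lambda> \<ge> 1" unfolding \<Lambda>_def using z by (simp add: ge_one_powr_ge_zero)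
    have Q: "Q \<ge> 0" by (simp add: Q_def)
    define R where "R = C1 * norm z powr (1 / real m)"
    have "norm z powr (1 / real m) \<ge> 1" using z by (simp add: ge_one_powr_ge_zero)
    then have R: "R \<ge> 1" unfolding R_def using C1(1) by (metis mult_mono' mult_1 zero_le_one)
    have Rpow: "R ^ length l = C1 ^ length l * \<Lambda>"
    proof -
      have "(norm z powr (1 / real m)) ^ length l = norm z powr (real (length l) * (1 / real m))"
        using z by (intro powr_power) auto
      then show ?thesis by (simp add: R_def \<Lambda>_def power_mult_distrib)
    qed
    have p_far: "p \<xi> \<le> Cf * n * (1 / norm \<xi> ^ (2 * d))" if far: "far_frequency m c \<delta> z \<xi>" for \<xi>
    proof -
      have PE: "P x \<psi> \<xi> (norm \<xi> powr (- (real N * \<delta>)) * n)" unfolding P_def n_def using H far by blast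
      have w: "norm \<xi> \<ge> 1" using P[OF PE] by simp
      have pow: "norm \<xi> ^ j = norm \<xi> powr real j" for j
        using w by (intro powr_realpow[symmetric]) linarith
      have "norm \<xi> ^ length l * norm \<xi> powr (- (real N * \<delta>)) = norm \<xi> powr (real (length l) - real N * \<delta>)"
        unfolding pow by (simp add: powr_add[symmetric])
      also have "\<dots> \<le> norm \<xi> powr (- real (2 * d))" using w N by (intro powr_mono) auto
      also have "\<dots> = 1 / norm \<xi> ^ (2 * d)"
        unfolding pow by (simp only: powr_minus inverse_eq_divide)
      finally have "Cf * n * (norm \<xi> ^ length l * norm \<xi> powr (- (real N * \<delta>))) \<le> Cf * n * (1 / norm \<xi> ^ (2 * d))"
        using Cf(1) n by (intro mult_left_mono) auto
      then show ?thesis using Cf(2)[OF PE \<phi>(1)] by (simp add: p_def mult_ac)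
    qed
    have sum_le: "(\<Sum>\<xi>\<in>F. p \<xi>) \<le> C * (\<Lambda> * (1 + Q) * n)" if F: "finite F" "F \<subseteq> integer_lattice" for F
    proof -
      define F1 where "F1 = F \<inter> ?near"
      define F2 where "F2 = (F - ?near) \<inter> {0}"
      define F3 where "F3 = F - ?near - {0}"
      have "F = F1 \<union> (F2 \<union> F3)" "F1 \<inter> (F2 \<union> F3) = {}" "F2 \<inter> F3 = {}" by (auto simp: F1_def F2_def F3_def)
      then have split: "(\<Sum>\<xi>\<in>F. p \<xi>) = (\<Sum>\<xi>\<in>F1. p \<xi>) + ((\<Sum>\<xi>\<in>F2. p \<xi>) + (\<Sum>\<xi>\<in>F3. p \<xi>))"
        using F(1) by (metis finite_Un sum.union_disjoint)
      have lat: "F1 \<subseteq> integer_lattice" "F2 \<subseteq> integer_lattice" "finite F1" "finite F2"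
        using F by (auto simp: F1_def F2_def)
      have cs: "(\<Sum>\<xi>\<in>G. p \<xi>) \<le> sqrt (real (card G)) * (Cn * \<rho> ^ length l * n)"
        if G: "finite G" "G \<subseteq> integer_lattice" "\<rho> \<ge> 1" "\<forall>\<xi>\<in>G. norm \<xi> \<le> \<rho>" for G \<rho>
      proof -
        have "(\<Sum>\<xi>\<in>G. \<bar>1\<bar> * \<bar>p \<xi>\<bar>) \<le> L2_set (\<lambda>_. 1) G * L2_set p G" by (rule L2_set_mult_ineq)
        also have "L2_set (\<lambda>_. 1::real) G = sqrt (real (card G))" by (simp add: L2_set_def)
        also have "sqrt (real (card G)) * L2_set p G \<le> sqrt (real (card G)) * (Cn * \<rho> ^ length l * n)"
          unfolding p_def n_def by (intro mult_left_mono Cn(2)[OF \<phi>(2) \<psi>] G) auto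
        finally show ?thesis by (simp add: p_def)
      qed
      have "(\<Sum>\<xi>\<in>F1. p \<xi>) \<le> sqrt (real (card F1)) * (Cn * R ^ length l * n)"
        by (intro cs lat R) (auto simp: F1_def R_def intro: C1(2)[OF z])
      also have "\<dots> \<le> Q * (Cn * R ^ length l * n)"
        unfolding Q_def F1_def using Cn(1) R n fin by (intro mult_right_mono real_sqrt_le_mono) (auto intro: card_mono)
      also have "\<dots> = Cn * C1 ^ length l * (\<Lambda> * Q * n)" by (simp add: Rpow)
      also have "\<dots> \<le> Cn * C1 ^ length l * (\<Lambda> * (1 + Q) * n)"
        using Cn(1) C1(1) \<Lambda> n by (intro mult_left_mono mult_right_mono) auto
      finally have s1: "(\<Sum>\<xi>\<in>F1. p \<xi>) \<le> Cn * C1 ^ length l * (\<Lambda> * (1 + Q) * n)" .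
      have one: "1 \<le> \<Lambda> * (1 + Q)" using \<Lambda> Q by (metis add_increasing2 mult_mono' mult_1 order_refl zero_le_one)
      have n_le: "n \<le> \<Lambda> * (1 + Q) * n" using le_mult_of_one_le[OF one n] .
      have "card F2 \<le> 1" using card_mono[of "{0}" F2] by (simp add: F2_def)
      then have "sqrt (real (card F2)) \<le> 1" by simp
      then have "sqrt (real (card F2)) * (Cn * 1 ^ length l * n) \<le> 1 * (Cn * 1 ^ length l * n)"
        using Cn(1) n by (intro mult_right_mono) auto
      moreover have "(\<Sum>\<xi>\<in>F2. p \<xi>) \<le> sqrt (real (card F2)) * (Cn * 1 ^ length l * n)"
        by (intro cs lat) (auto simp: F2_def)
      ultimately have "(\<Sum>\<xi>\<in>F2. p \<xi>) \<le> Cn * n" by simp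
      also have "\<dots> \<le> Cn * (\<Lambda> * (1 + Q) * n)" using Cn(1) n_le by (rule mult_left_mono[rotated])
      finally have s2: "(\<Sum>\<xi>\<in>F2. p \<xi>) \<le> Cn * (\<Lambda> * (1 + Q) * n)" .
      have far: "far_frequency m c \<delta> z \<xi>" if "\<xi> \<in> F3" for \<xi>
        using that F(2) by (auto simp: F3_def far_frequency_def near_lattice_points_def integer_lattice_def)
      have "(\<Sum>\<xi>\<in>F3. p \<xi>) \<le> (\<Sum>\<xi>\<in>F3. Cf * n * (1 / norm \<xi> ^ (2 * d)))"
        by (intro sum_mono p_far far)
      also have "\<dots> = Cf * n * (\<Sum>\<xi>\<in>F3. 1 / norm \<xi> ^ (2 * d))" by (simp add: sum_distrib_left)
      also have "\<dots> \<le> Cf * n * S"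
        using F Cf(1) n by (intro mult_left_mono S) (auto simp: F3_def)
      also have "\<dots> \<le> Cf * S * (\<Lambda> * (1 + Q) * n)"
        using mult_left_mono[OF n_le, of "Cf * S"] Cf(1) S0 by (simp add: mult_ac)
      finally have s3: "(\<Sum>\<xi>\<in>F3. p \<xi>) \<le> Cf * S * (\<Lambda> * (1 + Q) * n)" .
      show ?thesis unfolding split C_def distrib_right using s1 s2 s3 by linarith
    qed
    let ?f = "\<lambda>y. \<phi> y * iter_D l \<psi> y"
    have "(2 * pi) ^ CARD('n) * norm (?f x) \<le> C * (\<Lambda> * (1 + Q) * n)"
    proof (rule norm_le_sum_fourier_coeff)
      show "continuous_on UNIV ?f" by (rule test_fun_times_continuous[OF \<phi>(1) continuous_iter_D[OF \<psi>] r(1)])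
      show "?f y = 0" if "y \<notin> period_cube x" for y
      proof -
        have "y \<notin> cball x (r / 2)" using that cball_subset_period_cube[OF r(2), of x] by blast
        then show ?thesis using test_fun_zero[OF \<phi>(1)] by simp
      qed
      show "(\<Sum>\<xi>\<in>F. norm (fourier_coeff ?f \<xi>)) \<le> C * (\<Lambda> * (1 + Q) * n)" if "finite F" "F \<subseteq> integer_lattice" for F
        using sum_le[OF that] by (simp add: p_def pairing_def)
    qed
    moreover have "?f x = iter_D l \<psi> x" by (simp add: \<phi>_def cutoff_profile_def)
    moreover have "norm (iter_D l \<psi> x) \<le> (2 * pi) ^ CARD('n) * norm (iter_D l \<psi> x)"
      using pi_ge_two by (intro le_mult_of_one_le one_le_power) auto
    ultimately show ?thesis by (simp add: \<Lambda>_def Q_def n_def)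
  qed
  ultimately show ?thesis by blast
qed

lemma open_inner_region:
  fixes \<Omega> :: "'a::euclidean_space set"
  assumes "open \<Omega>" "r > 0"
  shows "open (inner_region \<Omega> r)"
proof (rule openI)
  fix x assume "x \<in> inner_region \<Omega> r"
  then have sub: "cball x r \<subseteq> \<Omega>" by (simp add: inner_region_def)
  obtain e where e: "e > 0" "(\<Union>w\<in>cball x r. ball w e) \<subseteq> \<Omega>"
    using compact_subset_open_imp_ball_epsilon_subset[OF compact_cball assms(1) sub] by blast
  have "y \<in> inner_region \<Omega> r" if "y \<in> ball x e" for y
  proof -
    have "w \<in> \<Omega>" if w: "w \<in> cball y r" for w
    proof (rule subsetD[OF e(2)], rule UN_I)
      show "w - y + x \<in> cball x r" using w by (simp add: dist_norm norm_minus_commute)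
      show "w \<in> ball (w - y + x) e" using \<open>y \<in> ball x e\<close> by (simp add: dist_norm algebra_simps)
    qed
    then show ?thesis using assms(2) by (auto simp: inner_region_def)
  qed
  then show "\<exists>e>0. ball x e \<subseteq> inner_region \<Omega> r" using e(1) by blast
qed

lemma local_norm_le_L2_norm:
  fixes \<psi> :: "real^'n::finite \<Rightarrow> complex"
  assumes "continuous_on (cball x (r / 2)) \<psi>" "cball x (r / 2) \<subseteq> \<Omega>" "square_integrable_on \<psi> \<Omega>"
  shows "local_norm x r \<psi> \<le> L2_norm \<Omega> \<psi>"
proof -
  let ?g = "\<lambda>y. indicator (cball x (r / 2)) y *\<^sub>R (norm (\<psi> y))\<^sup>2"
  have I: "integrable lborel ?g"
    by (intro integrable_on_compact continuous_intros assms) auto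
  have "(LINT y|lborel. ?g y) = (LINT y|lebesgue. ?g y)"
    using I by (intro integral_completion[symmetric]) auto
  also have "\<dots> \<le> (LINT y|lebesgue. indicator \<Omega> y *\<^sub>R (norm (\<psi> y))\<^sup>2)"
  proof (rule integral_mono)
    show "integrable lebesgue ?g" using I by (simp add: integrable_completion borel_measurable_integrable)
    show "integrable lebesgue (\<lambda>y. indicator \<Omega> y *\<^sub>R (norm (\<psi> y))\<^sup>2)"
      using assms(3) by (simp add: square_integrable_on_def set_integrable_def)
  qed (use assms(2) in \<open>auto simp: indicator_def\<close>)
  finally show ?thesis
    by (simp add: local_norm_def L2_norm_def set_lebesgue_integral_def)
qed

text \<open>
Nonzero lattice points have norm at least 1, and at the origin both powers are 0.
\<close>

lemma near_lattice_points_mono: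
  assumes "\<delta> \<le> \<delta>'"
  shows "near_lattice_points m c \<delta> z \<subseteq> near_lattice_points m c \<delta>' z"
proof
  fix \<xi> assume \<xi>: "\<xi> \<in> near_lattice_points m c \<delta> z"
  have "norm \<xi> powr (real m - 1 + \<delta>) \<le> norm \<xi> powr (real m - 1 + \<delta>')"
  proof (cases "\<xi> = 0")
    case False
    then have "norm \<xi> \<ge> 1" using \<xi> by (intro integer_lattice_norm_ge_1) (auto simp: near_lattice_points_def integer_lattice_def)
    then show ?thesis using assms by (intro powr_mono) auto
  qed simp
  then show "\<xi> \<in> near_lattice_points m c \<delta>' z" using \<xi> by (auto simp: near_lattice_points_def)
qed

theorem corollary2:
  fixes m :: nat
    and c :: "'n::{finite,linorder} multi_index \<Rightarrow> complex"
    and \<delta> r :: real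
    and \<gamma> :: "'n multi_index"
    and M :: "'n multi_index \<Rightarrow> real"
  assumes "m \<ge> 1"
    and "elliptic m c"
    and "\<delta> > 0"
    and "r > 0"
    and "\<And>\<beta>. M \<beta> \<ge> 0"
  shows "\<exists>C::real. C \<ge> 0 \<and>
    (\<forall>(\<Omega> :: (real^'n::{finite,linorder}) set) (V :: real^'n::{finite,linorder} \<Rightarrow> complex) (z :: complex) (\<psi> :: real^'n::{finite,linorder} \<Rightarrow> complex).
      open \<Omega> \<longrightarrow>
      smooth_on \<Omega> V \<longrightarrow>
      (\<forall>\<beta>. \<forall>x\<in>\<Omega>. norm (D_multi \<beta> V x) \<le> M \<beta>) \<longrightarrow>
      norm z \<ge> 1 \<longrightarrow>
      smooth_on \<Omega> \<psi> \<longrightarrow>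
      (\<forall>x\<in>\<Omega>. diff_op m c \<psi> x + V x * \<psi> x = z * \<psi> x) \<longrightarrow>
      finite (near_lattice_points m c \<delta> z) \<longrightarrow>
      square_integrable_on \<psi> \<Omega> \<longrightarrow>
      Linf_norm (inner_region \<Omega> r) (D_multi \<gamma> \<psi>)
        \<le> ennreal (C * norm z powr (real (mi_abs \<gamma>) / real m)
             * (1 + sqrt (real (card (near_lattice_points m c \<delta> z))))
             * L2_norm \<Omega> \<psi>))"
proof -
  define s where "s = min r 1"
  define \<epsilon> where "\<epsilon> = min \<delta> (1 / 2)"
  have s: "0 < s" "s \<le> 1" "s \<le> r" using assms(4) by (auto simp: s_def)
  have \<epsilon>: "0 < \<epsilon>" "\<epsilon> \<le> 1 / 2" "\<epsilon> \<le> \<delta>" using assms(3) by (auto simp: \<epsilon>_def)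
  define B where "B n = (\<Sum>\<beta> | mi_abs \<beta> = n. M \<beta>)" for n
  obtain C where C: "C \<ge> 0" "\<And>x V z \<psi>. \<lbrakk>schroedinger_on m c B (ball x s) V z \<psi>; norm z \<ge> 1;
    finite (near_lattice_points m c \<epsilon> z)\<rbrakk> \<Longrightarrow>
    norm (iter_D (mi_list \<gamma>) \<psi> x) \<le> C * (norm z powr (real (length (mi_list \<gamma>)) / real m) *
      (1 + sqrt (real (card (near_lattice_points m c \<epsilon> z)))) * local_norm x s \<psi>)"
    using local_derivative_estimate[OF s(1,2) assms(1,2) \<epsilon>(1,2), of B "mi_list \<gamma>"] by blast
  show ?thesis
  proof (intro exI[of _ C] conjI C(1) allI impI)
    fix \<Omega> :: "(real^'n::{finite,linorder}) set" and V :: "real^'n::{finite,linorder} \<Rightarrow> complex" and z :: complex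
      and \<psi> :: "real^'n::{finite,linorder} \<Rightarrow> complex"
    assume \<Omega>: "open \<Omega>" and V: "smooth_on \<Omega> V" "\<forall>\<beta>. \<forall>x\<in>\<Omega>. norm (D_multi \<beta> V x) \<le> M \<beta>"
      and z: "norm z \<ge> 1" and \<psi>: "smooth_on \<Omega> \<psi>"
      and eq: "\<forall>x\<in>\<Omega>. diff_op m c \<psi> x + V x * \<psi> x = z * \<psi> x"
      and fin: "finite (near_lattice_points m c \<delta> z)" and sq: "square_integrable_on \<psi> \<Omega>"
    let ?bound = "C * norm z powr (real (mi_abs \<gamma>) / real m)
             * (1 + sqrt (real (card (near_lattice_points m c \<delta> z)))) * L2_norm \<Omega> \<psi>"
    note sub = near_lattice_points_mono[OF \<epsilon>(3), of m c z]
    have fin': "finite (near_lattice_points m c \<epsilon> z)" using finite_subset[OF sub fin] .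
    have card: "card (near_lattice_points m c \<epsilon> z) \<le> card (near_lattice_points m c \<delta> z)"
      by (rule card_mono[OF fin sub])
    have VB: "C_bounded k B \<Omega> V" for k
      unfolding B_def using C_bounded_of_D_multi[OF \<Omega> V(1), of M k] assms(5) V(2) by auto
    have pointwise: "norm (D_multi \<gamma> \<psi> x) \<le> ?bound" if "x \<in> inner_region \<Omega> r" for x
    proof -
      have ball: "cball x r \<subseteq> \<Omega>" using that by (simp add: inner_region_def)
      have bs: "ball x s \<subseteq> \<Omega>" "cball x (s / 2) \<subseteq> \<Omega>" using ball s by (auto simp: subset_iff)
      have H: "schroedinger_on m c B (ball x s) V z \<psi>"
        unfolding schroedinger_on_def
        using VB C_bounded_subset[OF _ bs(1)] smooth_on_subset[OF \<psi> bs(1)] eq bs(1) by blast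
      have L: "local_norm x s \<psi> \<le> L2_norm \<Omega> \<psi>"
        by (intro local_norm_le_L2_norm bs(2) sq continuous_on_subset[OF smooth_on_continuous[OF \<psi>]])
      have "norm (D_multi \<gamma> \<psi> x) \<le> C * (norm z powr (real (mi_abs \<gamma>) / real m) *
          (1 + sqrt (real (card (near_lattice_points m c \<epsilon> z)))) * local_norm x s \<psi>)"
        using C(2)[OF H z fin'] by (simp add: D_multi_eq_iter_D length_mi_list)
      also have "\<dots> \<le> C * (norm z powr (real (mi_abs \<gamma>) / real m) *
          (1 + sqrt (real (card (near_lattice_points m c \<delta> z)))) * L2_norm \<Omega> \<psi>)"
        using C(1) L card local_norm_nonneg[of x s \<psi>]
        by (intro mult_left_mono mult_mono add_mono real_sqrt_le_mono) auto
      finally show ?thesis by (simp add: mult.assoc)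
    qed
    have "continuous_on (inner_region \<Omega> r) (D_multi \<gamma> \<psi>)"
      unfolding D_multi_eq_iter_D
      by (rule continuous_on_subset[OF smooth_on_continuous[OF smooth_on_iter_D[OF \<Omega> \<psi>]]]) (auto simp: inner_region_def)
    then have meas: "D_multi \<gamma> \<psi> \<in> borel_measurable (lebesgue_on (inner_region \<Omega> r))"
      using open_inner_region[OF \<Omega> assms(4)] by (intro continuous_imp_measurable_on_sets_lebesgue) auto
    show "Linf_norm (inner_region \<Omega> r) (D_multi \<gamma> \<psi>) \<le> ennreal ?bound"
      unfolding Linf_norm_def
    proof (rule esssup_I)
      show "(\<lambda>x. ennreal (norm (D_multi \<gamma> \<psi> x))) \<in> borel_measurable (lebesgue_on (inner_region \<Omega> r))"
        using meas by measurable
      show "AE x in lebesgue_on (inner_region \<Omega> r). ennreal (norm (D_multi \<gamma> \<psi> x)) \<le> ennreal ?bound"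
        by (rule AE_I2) (auto intro!: ennreal_leI pointwise)
    qed
  qed
qed

end
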